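(* Let $\mathbb{P}_d$ be a finite classical polar space of rank $d$ over $\mathbb{F}_q$ with parameter $e$, let $L$ be a $(d-1)$-dimensional subspace of $\mathbb{P}_d$, let $P_1,\dots,P_{q^e+1}$ be the generators containing $L$, and for each $i\in\{1,\dots,q^e+1\}$ let $\sigma_i$ be a permutation of the set of affine hyperplanes of $\tilde P_i=P_i\setminus L$ that preserves the parallel classes. Then the graph $\Gamma(L,\sigma_1,\dots,\sigma_{q^e+1})$ is strongly regular with parameters $(v_0,k_0,\lambda_0,\mu_0)$, where $$v_0=(q^{d-1+e}+1)[d],\qquad k_0=q(q^{d-2+e}+1)[d-1],$$ $$\lambda_0=q-1+q^2(q^{d-3+e}+1)[d-2],\qquad \mu_0=(q^{d-2+e}+1)[d-1].$$ That is, it has $v_0$ vertices, every vertex has exactly $k_0$ neighbors, any two distinct adjacent vertices have exactly $\lambda_0$ common neighbors, and any two distinct non-adjacent vertices have exactly $\mu_0$ common neighbors.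
   Context: Polar spaces. Let $q$ be a prime power and $d\ge 1$. A finite classical polar space $\mathbb{P}_d$ of rank $d$ consists of the isotropic subspaces of a finite vector space $V$ with a form, of one of six types, each with a parameter $e$: $O^+(2d,q)$: $V=\mathbb{F}_q^{2d}$, quadratic form $x_1x_2+\dots+x_{2d-1}x_{2d}$, $e=0$; $O(2d+1,q)$: $V=\mathbb{F}_q^{2d+1}$, quadratic form $x_1^2+x_2x_3+\dots+x_{2d}x_{2d+1}$, $e=1$; $O^-(2d+2,q)$: $V=\mathbb{F}_q^{2d+2}$, quadratic form $f(x_1,x_2)+x_3x_4+\dots+x_{2d+1}x_{2d+2}$ with $f$ a homogeneous quadratic polynomial irreducible over $\mathbb{F}_q$, $e=2$; $Sp(2d,q)$: $V=\mathbb{F}_q^{2d}$, symplectic form $x_1y_2-x_2y_1+\dots+x_{2d-1}y_{2d}-x_{2d}y_{2d-1}$, $e=1$; for $q$ a square, $U(2d,q)$: $V=\mathbb{F}_q^{2d}$, Hermitian form $\sum_i x_iy_i^{\sqrt q}$, $e=1/2$; and $U(2d+1,q)$: $V=\mathbb{F}_q^{2d+1}$, Hermitian form $\sum_i x_iy_i^{\sqrt q}$, $e=3/2$. A subspace of $V$ is isotropic if the form vanishes identically on it; isotropic subspaces are called subspaces of $\mathbb{P}_d$. Dimensions are vector space dimensions. Points are $1$-dimensional, and lines $2$-dimensional, subspaces of $\mathbb{P}_d$; generators are the maximal isotropic subspaces, all of dimension $d$. Subspaces are identified with their sets of points. For a subspace $S$ of $\mathbb{P}_d$, $S^\perp$ is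 the set of points $p$ of $\mathbb{P}_d$ with $\langle S,p\rangle$ isotropic. Write $[n]=(q^n-1)/(q-1)$. Construction of $\Gamma(L,\sigma_1,\dots,\sigma_{q^e+1})$. Let $X$ be the set of points of $\mathbb{P}_d$ and $L$ a $(d-1)$-dimensional subspace of $\mathbb{P}_d$. Then $L$ lies in exactly $q^e+1$ generators $P_1,\dots,P_{q^e+1}$. Let $\tilde P_i=P_i\setminus L$ be the affine geometry with $L$ as hyperplane at infinity: its hyperplanes are the sets $H\setminus L$ with $H\neq L$ a $(d-1)$-dimensional subspace of $P_i$, and $H\setminus L$, $H'\setminus L$ are in the same parallel class iff $H\cap L=H'\cap L$. Let $Z$ be the set of points of $\mathbb{P}_d$ not in $L^\perp$; thus $X$ is the disjoint union of $L$, $\tilde P_1,\dots,\tilde P_{q^e+1}$ and $Z$. Each $\sigma_i$ is a permutation (not necessarily induced by a collineation) of the set of hyperplanes of $\tilde P_i$ mapping every parallel class onto itself. For $z\in Z$, $z^\perp\cap P_i$ is a $(d-1)$-dimensional subspace of $P_i$ different from $L$, so $z^\perp\cap\tilde P_i$ is a hyperplane of $\tilde P_i$. The graph $\Gamma(L,\sigma_1,\dots,\sigma_{q^e+1})$ has vertex set $X$; distinct vertices $x,y$ are adjacent as follows: if $x\in\tilde P_i$ and $y\in Z$ (or vice versa, by symmetry), they are adjacent iff $x\in(y^\perp\cap\tilde P_i)^{\sigma_i}$; in all other cases they are adjacent iff $x\in y^\perp$. *)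

theory Defs
  imports
    "HOL-Analysis.Analysis"
    "HOL-Computational_Algebra.Polynomial"
    "HOL-Library.Discrete_Functions"
begin

section \<open>The six types of finite classical polar spaces\<close>

text \<open>
  The ground field is the type \<^typ>\<open>'a\<close> of class \<open>{field, finite}\<close>, with \<open>q = CARD('a)\<close>.
  The arguments of \<open>O_minus a b c\<close> are the coefficients of
  \<open>f(x\<^sub>1, x\<^sub>2) = a x\<^sub>1\<^sup>2 + b x\<^sub>1 x\<^sub>2 + c x\<^sub>2\<^sup>2\<close>.
\<close>

datatype 'a polar_type =
    O_plus            \<comment> \<open>\<open>O\<^sup>+(2d,q)\<close>\<close>
  | O_parabolic       \<comment> \<open>\<open>O(2d+1,q)\<close>\<close>
  | O_minus 'a 'a 'a  \<comment> \<open>\<open>O\<^sup>-(2d+2,q)\<close>\<close>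
  | Symplectic        \<comment> \<open>\<open>Sp(2d,q)\<close>\<close>
  | U_even            \<comment> \<open>\<open>U(2d,q)\<close>\<close>
  | U_odd             \<comment> \<open>\<open>U(2d+1,q)\<close>\<close>

fun polar_dim :: "'a polar_type \<Rightarrow> nat \<Rightarrow> nat" where
  "polar_dim O_plus d = 2 * d"
| "polar_dim O_parabolic d = 2 * d + 1"
| "polar_dim (O_minus _ _ _) d = 2 * d + 2"
| "polar_dim Symplectic d = 2 * d"
| "polar_dim U_even d = 2 * d"
| "polar_dim U_odd d = 2 * d + 1"

fun polar_e :: "'a polar_type \<Rightarrow> real" where
  "polar_e O_plus = 0"
| "polar_e O_parabolic = 1"
| "polar_e (O_minus _ _ _) = 2"
| "polar_e Symplectic = 1"
| "polar_e U_even = 1 / 2"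
| "polar_e U_odd = 3 / 2"

text \<open>
  The polynomial \<open>a X\<^sup>2 + b X Y + c Y\<^sup>2\<close> as an element of \<open>F[X][Y]\<close>: the outer
  polynomial variable is \<open>Y\<close>, the inner one is \<open>X\<close>.
\<close>

definition binary_quadratic :: "'a::comm_ring_1 \<Rightarrow> 'a \<Rightarrow> 'a \<Rightarrow> 'a poly poly" where
  "binary_quadratic a b c = [: [:0, 0, a:], [:0, b:], [:c:] :]"

fun polar_admissible :: "'a::{field,finite} polar_type \<Rightarrow> bool" where
  "polar_admissible O_plus \<longleftrightarrow> True"
| "polar_admissible O_parabolic \<longleftrightarrow> True"
| "polar_admissible (O_minus a b c) \<longleftrightarrow> irreducible (binary_quadratic a b c)"
| "polar_admissible Symplectic \<longleftrightarrow> True"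
| "polar_admissible U_even \<longleftrightarrow> (\<exists>s. CARD('a) = s\<^sup>2)"
| "polar_admissible U_odd \<longleftrightarrow> (\<exists>s. CARD('a) = s\<^sup>2)"

text \<open>
  The vector space is \<^typ>\<open>'a ^ 'n\<close>. Since the index type \<^typ>\<open>'n\<close> carries no order, the
  coordinates are numbered by a map \<open>\<iota> :: nat \<Rightarrow> 'n\<close>, required in use to be a bijection
  from \<open>{1..CARD('n)}\<close>; the \<open>j\<close>-th coordinate of \<open>x\<close> is \<open>x $ \<iota> j\<close>. The argument \<open>s\<close>
  of \<open>hyperbolic_part\<close> is the number of coordinates preceding the hyperbolic pairs.
\<close>

definition hyperbolic_part :: "(nat \<Rightarrow> 'n) \<Rightarrow> nat \<Rightarrow> nat \<Rightarrow> 'a::{field,finite} ^ 'n::finite \<Rightarrow> 'a" where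
  "hyperbolic_part \<iota> s d x = (\<Sum>i=1..d. x $ \<iota> (s + 2 * i - 1) * x $ \<iota> (s + 2 * i))"

definition symplectic_form ::
    "(nat \<Rightarrow> 'n) \<Rightarrow> nat \<Rightarrow> 'a::{field,finite} ^ 'n::finite \<Rightarrow> 'a ^ 'n \<Rightarrow> 'a" where
  "symplectic_form \<iota> d x y =
     (\<Sum>i=1..d. x $ \<iota> (2 * i - 1) * y $ \<iota> (2 * i) - x $ \<iota> (2 * i) * y $ \<iota> (2 * i - 1))"

definition hermitian_form :: "'a::{field,finite} ^ 'n::finite \<Rightarrow> 'a ^ 'n \<Rightarrow> 'a" where
  "hermitian_form x y = (\<Sum>i\<in>UNIV. x $ i * (y $ i) ^ floor_sqrt CARD('a))"

fun form_vanishes ::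
    "'a::{field,finite} polar_type \<Rightarrow> nat \<Rightarrow> (nat \<Rightarrow> 'n) \<Rightarrow> ('a ^ 'n::finite) set \<Rightarrow> bool" where
  "form_vanishes O_plus d \<iota> S \<longleftrightarrow>
     (\<forall>x\<in>S. hyperbolic_part \<iota> 0 d x = 0)"
| "form_vanishes O_parabolic d \<iota> S \<longleftrightarrow>
     (\<forall>x\<in>S. (x $ \<iota> 1)\<^sup>2 + hyperbolic_part \<iota> 1 d x = 0)"
| "form_vanishes (O_minus a b c) d \<iota> S \<longleftrightarrow>
     (\<forall>x\<in>S. a * (x $ \<iota> 1)\<^sup>2 + b * x $ \<iota> 1 * x $ \<iota> 2 + c * (x $ \<iota> 2)\<^sup>2
              + hyperbolic_part \<iota> 2 d x = 0)"
| "form_vanishes Symplectic d \<iota> S \<longleftrightarrow>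
     (\<forall>x\<in>S. \<forall>y\<in>S. symplectic_form \<iota> d x y = 0)"
| "form_vanishes U_even d \<iota> S \<longleftrightarrow>
     (\<forall>x\<in>S. \<forall>y\<in>S. hermitian_form x y = 0)"
| "form_vanishes U_odd d \<iota> S \<longleftrightarrow>
     (\<forall>x\<in>S. \<forall>y\<in>S. hermitian_form x y = 0)"

text \<open>A polar space is represented by its set of subspaces (as sets of vectors, \<open>{0}\<close> included).\<close>

definition polar_space ::
    "'a::{field,finite} polar_type \<Rightarrow> nat \<Rightarrow> (nat \<Rightarrow> 'n) \<Rightarrow> ('a ^ 'n::finite) set set" where
  "polar_space ty d \<iota> = {S. vec.subspace S \<and> form_vanishes ty d \<iota> S}"


section \<open>Points, generators, perpendicularity\<close>

definition points :: "('a::{field,finite} ^ 'n::finite) set set \<Rightarrow> ('a ^ 'n) set set" where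
  "points \<P> = {p \<in> \<P>. vec.dim p = 1}"

definition points_of ::
    "('a::{field,finite} ^ 'n::finite) set set \<Rightarrow> ('a ^ 'n) set \<Rightarrow> ('a ^ 'n) set set" where
  "points_of \<P> S = {p \<in> points \<P>. p \<subseteq> S}"

definition generators :: "('a::{field,finite} ^ 'n::finite) set set \<Rightarrow> ('a ^ 'n) set set" where
  "generators \<P> = {P \<in> \<P>. \<forall>S\<in>\<P>. P \<subseteq> S \<longrightarrow> S = P}"

definition perp ::
    "('a::{field,finite} ^ 'n::finite) set set \<Rightarrow> ('a ^ 'n) set \<Rightarrow> ('a ^ 'n) set set" where
  "perp \<P> S = {p \<in> points \<P>. vec.span (S \<union> p) \<in> \<P>}"


section \<open>The affine geometries \<open>P \<setminus> L\<close>\<close>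

definition affine_part ::
    "('a::{field,finite} ^ 'n::finite) set set \<Rightarrow> ('a ^ 'n) set \<Rightarrow> ('a ^ 'n) set \<Rightarrow> ('a ^ 'n) set set" where
  "affine_part \<P> L S = points_of \<P> S - points_of \<P> L"

text \<open>The \<open>(d-1)\<close>-dimensional subspaces of \<open>P\<close> other than \<open>L\<close>.\<close>

definition proper_hyperplanes ::
    "nat \<Rightarrow> ('a::{field,finite} ^ 'n::finite) set \<Rightarrow> ('a ^ 'n) set \<Rightarrow> ('a ^ 'n) set set" where
  "proper_hyperplanes d L P = {H. vec.subspace H \<and> H \<subseteq> P \<and> vec.dim H = d - 1 \<and> H \<noteq> L}"

definition affine_hyperplanes ::
    "('a::{field,finite} ^ 'n::finite) set set \<Rightarrow> nat \<Rightarrow> ('a ^ 'n) set \<Rightarrow> ('a ^ 'n) set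
       \<Rightarrow> ('a ^ 'n) set set set" where
  "affine_hyperplanes \<P> d L P = affine_part \<P> L ` proper_hyperplanes d L P"

definition parallel_class ::
    "('a::{field,finite} ^ 'n::finite) set set \<Rightarrow> nat \<Rightarrow> ('a ^ 'n) set \<Rightarrow> ('a ^ 'n) set
       \<Rightarrow> ('a ^ 'n) set set \<Rightarrow> ('a ^ 'n) set set set" where
  "parallel_class \<P> d L P A =
     {affine_part \<P> L H' | H H'. H \<in> proper_hyperplanes d L P \<and> H' \<in> proper_hyperplanes d L P
        \<and> A = affine_part \<P> L H \<and> H \<inter> L = H' \<inter> L}"

definition parallel_preserving_permutation ::
    "('a::{field,finite} ^ 'n::finite) set set \<Rightarrow> nat \<Rightarrow> ('a ^ 'n) set \<Rightarrow> ('a ^ 'n) set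
       \<Rightarrow> (('a ^ 'n) set set \<Rightarrow> ('a ^ 'n) set set) \<Rightarrow> bool" where
  "parallel_preserving_permutation \<P> d L P \<sigma> \<longleftrightarrow>
     bij_betw \<sigma> (affine_hyperplanes \<P> d L P) (affine_hyperplanes \<P> d L P) \<and>
     (\<forall>A\<in>affine_hyperplanes \<P> d L P. \<sigma> ` parallel_class \<P> d L P A = parallel_class \<P> d L P A)"


section \<open>The graph \<open>\<Gamma>(L, \<sigma>\<^sub>1, \<dots>, \<sigma>\<^sub>N)\<close>\<close>

text \<open>
  The graph has vertex set \<^term>\<open>points \<P>\<close>. The generators through \<open>L\<close> are
  enumerated as \<open>P 1, \<dots>, P N\<close>; the number \<open>N\<close> is determined by this (it equals \<open>q\<^sup>e + 1\<close>).
\<close>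

definition affine_adjacent ::
    "('a::{field,finite} ^ 'n::finite) set set \<Rightarrow> ('a ^ 'n) set \<Rightarrow> nat \<Rightarrow> (nat \<Rightarrow> ('a ^ 'n) set)
       \<Rightarrow> (nat \<Rightarrow> ('a ^ 'n) set set \<Rightarrow> ('a ^ 'n) set set) \<Rightarrow> ('a ^ 'n) set \<Rightarrow> ('a ^ 'n) set \<Rightarrow> bool" where
  "affine_adjacent \<P> L N P \<sigma> x y \<longleftrightarrow>
     (\<exists>i\<in>{1..N}. x \<in> affine_part \<P> L (P i) \<and> x \<in> \<sigma> i (perp \<P> y \<inter> affine_part \<P> L (P i)))"

definition Gamma_adjacent ::
    "('a::{field,finite} ^ 'n::finite) set set \<Rightarrow> ('a ^ 'n) set \<Rightarrow> nat \<Rightarrow> (nat \<Rightarrow> ('a ^ 'n) set)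
       \<Rightarrow> (nat \<Rightarrow> ('a ^ 'n) set set \<Rightarrow> ('a ^ 'n) set set) \<Rightarrow> ('a ^ 'n) set \<Rightarrow> ('a ^ 'n) set \<Rightarrow> bool" where
  "Gamma_adjacent \<P> L N P \<sigma> x y \<longleftrightarrow>
     (let A = (\<Union>i\<in>{1..N}. affine_part \<P> L (P i));
          Z = points \<P> - perp \<P> L
      in x \<noteq> y \<and>
         (if x \<in> A \<and> y \<in> Z then affine_adjacent \<P> L N P \<sigma> x y
          else if x \<in> Z \<and> y \<in> A then affine_adjacent \<P> L N P \<sigma> y x
          else x \<in> perp \<P> y))"


section \<open>Strongly regular graphs\<close>

text \<open>
  The parameters are real numbers because they are given by expressions such as
  \<open>q\<^sup>2(q\<^bsup>d-3+e\<^esup> + 1)[d - 2]\<close> with a half-integer \<open>e\<close>; for \<open>d = 1\<close> the number \<open>\<lambda>\<close> is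
  negative, but then there are no edges.
\<close>

definition strongly_regular ::
    "'v set \<Rightarrow> ('v \<Rightarrow> 'v \<Rightarrow> bool) \<Rightarrow> real \<Rightarrow> real \<Rightarrow> real \<Rightarrow> real \<Rightarrow> bool" where
  "strongly_regular V adj v k l m \<longleftrightarrow>
     finite V \<and>
     (\<forall>x\<in>V. \<not> adj x x) \<and>
     (\<forall>x\<in>V. \<forall>y\<in>V. adj x y \<longrightarrow> adj y x) \<and>
     real (card V) = v \<and>
     (\<forall>x\<in>V. real (card {z\<in>V. adj x z}) = k) \<and>
     (\<forall>x\<in>V. \<forall>y\<in>V. x \<noteq> y \<and> adj x y \<longrightarrow> real (card {z\<in>V. adj x z \<and> adj y z}) = l) \<and>
     (\<forall>x\<in>V. \<forall>y\<in>V. x \<noteq> y \<and> \<not> adj x y \<longrightarrow> real (card {z\<in>V. adj x z \<and> adj y z}) = m)"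

text \<open>\<open>[n] = (q\<^sup>n - 1) / (q - 1)\<close>, for integer \<open>n\<close> since \<open>[d - 2]\<close> with \<open>d = 1\<close> occurs.\<close>

definition qbracket :: "real \<Rightarrow> int \<Rightarrow> real" where
  "qbracket q n = (q powi n - 1) / (q - 1)"

end

(* A polar space is handled through one invariant of its form: for an isotropic vector x and any y
   not perpendicular to x, the affine line y + <x> contains a constant number kappa of isotropic
   vectors (1 for quadratic, q for symplectic and sqrt q for Hermitian forms), and
   kappa * q^n = q^(2d) * q^e. Peeling a generator off one vector at a time, this determines the
   number of isotropic vectors in the perp of every isotropic subspace, hence the dimension of the
   generators and the strong regularity of the collinearity graph.

   Switching by sigma changes only adjacencies between the affine parts A_i and Z. A sum over Z of
   a condition on the traces z^perp in A_i is a sum over hyperplanes weighted by fibre sizes, and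
   these depend only on coincidence and parallelism of hyperplanes, which sigma_i preserves. So every
   pair of vertices of Gamma has as many common neighbours as some pair of the collinearity graph
   with the same adjacency. *)

theory Submission
  imports Defs
begin

section \<open>Finite fields\<close>

text \<open>All six types in every characteristic have to fit one set of axioms. A Hermitian form is
  not linear in its second argument, isotropy is not \<open>B x x = 0\<close> for quadratic forms in
  characteristic 2, and the polar form of the parabolic type degenerates there. The numbers \<kappa>
  arise from isotropy of y + t x as an equation in t: linear for a quadratic form, always true for a
  symplectic one, and prescribing the value of a trace for a Hermitian one. Each type has to exhibit
  just one generator. In the switching argument the obstacle are pairs of x in A_i and y in Z, since
  their own adjacency may change. Their number of common neighbours depends, however, only on i, y
  and adjacency, so x is exchanged for a point of A_i that has the wanted adjacency to y in the
  collinearity graph. All fibre sizes come from one source: the number of points perpendicular to an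
  isotropic subspace, possibly cut with the perp of one more point.\<close>

lemma finite_field_power_card:
  fixes x :: "'a::{field,finite}"
  shows "x ^ CARD('a) = x"
proof (cases "x = 0")
  case False
  have "x * (\<Prod>y\<in>UNIV-{0}. x * y) = x * x ^ (CARD('a) - 1) * \<Prod>(UNIV-{0})"
    by (simp add: prod.distrib mult_ac)
  also have "x * x ^ (CARD('a) - 1) = x ^ CARD('a)"
    by (metis One_nat_def Suc_pred power_Suc zero_less_card_finite)
  \<comment> \<open>Since x \<noteq> 0, multiplication by x permutes the nonzero elements; the
    product over them is nonzero and cancels.\<close>
  also have "(\<Prod>y\<in>UNIV-{0}. x * y) = (\<Prod>y\<in>UNIV-{0}. y)"
    by (rule prod.reindex_bij_witness[of _ "\<lambda>y. y / x" "\<lambda>y. x * y"]) (use False in auto)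
  finally show ?thesis
    by simp
qed (use zero_less_card_finite[where ?'a = 'a] in auto)

text \<open>Among the additive subgroups whose order is a power of the characteristic p, a maximal
  one is the whole field: for x outside H, the p cosets of H by multiples of x would make up a
  larger one.\<close>

lemma card_field_eq_CHAR_power: "\<exists>k. CARD('a::{field,finite}) = CHAR('a) ^ k"
proof -
  let ?p = "CHAR('a)"
  have p: "prime ?p"
    by (intro prime_CHAR_semidom) (simp add: finite_imp_CHAR_pos)
  define good where "good H \<longleftrightarrow> 0 \<in> H \<and> (\<forall>x\<in>H. \<forall>y\<in>H. x - y \<in> H) \<and> (\<exists>k. card H = ?p ^ k)"
    for H :: "'a set"
  have "good {0}"
    unfolding good_def by (auto intro: exI[of _ 0])
  then obtain H where H: "good H" and max: "\<And>K. good K \<Longrightarrow> H \<subseteq> K \<Longrightarrow> K = H"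
    using finite_has_maximal[of "{H. good H}"] by auto
  have H0: "0 \<in> H" and Hd: "\<And>x y. x \<in> H \<Longrightarrow> y \<in> H \<Longrightarrow> x - y \<in> H"
    using H unfolding good_def by auto
  have Ha: "x + y \<in> H" if "x \<in> H" "y \<in> H" for x y
    using Hd[OF that(1) Hd[OF H0 that(2)]] by simp
  have Hn: "of_nat n * x \<in> H" if "x \<in> H" for n x
    by (induction n) (use H0 Ha that in \<open>auto simp: algebra_simps\<close>)
  have Hi: "of_int n * x \<in> H" if "x \<in> H" for n x
  proof (cases "n \<ge> 0")
    case True then show ?thesis using Hn[OF that, of "nat n"] by simp
  next
    case False then show ?thesis using Hd[OF H0 Hn[OF that, of "nat (-n)"]] by simp
  qed
  have "H = UNIV"
  proof (rule ccontr)
    assume "H \<noteq> UNIV"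
    then obtain x where x: "x \<notin> H" by auto
    define K where "K = (\<lambda>(h, j::nat). h + of_nat j * x) ` (H \<times> {..<?p})"
    \<comment> \<open>Any integer multiple of x may be used, since p times x is 0 and the
      coefficient can be reduced modulo p.\<close>
    have Kint: "h + of_int j * x \<in> K" if h: "h \<in> H" for h j
    proof -
      have "(of_int (j mod int ?p) :: 'a) = of_int (j mod int ?p) + of_int (int ?p) * of_int (j div int ?p)"
        by simp
      also have "\<dots> = of_int j"
        unfolding of_int_mult[symmetric] of_int_add[symmetric] by simp
      finally have "(of_nat (nat (j mod int ?p)) :: 'a) = of_int j"
        using p by (simp add: prime_gt_0_nat of_nat_nat)
      moreover have "nat (j mod int ?p) < ?p"
        using p by (simp add: prime_gt_0_nat nat_less_iff)
      ultimately show ?thesis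
        unfolding K_def using h by (intro image_eqI[of _ _ "(h, nat (j mod int ?p))"]) auto
    qed
    have inj: "inj_on (\<lambda>(h, j::nat). h + of_nat j * x) (H \<times> {..<?p})"
    proof (rule inj_onI, clarsimp)
      fix h h' and j j' :: nat
      assume a: "h \<in> H" "j < ?p" "h' \<in> H" "j' < ?p" "h + of_nat j * x = h' + of_nat j' * x"
      have "j = j'"
      proof (rule ccontr)
        assume ne: "j \<noteq> j'"
        have "\<not> int ?p dvd int j - int j'"
        proof
          assume "int ?p dvd int j - int j'"
          moreover have "\<bar>int j - int j'\<bar> < int ?p" "int j - int j' \<noteq> 0" using a ne by auto
          ultimately show False using dvd_imp_le_int[of "int j - int j'" "int ?p"] by simp
        qed
        \<comment> \<open>As j - j' is invertible modulo p, a Bezout identity recovers x itself from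
          (j - j') x in H, against the choice of x.\<close>
        then have "coprime (int j - int j') (int ?p)"
          using p by (metis coprime_commute prime_imp_coprime prime_nat_int_transfer)
        then obtain u v where uv: "u * (int j - int j') + v * int ?p = 1"
          using bezout_int[of "int j - int j'" "int ?p"] by auto
        have "(of_int (int j - int j')) * x = h' - h" using a(5) by (simp add: algebra_simps)
        then have "of_int (int j - int j') * x \<in> H" using Hd a by auto
        then have "of_int u * (of_int (int j - int j') * x) \<in> H" by (rule Hi)
        moreover have "of_int u * (of_int (int j - int j') * x) = of_int (u * (int j - int j') + v * int ?p) * x"
          by simp
        ultimately have "x \<in> H" unfolding uv by (metis mult_1 of_int_1)
        then show False using x by simp
      qed
      with a show "h = h' \<and> j = j'" by simp
    qed
    have cK: "card K = card H * ?p"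
      unfolding K_def using inj by (simp add: card_image card_cartesian_product)
    have "good K"
      unfolding good_def
    proof (intro conjI ballI)
      show "0 \<in> K" using Kint[OF H0, of 0] by simp
      fix y z assume "y \<in> K" "z \<in> K"
      then obtain h j h' j' where "h \<in> H" "h' \<in> H" and y: "y = h + of_nat j * x" "z = h' + of_nat j' * x"
        unfolding K_def by auto
      moreover have "y - z = (h - h') + of_int (int j - int j') * x" unfolding y by (simp add: algebra_simps)
      ultimately show "y - z \<in> K" using Kint[OF Hd[OF \<open>h \<in> H\<close> \<open>h' \<in> H\<close>]] by metis
    next
      obtain k where "card H = ?p ^ k" using H unfolding good_def by auto
      then have "card K = ?p ^ Suc k" using cK by simp
      then show "\<exists>k. card K = ?p ^ k" by blast
    qed
    moreover have "H \<subseteq> K" using Kint[of _ 0] by auto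
    ultimately have "K = H" by (rule max)
    then have "card H = card H * ?p" using cK by simp
    moreover have "card H > 0" using H0 by (auto simp: card_gt_0_iff)
    ultimately show False using prime_gt_1_nat[OF p] by simp
  qed
  then show ?thesis using H unfolding good_def by auto
qed

text \<open>s divides a power of the characteristic, so it is one itself, and the s-th power is an
  iterate of the Frobenius map.\<close>

lemma sqrt_card_power_add:
  fixes x y :: "'a::{field,finite}"
  assumes "CARD('a) = s\<^sup>2"
  shows "(x + y) ^ s = x ^ s + y ^ s"
proof -
  have p: "prime CHAR('a)"
    by (intro prime_CHAR_semidom) (simp add: finite_imp_CHAR_pos)
  obtain k where "s\<^sup>2 = CHAR('a) ^ k"
    using card_field_eq_CHAR_power[where 'a='a] assms by auto
  then have "s dvd CHAR('a) ^ k" by (metis dvd_triv_left power2_eq_square)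
  then obtain n where "s = CHAR('a) ^ n"
    using divides_primepow_nat[OF p] by blast
  then show ?thesis using freshmans_dream'[OF p] by blast
qed

text \<open>The fibres cover A, each has at most \<open>a\<close> elements, and there are at most
  \<open>b\<close> of them; as A has \<open>a * b\<close> elements, every bound is attained. Numbers
  of roots of polynomials provide such bounds for trace and norm.\<close>

lemma card_fibre_eq:
  assumes "finite A" "finite B" "f ` A \<subseteq> B" "card B \<le> b"
    and "\<And>y. y \<in> B \<Longrightarrow> card {x\<in>A. f x = y} \<le> a" and "card A = a * b" "y \<in> B"
  shows "card {x\<in>A. f x = y} = a"
proof (rule ccontr)
  assume "card {x\<in>A. f x = y} \<noteq> a"
  then have "card {x\<in>A. f x = y} < a" using assms(5,7) by fastforce
  then have "(\<Sum>y\<in>B. card {x\<in>A. f x = y}) < (\<Sum>y\<in>B. a)"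
    using assms by (intro sum_strict_mono_ex1) auto
  also have "\<dots> \<le> a * b" using assms(4) by simp
  also have "(\<Sum>y\<in>B. card {x\<in>A. f x = y}) = card A"
    using sum.group[OF assms(1,2,3), of "\<lambda>_. 1::nat"] by simp
  finally show False using assms(6) by simp
qed

section \<open>Trace and norm to the subfield of order \<open>s\<close>\<close>

context
  fixes s :: nat
  assumes card_sq: "CARD('a::{field,finite}) = s\<^sup>2"
begin

lemma sqrt_card_gt1: "s > 1"
proof (rule ccontr)
  assume "\<not> s > 1"
  then have "s = 0 \<or> s = 1" by auto
  then have "CARD('a) \<le> 1" using card_sq by auto
  moreover have "card {0, 1::'a} \<le> CARD('a)" by (intro card_mono) auto
  ultimately show False by simp
qed

lemma power_sqrt_card_twice: "((x::'a) ^ s) ^ s = x"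
  by (metis card_sq finite_field_power_card power2_eq_square power_mult)

text \<open>u + u ^ s is the trace of u in the subfield fixed by the s-th power. That subfield and
  each fibre consist of roots of a polynomial of degree s, hence have at most s elements, while the
  field has s * s.\<close>

lemma card_trace_fibre:
  fixes c :: 'a
  assumes "c ^ s = c"
  shows "card {u. c + u + u ^ s = 0} = s"
proof -
  let ?B = "{c::'a. c ^ s = c}"
  have deg: "degree (monom 1 s + [:e, k:] :: 'a poly) = s" for e k
  proof (rule degree_add_eq_left[THEN trans])
    show "degree [:e, k:] < degree (monom (1::'a) s)"
      using sqrt_card_gt1 by (simp add: degree_monom_eq degree_pCons_eq_if)
  qed (simp add: degree_monom_eq)
  have roots: "card {x::'a. poly (monom 1 s + [:e, k:]) x = 0} \<le> s" for e k
    using card_poly_roots_bound[of "monom 1 s + [:e, k:] :: 'a poly"] deg[of e k] sqrt_card_gt1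
    by (metis degree_0 not_one_less_zero)
  have *: "card {u\<in>UNIV. - u - u ^ s = c} = s"
  proof (rule card_fibre_eq[of UNIV ?B _ s])
    \<comment> \<open>Obtained from additivity of the s-th power, which treats odd and even s
      alike.\<close>
    have m: "(- u) ^ s = - (u ^ s)" for u :: 'a
      using sqrt_card_power_add[OF card_sq, of u "-u"] sqrt_card_gt1
      by (metis add.right_inverse add_eq_0_iff not_one_less_zero zero_power bot_nat_0.not_eq_extremum)
    show "range (\<lambda>u::'a. - u - u ^ s) \<subseteq> ?B"
    proof clarsimp
      fix u :: 'a
      have "(- u - u ^ s) ^ s = (- u) ^ s + (- (u ^ s)) ^ s"
        using sqrt_card_power_add[OF card_sq, of "-u" "- (u ^ s)"] by simp
      then show "(- u - u ^ s) ^ s = - u - u ^ s" by (simp add: m power_sqrt_card_twice)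
    qed
    show "card ?B \<le> s" using roots[of 0 "-1"] by (simp add: poly_monom)
    show "card {u\<in>UNIV. - u - u ^ s = y} \<le> s" for y :: 'a
    proof -
      have "- u - u ^ s = y \<longleftrightarrow> poly (monom 1 s + [:y, 1:]) u = 0" for u
      proof -
        have "poly (monom 1 s + [:y, 1:]) u = y - (- u - u ^ s)"
          by (simp add: poly_monom)
        then show ?thesis by (metis eq_iff_diff_eq_0)
      qed
      then have "{u\<in>UNIV. - u - u ^ s = y} = {x. poly (monom 1 s + [:y, 1:]) x = 0}" by auto
      then show ?thesis using roots[of y 1] by metis
    qed
    show "CARD('a) = s * s" using card_sq by (simp add: power2_eq_square)
  qed (use assms in auto)
  have "- u - u ^ s = c \<longleftrightarrow> c + u + u ^ s = 0" for u
  proof -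
    have "c + u + u ^ s = c - (- u - u ^ s)" by simp
    then show ?thesis by (metis eq_iff_diff_eq_0)
  qed
  then have "{u\<in>UNIV. - u - u ^ s = c} = {u. c + u + u ^ s = 0}" by simp
  with * show ?thesis by metis
qed

text \<open>For even s the characteristic is 2 and 1 = - 1. For odd s the norm x ^ (s + 1) maps the
  s^2 - 1 nonzero elements into the roots of c ^ (s - 1) = 1 with fibres of at most s + 1 elements,
  so it attains every such root; - 1 is one because s - 1 is even. The element serves to build
  isotropic vectors of a Hermitian form.\<close>

lemma norm_eq_minus_one: "\<exists>\<epsilon>::'a. \<epsilon> * \<epsilon> ^ s = - 1"
proof (cases "odd s")
  case False
  then have "(-1 :: 'a) ^ s\<^sup>2 = 1" by (intro neg_one_even_power) simp
  then have "(1 :: 'a) = - 1"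
    using finite_field_power_card[of "-1 :: 'a"] unfolding card_sq by (rule trans[OF sym])
  then have "(1 :: 'a) * 1 ^ s = - 1" unfolding power_one mult_1 .
  then show ?thesis by (rule exI)
next
  case True
  let ?A = "UNIV - {0::'a}" and ?B = "{c::'a. c ^ (s - 1) = 1}"
  have roots: "card {x::'a. x ^ n = c} \<le> n" if "n > 0" for n c
  proof -
    have deg: "degree (monom 1 n + [:-c:] :: 'a poly) = n"
      by (rule degree_add_eq_left[THEN trans]) (use that in \<open>auto simp: degree_monom_eq\<close>)
    then have "monom 1 n + [:-c:] \<noteq> (0 :: 'a poly)" using that by (metis degree_0 less_irrefl)
    then show ?thesis using card_poly_roots_bound[of "monom 1 n + [:-c:] :: 'a poly"] deg
      by (simp add: poly_monom)
  qed
  have s2: "s\<^sup>2 - 1 = (s + 1) * (s - 1)"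
  proof -
    have "int (s\<^sup>2 - 1) = int ((s + 1) * (s - 1))"
      using sqrt_card_gt1 by (simp add: of_nat_diff power2_eq_square algebra_simps)
    then show ?thesis by linarith
  qed
  have "card {x\<in>?A. x ^ (s + 1) = -1} = s + 1"
  proof (rule card_fibre_eq[of ?A ?B _ "s - 1"])
    show "(\<lambda>x. x ^ (s + 1)) ` ?A \<subseteq> ?B"
    proof clarsimp
      fix x :: 'a assume "x \<noteq> 0"
      have "x * x ^ (s\<^sup>2 - 1) = x"
        using finite_field_power_card[of x] unfolding card_sq[symmetric]
        by (metis Suc_diff_1 power_Suc zero_less_card_finite)
      then have "x ^ ((s + 1) * (s - 1)) = 1"
        using \<open>x \<noteq> 0\<close> unfolding s2 by (metis mult_cancel_left1)
      then show "(x * x ^ s) ^ (s - Suc 0) = 1"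
        unfolding power_mult by simp
    qed
    show "card ?B \<le> s - 1" by (rule roots) (use sqrt_card_gt1 in simp)
    show "card {x\<in>?A. x ^ (s + 1) = y} \<le> s + 1" for y
    proof -
      have "card {x\<in>?A. x ^ (s + 1) = y} \<le> card {x. x ^ (s + 1) = y}"
        by (rule card_mono) auto
      also have "\<dots> \<le> s + 1" by (rule roots) simp
      finally show ?thesis .
    qed
    show "card ?A = (s + 1) * (s - 1)"
    proof -
      have "card ?A = CARD('a) - 1" by (simp add: card_Diff_subset)
      then show ?thesis unfolding card_sq s2 .
    qed
    have "even (s - 1)" using True by simp
    then show "-1 \<in> ?B" by simp
  qed auto
  then have "{x\<in>?A. x ^ (s + 1) = -1} \<noteq> {}" by (metis card.empty Suc_eq_plus1 nat.distinct(1))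
  then show ?thesis by auto
qed

end

section \<open>Counting isotropic vectors\<close>

lemma card_span_independent:
  fixes S :: "('a::{field,finite} ^ 'n::finite) set"
  assumes "finite S" "vec.independent S"
  shows "card (vec.span S) = CARD('a) ^ card S"
  using assms
proof (induction S)
  case (insert b S)
  then have b: "b \<notin> vec.span S" and ind: "vec.independent S"
    by (auto simp: vec.independent_insert)
  let ?f = "\<lambda>(k::'a, v). k *s b + v"
  have "vec.span (insert b S) = ?f ` (UNIV \<times> vec.span S)"
  proof (intro set_eqI iffI)
    fix x assume "x \<in> vec.span (insert b S)"
    then obtain k where k: "x - k *s b \<in> vec.span S" by (auto simp: vec.span_insert)
    moreover have "x = ?f (k, x - k *s b)" by simp
    ultimately show "x \<in> ?f ` (UNIV \<times> vec.span S)" by blast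
  next
    fix x assume "x \<in> ?f ` (UNIV \<times> vec.span S)"
    then obtain k v where "x = k *s b + v" "v \<in> vec.span S" by auto
    then have "x - k *s b \<in> vec.span S" by simp
    then show "x \<in> vec.span (insert b S)" by (auto simp: vec.span_insert)
  qed
  moreover have "inj_on ?f (UNIV \<times> vec.span S)"
  proof (rule inj_onI, clarsimp)
    fix k v k' v' assume v: "v \<in> vec.span S" "v' \<in> vec.span S" and eq: "k *s b + v = k' *s b + v'"
    have e: "(k - k') *s b = v' - v" using eq by (simp add: vec.scale_left_diff_distrib algebra_simps)
    have "k = k'"
    proof (rule ccontr)
      assume "k \<noteq> k'"
      then have "b = (inverse (k - k') * (k - k')) *s b" by simp
      also have "\<dots> = inverse (k - k') *s ((k - k') *s b)" by (simp only: vector_smult_assoc)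
      also have "\<dots> \<in> vec.span S" unfolding e using v by (intro vec.span_scale vec.span_diff)
      finally show False using b by simp
    qed
    with eq show "k = k' \<and> v = v'" by simp
  qed
  ultimately have "card (vec.span (insert b S)) = CARD('a) * card (vec.span S)"
    by (simp add: card_image card_cartesian_product)
  then show ?case using insert ind by simp
qed simp

lemma card_subspace:
  fixes S :: "('a::{field,finite} ^ 'n::finite) set"
  assumes "vec.subspace S"
  shows "card S = CARD('a) ^ vec.dim S"
proof -
  obtain T where T: "T \<subseteq> S" "vec.independent T" "S \<subseteq> vec.span T" "card T = vec.dim S"
    using vec.basis_exists[of S] by blast
  then have "vec.span T = S" using assms by (metis vec.span_minimal subset_antisym)
  then show ?thesis using card_span_independent[of T] T by simp
qed

lemma card_span_insert:
  fixes S :: "('a::{field,finite} ^ 'n::finite) set"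
  assumes "vec.subspace S" "x \<notin> S"
  shows "card (vec.span (insert x S)) = CARD('a) * card S"
proof -
  have "x \<notin> vec.span S" using assms by (simp add: vec.span_eq_iff[THEN iffD2])
  then show ?thesis
    using assms card_subspace[of "vec.span (insert x S)"] card_subspace[of S] by (simp add: vec.dim_insert)
qed

lemma card_field_gt1: "CARD('a::{field,finite}) > 1"
proof -
  have "card {0, 1::'a} \<le> CARD('a)" by (intro card_mono) auto
  then show ?thesis by simp
qed

text \<open>U is a union of lines in direction x, and along each of them \<phi> takes every value
  once. Stated for any set closed under shifts by x, so that it covers subspaces and sets of
  isotropic vectors alike.\<close>

lemma card_shift_filter:
  fixes x :: "'a::{field,finite} ^ 'n::finite" and \<phi> :: "'a ^ 'n \<Rightarrow> 'a"
  assumes closed: "\<And>w t. w \<in> U \<Longrightarrow> w + t *s x \<in> U"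
    and lin: "\<And>w t. \<phi> (w + t *s x) = \<phi> w + t * \<phi> x" and "\<phi> x \<noteq> 0"
  shows "CARD('a) * card {w \<in> U. \<phi> w = 0} = card U"
proof -
  have "bij_betw (\<lambda>(w, t). w + t *s x) ({w \<in> U. \<phi> w = 0} \<times> UNIV) U"
  proof (rule bij_betwI[where g = "\<lambda>u. (u + (- \<phi> u / \<phi> x) *s x, \<phi> u / \<phi> x)"])
    show "(\<lambda>u. (u + (- \<phi> u / \<phi> x) *s x, \<phi> u / \<phi> x)) \<in> U \<rightarrow> {w \<in> U. \<phi> w = 0} \<times> UNIV"
    proof (intro funcsetI SigmaI)
      fix u assume "u \<in> U"
      then have "u + (- \<phi> u / \<phi> x) *s x \<in> U" by (rule closed)
      moreover have "\<phi> (u + (- \<phi> u / \<phi> x) *s x) = 0"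
        unfolding lin using \<open>\<phi> x \<noteq> 0\<close> by simp
      ultimately show "u + (- \<phi> u / \<phi> x) *s x \<in> {w \<in> U. \<phi> w = 0}" by blast
    qed simp
    show "(\<lambda>(w, t). w + t *s x) \<in> {w \<in> U. \<phi> w = 0} \<times> UNIV \<rightarrow> U" using closed by auto
  qed (use \<open>\<phi> x \<noteq> 0\<close> in \<open>auto simp: lin\<close>)
  from bij_betw_same_card[OF this] show ?thesis by (simp add: card_cartesian_product mult.commute)
qed

text \<open>\<open>B\<close> is linear on the left and orthogonality is symmetric, which covers
  Hermitian forms. \<open>iso\<close> is kept apart from \<open>B x x = 0\<close> for the sake of
  quadratic forms in characteristic 2. \<open>nondeg\<close> speaks of isotropic vectors because the
  polar form of the parabolic type has a radical in characteristic 2, spanned by a vector that is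
  not isotropic. \<open>ex_generator\<close> asks for a single generator of dimension
  \<open>d\<close>; \<open>dim_generator\<close> extends this to all.\<close>

locale polar_form =
  fixes B :: "'a::{field,finite} ^ 'n::finite \<Rightarrow> 'a ^ 'n \<Rightarrow> 'a"
    and iso :: "'a ^ 'n \<Rightarrow> bool" and \<kappa> d :: nat and q E :: real
    and \<P> :: "('a ^ 'n) set set"
  assumes q: "q = real CARD('a)"
    and B_add: "B (x + y) z = B x z + B y z"
    and B_scale: "B (c *s x) z = c * B x z"
    and B_sym: "B x y = 0 \<Longrightarrow> B y x = 0"
    and iso_self: "iso x \<Longrightarrow> B x x = 0"
    and iso_add: "iso x \<Longrightarrow> iso y \<Longrightarrow> B x y = 0 \<Longrightarrow> iso (x + y)"
    and iso_scale: "iso x \<Longrightarrow> iso (c *s x)"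
    and nondeg: "iso x \<Longrightarrow> x \<noteq> 0 \<Longrightarrow> \<exists>y. B y x \<noteq> 0"
    and kappa: "iso x \<Longrightarrow> B y x \<noteq> 0 \<Longrightarrow> card {t. iso (y + t *s x)} = \<kappa>"
    and mem_P: "S \<in> \<P> \<longleftrightarrow> vec.subspace S \<and> (\<forall>x\<in>S. iso x) \<and> (\<forall>x\<in>S. \<forall>y\<in>S. B x y = 0)"
    and ex_generator: "\<exists>G\<in>generators \<P>. vec.dim G = d"
    and E: "real \<kappa> * q ^ CARD('n) = q ^ (2 * d) * E" \<comment> \<open>that is, \<open>E = q\<^sup>e\<close>\<close>
    and d_pos: "d \<ge> 1"
begin

section \<open>Orthogonality and isotropic subspaces\<close>

lemma q_gt1: "q > 1" using card_field_gt1[where 'a='a] unfolding q by simp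

text \<open>Orthogonality is tested in the argument in which \<open>B\<close> is linear, so this is
  a subspace for every \<open>S\<close>. It contains non-isotropic vectors too; for a subspace of
  the polar space, \<open>perp\<close> consists of its points, see \<open>perp_eq\<close>.\<close>

definition orth :: "('a ^ 'n) set \<Rightarrow> ('a ^ 'n) set" where
  "orth S = {v. \<forall>s\<in>S. B v s = 0}"

definition N :: "('a ^ 'n) set \<Rightarrow> real" where
  "N W = real (card {v \<in> W. iso v})"

lemma B_0 [simp]: "B 0 y = 0"
  using B_scale[of 0 0 y] by simp

lemma B_diff: "B (x - y) z = B x z - B y z"
  using B_add[of "x - y" y z] by simp

lemma B_sym_iff: "B x y = 0 \<longleftrightarrow> B y x = 0"
  using B_sym by blast

lemma B_0_right [simp]: "B x 0 = 0"
  using B_sym_iff[of x 0] by simp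

lemma subspace_orth: "vec.subspace (orth S)"
  by (rule vec.subspaceI) (auto simp: orth_def B_add B_scale)

lemma subspace_left: "vec.subspace {v. B v y = 0}"
  by (rule vec.subspaceI) (auto simp: B_add B_scale)

text \<open>Covers a Hermitian form, which is only semilinear on the right: symmetry of
  orthogonality turns the set into a left one.\<close>

lemma subspace_right: "vec.subspace {v. B y v = 0}"
  using subspace_left[of y] B_sym_iff[of _ y] by simp

lemma orth_antimono: "S \<subseteq> T \<Longrightarrow> orth T \<subseteq> orth S"
  unfolding orth_def by blast

lemma orth_span: "orth (vec.span S) = orth S"
proof
  show "orth S \<subseteq> orth (vec.span S)"
  proof
    fix v assume "v \<in> orth S"
    then have "S \<subseteq> {s. B v s = 0}" unfolding orth_def by blast
    then have "vec.span S \<subseteq> {s. B v s = 0}" using subspace_right by (rule vec.span_minimal)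
    then show "v \<in> orth (vec.span S)" unfolding orth_def by blast
  qed
qed (rule orth_antimono[OF vec.span_superset])

lemma orth_insert: "orth (insert x S) = orth S \<inter> {v. B v x = 0}"
  unfolding orth_def by blast

lemma orth_Un: "orth (S \<union> T) = orth S \<inter> orth T"
  unfolding orth_def by blast

lemma orth_sym: "S \<subseteq> orth T \<longleftrightarrow> T \<subseteq> orth S"
  unfolding orth_def using B_sym_iff by blast

lemma iso_0: "iso 0"
proof -
  obtain G where "G \<in> generators \<P>" using ex_generator by blast
  then have "G \<in> \<P>" unfolding generators_def by blast
  then show ?thesis using mem_P vec.subspace_0 by blast
qed

lemma zero_mem_P: "{0} \<in> \<P>"
  unfolding mem_P using iso_0 by (simp add: vec.subspace_single_0)

lemma iso_shift: "iso w \<Longrightarrow> iso x \<Longrightarrow> B w x = 0 \<Longrightarrow> iso (w + t *s x)"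
  using iso_add[of w "t *s x"] iso_scale[of x t] B_scale[of t x w] B_sym_iff[of w x] B_sym_iff[of w "t *s x"]
  by simp

lemma span_insert_mem_P:
  assumes "S \<in> \<P>" "iso x" "x \<in> orth S"
  shows "vec.span (insert x S) \<in> \<P>"
proof -
  have S: "vec.subspace S" "\<And>s. s \<in> S \<Longrightarrow> iso s" "\<And>s t. s \<in> S \<Longrightarrow> t \<in> S \<Longrightarrow> B s t = 0"
    using assms(1) mem_P by blast+
  then have sp: "vec.span S = S" by (simp add: vec.span_eq_iff)
  have elem: "\<exists>s k. s \<in> S \<and> v = s + k *s x" if v: "v \<in> vec.span (insert x S)" for v
  proof -
    obtain k where "v - k *s x \<in> S" using v sp by (auto simp: vec.span_insert)
    moreover have "v = (v - k *s x) + k *s x" by simp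
    ultimately show ?thesis by blast
  qed
  have xs: "B x s = 0" "B s x = 0" if "s \<in> S" for s
    using assms(3) that B_sym_iff unfolding orth_def by blast+
  have "iso v" if v: "v \<in> vec.span (insert x S)" for v
  proof -
    obtain s k where "s \<in> S" "v = s + k *s x" using elem[OF v] by blast
    then show ?thesis using iso_shift[of s x k] assms(2) S(2) xs by simp
  qed
  moreover have "B v w = 0" if v: "v \<in> vec.span (insert x S)" and w: "w \<in> vec.span (insert x S)" for v w
  proof -
    \<comment> \<open>Left linearity settles orthogonality to the spanning set
      \<open>insert x S\<close>; \<open>orth_span\<close> then passes to its span.\<close>
    have l: "B u s = 0" if u: "u \<in> vec.span (insert x S)" and s: "s \<in> insert x S" for u s
    proof -
      obtain t k where "t \<in> S" "u = t + k *s x" using elem[OF u] by blast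
      then show ?thesis using s S(3)[of t s] xs iso_self[OF assms(2)] by (auto simp: B_add B_scale)
    qed
    have "v \<in> orth (insert x S)" unfolding orth_def using l v by blast
    then show ?thesis using w unfolding orth_span[symmetric, of "insert x S"] unfolding orth_def by blast
  qed
  ultimately show ?thesis unfolding mem_P by simp
qed

lemma subspace_mem_P: "S \<in> \<P> \<Longrightarrow> vec.subspace T \<Longrightarrow> T \<subseteq> S \<Longrightarrow> T \<in> \<P>"
  unfolding mem_P by blast

lemma mem_P_subset_orth: "S \<in> \<P> \<Longrightarrow> S \<subseteq> orth S"
  unfolding mem_P orth_def by blast

section \<open>Isotropic vectors in subspaces and in their hyperplanes\<close>

lemma card_hyperplane:
  assumes "vec.subspace W" "z \<in> W" "B z x \<noteq> 0"
  shows "q * real (card {w \<in> W. B w x = 0}) = real (card W)"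
proof -
  have "CARD('a) * card {w \<in> W. B w x = 0} = card W"
    by (rule card_shift_filter[of W z "\<lambda>w. B w x"])
       (use assms in \<open>auto simp: B_add B_scale intro: vec.subspace_add vec.subspace_scale\<close>)
  then show ?thesis unfolding q of_nat_mult[symmetric] by (simp only:)
qed

text \<open>Here x is an isotropic vector in the radical of W: shifts by multiples of x preserve
  isotropy, while \<open>B w y\<close> takes each value once along such a line.\<close>

lemma N_Int_perp:
  assumes "vec.subspace W" "x \<in> W" "iso x" "\<And>w. w \<in> W \<Longrightarrow> B w x = 0" "B x y \<noteq> 0"
  shows "q * N {w \<in> W. B w y = 0} = N W"
proof -
  have "CARD('a) * card {w \<in> {w \<in> W. iso w}. B w y = 0} = card {w \<in> W. iso w}"
  proof (rule card_shift_filter)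
    fix w and t :: 'a assume "w \<in> {w \<in> W. iso w}"
    then show "w + t *s x \<in> {w \<in> W. iso w}"
      using iso_shift[of w x t] assms(3) assms(4)[of w] vec.subspace_add[OF assms(1) _ vec.subspace_scale[OF assms(1,2)]]
      by simp
  qed (simp_all add: B_add B_scale assms(5))
  moreover have "{w \<in> {w \<in> W. iso w}. B w y = 0} = {w \<in> {w \<in> W. B w y = 0}. iso w}" by blast
  ultimately show ?thesis unfolding N_def q of_nat_mult[symmetric] by (simp only:)
qed

text \<open>Double count of the pairs (w, t) with w in W, \<open>B w x\<close> nonzero and w + t x
  isotropic: each w has \<kappa> values of t, and each isotropic vector of W outside the perp of x
  arises from q pairs. The vectors w make up the fraction (q - 1) / q of W.\<close>

lemma N_drop:
  assumes W: "vec.subspace W" and x: "x \<in> W" "iso x" and w: "w \<in> W" "B w x \<noteq> 0"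
  shows "N W - N {w \<in> W. B w x = 0} = \<kappa> * (q - 1) / q\<^sup>2 * card W"
proof -
  let ?U = "{w \<in> W. B w x \<noteq> 0}" and ?V = "{w \<in> W. iso w \<and> B w x \<noteq> 0}"
  let ?S = "SIGMA w:?U. {t. iso (w + t *s x)}"
  have Wx: "t *s x \<in> W" for t using vec.subspace_scale[OF W x(1)] .
  \<comment> \<open>As x is isotropic, \<open>B x x = 0\<close>, so shifting along x does not leave
    the complement of its perp.\<close>
  have shift: "B (w + t *s x) x = B w x" "B (w - t *s x) x = B w x" for w t
    unfolding B_add B_diff B_scale iso_self[OF x(2)] by simp_all
  have "bij_betw (\<lambda>(w, t). (w - t *s x, t)) (?V \<times> UNIV) ?S"
  proof (rule bij_betwI[where g = "\<lambda>(w, t). (w + t *s x, t)"])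
    show "(\<lambda>(w, t). (w - t *s x, t)) \<in> ?V \<times> UNIV \<rightarrow> ?S"
    proof (rule funcsetI)
      fix p assume "p \<in> ?V \<times> (UNIV :: 'a set)"
      then obtain w t where p: "p = (w, t)" and w: "w \<in> W" "iso w" "B w x \<noteq> 0" by blast
      have "w - t *s x \<in> ?U" using vec.subspace_diff[OF W w(1) Wx] shift(2) w(3) by simp
      then show "(\<lambda>(w, t). (w - t *s x, t)) p \<in> ?S" unfolding p using w(2) by simp
    qed
    show "(\<lambda>(w, t). (w + t *s x, t)) \<in> ?S \<rightarrow> ?V \<times> UNIV"
    proof (rule funcsetI)
      fix p assume "p \<in> ?S"
      then obtain w t where p: "p = (w, t)" and w: "w \<in> W" "iso (w + t *s x)" "B w x \<noteq> 0" by blast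
      have "w + t *s x \<in> ?V" using vec.subspace_add[OF W w(1) Wx] shift(1) w by simp
      then show "(\<lambda>(w, t). (w + t *s x, t)) p \<in> ?V \<times> UNIV" unfolding p by simp
    qed
  qed (simp_all add: split_paired_all)
  from bij_betw_same_card[OF this]
  have "card ?V * CARD('a) = (\<Sum>w\<in>?U. card {t. iso (w + t *s x)})"
    by (simp add: card_cartesian_product)
  also have "\<dots> = (\<Sum>w\<in>?U. \<kappa>)" using kappa[OF x(2)] by (intro sum.cong) auto
  finally have 1: "real (card ?V) * q = \<kappa> * real (card ?U)" unfolding q of_nat_mult[symmetric] by (simp only: sum_constant of_nat_id mult.commute)
  have "card W = card ?U + card {w \<in> W. B w x = 0}"
  proof -
    have "W = ?U \<union> {w \<in> W. B w x = 0}" by blast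
    moreover have "card (?U \<union> {w \<in> W. B w x = 0}) = card ?U + card {w \<in> W. B w x = 0}"
      by (rule card_Un_disjoint) auto
    ultimately show ?thesis by metis
  qed
  then have "real (card W) = real (card ?U) + real (card {w \<in> W. B w x = 0})" by simp
  then have 2: "real (card ?U) = card W * (q - 1) / q"
    using card_hyperplane[OF W w] q_gt1 by (simp add: field_simps)
  have "card {w \<in> W. iso w} = card ?V + card {w \<in> {w \<in> W. B w x = 0}. iso w}"
  proof -
    have "{w \<in> W. iso w} = ?V \<union> {w \<in> {w \<in> W. B w x = 0}. iso w}" by blast
    moreover have "card (?V \<union> {w \<in> {w \<in> W. B w x = 0}. iso w}) = card ?V + card {w \<in> {w \<in> W. B w x = 0}. iso w}"
      by (rule card_Un_disjoint) auto
    ultimately show ?thesis by metis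
  qed
  then have "N W - N {w \<in> W. B w x = 0} = card ?V" unfolding N_def by simp
  also have "\<dots> = \<kappa> * real (card ?U) / q" using 1 q_gt1 by (simp add: field_simps)
  also have "\<dots> = \<kappa> * (q - 1) / q\<^sup>2 * card W" unfolding 2 using q_gt1 by (simp add: field_simps power2_eq_square)
  finally show ?thesis .
qed

text \<open>Counting the pairs \<open>(v, s)\<close> with \<open>s \<in> S\<close> and \<open>B v s = 0\<close> in both orders yields the dimension
  of \<open>orth S\<close> without any linearity of \<open>B\<close> in its second argument.\<close>

lemma card_orth:
  assumes S: "vec.subspace S" and nd: "\<And>s. s \<in> S \<Longrightarrow> s \<noteq> 0 \<Longrightarrow> \<exists>v. B v s \<noteq> 0"
  shows "real (card (orth S)) * card S = q ^ CARD('n)"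
proof -
  let ?V = "UNIV :: ('a ^ 'n) set" and ?v = "real CARD('a ^ 'n)"
  have s: "real (card {v \<in> ?V. B v s = 0}) = (if s = 0 then ?v else ?v / q)" if sS: "s \<in> S" for s
  proof (cases "s = 0")
    case False
    then obtain z where "B z s \<noteq> 0" using nd sS by blast
    then show ?thesis using card_hyperplane[OF vec.subspace_UNIV, of z s] q_gt1 False
      by (simp add: field_simps)
  qed simp
  have v: "real (card {s \<in> S. B v s = 0}) = (if v \<in> orth S then real (card S) else card S / q)" for v
  proof (cases "v \<in> orth S")
    case True
    then have "{s \<in> S. B v s = 0} = S" unfolding orth_def by blast
    then show ?thesis using True by simp
  next
    case False
    then obtain z where "z \<in> S" "B z v \<noteq> 0" unfolding orth_def using B_sym_iff[of v] by auto
    then have "q * real (card {s \<in> S. B s v = 0}) = card S" by (rule card_hyperplane[OF S])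
    moreover have "{s \<in> S. B v s = 0} = {s \<in> S. B s v = 0}" using B_sym_iff[of v] by blast
    ultimately show ?thesis using False q_gt1 by (simp add: field_simps)
  qed
  have "(\<Sum>s\<in>S. card {v \<in> ?V. B v s = 0}) = (\<Sum>v\<in>?V. card {s \<in> S. B v s = 0})"
  proof -
    have "(\<Sum>s\<in>S. card {v \<in> ?V. B v s = 0}) = (\<Sum>s\<in>S. \<Sum>v\<in>?V. if B v s = 0 then 1 else 0)"
      by (simp add: sum.If_cases Collect_conj_eq)
    also have "\<dots> = (\<Sum>v\<in>?V. \<Sum>s\<in>S. if B v s = 0 then 1 else 0)" by (rule sum.swap)
    also have "\<dots> = (\<Sum>v\<in>?V. card {s \<in> S. B v s = 0})"
      by (simp add: sum.If_cases Collect_conj_eq)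
    finally show ?thesis .
  qed
  then have "(\<Sum>s\<in>S. real (card {v \<in> ?V. B v s = 0})) = (\<Sum>v\<in>?V. real (card {s \<in> S. B v s = 0}))"
    by (metis (no_types, lifting) of_nat_sum sum.cong)
  also have "(\<Sum>s\<in>S. real (card {v \<in> ?V. B v s = 0})) = (\<Sum>s\<in>S. if s = 0 then ?v else ?v / q)"
    using s by (intro sum.cong) auto
  also have "\<dots> = ?v + (card S - 1) * (?v / q)"
    using vec.subspace_0[OF S] by (simp add: sum.remove[of S 0] card_Diff_singleton)
  also have "(\<Sum>v\<in>?V. real (card {s \<in> S. B v s = 0})) = (\<Sum>v\<in>?V. if v \<in> orth S then real (card S) else card S / q)"
    using v by (intro sum.cong) auto
  also have "\<dots> = card (orth S) * real (card S) + (?v - card (orth S)) * (card S / q)"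
    using card_mono[of ?V "orth S"]
    by (simp add: sum.If_cases Compl_eq_Diff_UNIV card_Diff_subset of_nat_diff)
  finally have eq: "?v + (card S - 1) * (?v / q) = card (orth S) * real (card S) + (?v - card (orth S)) * (card S / q)" .
  moreover have "card S \<ge> 1" using vec.subspace_0[OF S] by (simp add: Suc_le_eq card_gt_0_iff) blast
  \<comment> \<open>The terms other than the two sides of the claim cancel; what remains is the
    claim times 1 - 1/q, cleared of denominators.\<close>
  ultimately have "(card (orth S) * real (card S)) * (q - 1) = ?v * (q - 1)"
    using q_gt1 by (simp add: field_simps of_nat_diff)
  then have "card (orth S) * real (card S) = ?v" using q_gt1 by simp
  then show ?thesis unfolding q by simp
qed

lemma mem_PD:
  assumes "S \<in> \<P>"
  shows "vec.subspace S" "x \<in> S \<Longrightarrow> iso x" "x \<in> S \<Longrightarrow> y \<in> S \<Longrightarrow> B x y = 0"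
  using assms unfolding mem_P by simp_all

lemma card_orth_P:
  assumes "S \<in> \<P>"
  shows "real (card (orth S)) * card S = q ^ CARD('n)"
  by (rule card_orth[OF mem_PD(1)[OF assms]]) (rule nondeg[OF mem_PD(2)[OF assms]])

lemma generatorD: "G \<in> generators \<P> \<Longrightarrow> G \<in> \<P>"
  unfolding generators_def by simp

text \<open>An isotropic vector orthogonal to G and outside it would extend G, which is
  maximal.\<close>

lemma iso_orth_generator:
  assumes "G \<in> generators \<P>"
  shows "{v \<in> orth G. iso v} = G"
proof
  have G: "G \<in> \<P>" and max: "\<And>S. S \<in> \<P> \<Longrightarrow> G \<subseteq> S \<Longrightarrow> S = G" using assms unfolding generators_def by blast+
  show "{v \<in> orth G. iso v} \<subseteq> G"
  proof clarify
    fix v assume "v \<in> orth G" "iso v"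
    then have "vec.span (insert v G) \<in> \<P>" using G span_insert_mem_P by blast
    moreover have "insert v G \<subseteq> vec.span (insert v G)" by (rule vec.span_superset)
    ultimately show "v \<in> G" using max by blast
  qed
  show "G \<subseteq> {v \<in> orth G. iso v}" using mem_P_subset_orth[OF G] mem_PD(2)[OF G] by blast
qed

text \<open>Induction downwards from S = G, where \<open>iso_orth_generator\<close> leaves just the
  vectors of G. Going from the span of S and x back to S adds \<kappa> (q - 1) / q^2 times
  \<open>card (orth S)\<close> isotropic vectors by \<open>N_drop\<close>. Since
  \<open>card (orth S)\<close> is inversely proportional to \<open>card S\<close>, the increments
  telescope.\<close>

lemma N_orth_aux:
  assumes "G \<in> generators \<P>"
  shows "vec.subspace S \<Longrightarrow> S \<subseteq> G \<Longrightarrow>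
    N (orth S) = card G + \<kappa> * q ^ CARD('n) / q * (1 / card S - 1 / card G)"
proof (induction "card G - card S" arbitrary: S rule: less_induct)
  case less
  note G = generatorD[OF assms]
  show ?case
  proof (cases "S = G")
    case True
    then show ?thesis unfolding N_def using iso_orth_generator[OF assms] by simp
  next
    case False
    then obtain x where x: "x \<in> G" "x \<notin> S" using less by blast
    let ?S = "vec.span (insert x S)"
    have SP: "S \<in> \<P>" using subspace_mem_P[OF G less(2,3)] .
    have isox: "iso x" using mem_PD(2)[OF G x(1)] .
    have subG: "?S \<subseteq> G" using less(3) x by (intro vec.span_minimal mem_PD(1)[OF G]) auto
    have cS: "card ?S = CARD('a) * card S" using card_span_insert[OF less(2) x(2)] .
    have posS: "card S > 0" using vec.subspace_0[OF less(2)] by (auto simp: card_gt_0_iff)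
    have posG: "card G > 0" using x by (auto simp: card_gt_0_iff)
    have "card ?S \<le> card G" using subG by (intro card_mono) auto
    moreover have "card S < card ?S" using cS card_field_gt1[where 'a='a] posS by simp
    ultimately have IH: "N (orth ?S) = card G + \<kappa> * q ^ CARD('n) / q * (1 / card ?S - 1 / card G)"
      using less(1)[of ?S] subG by simp
    have xo: "x \<in> orth S" using mem_P_subset_orth[OF G] x orth_antimono[OF less(3)] by blast
    have o: "orth ?S = {w \<in> orth S. B w x = 0}" unfolding orth_span orth_insert by blast
    have "?S \<in> \<P>" using span_insert_mem_P[OF SP isox xo] .
    note cards = card_orth_P[OF this] card_orth_P[OF SP]
    \<comment> \<open>By size, adding x to S makes the perp smaller; this provides the vector w, not
      perpendicular to x, that \<open>N_drop\<close> needs.\<close>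
    have "orth ?S \<noteq> orth S"
    proof
      assume "orth ?S = orth S"
      then have "real (card (orth S)) * (q * card S) = real (card (orth S)) * card S" using cards cS q by simp
      moreover have "card (orth S) \<noteq> 0" using cards q_gt1 by auto
      ultimately show False using posS q_gt1 by simp
    qed
    then obtain w where w: "w \<in> orth S" "B w x \<noteq> 0" using o by blast
    have "N (orth S) = N (orth ?S) + \<kappa> * (q - 1) / q\<^sup>2 * card (orth S)"
      using N_drop[OF subspace_orth xo isox w] o by simp
    also have "real (card (orth S)) = q ^ CARD('n) / card S"
      unfolding cards(2)[symmetric]
      by (rule nonzero_mult_div_cancel_right[symmetric]) (use posS in linarith)
    finally have "N (orth S) = card G + \<kappa> * q ^ CARD('n) / q * (1 / (q * card S) - 1 / card G)
        + \<kappa> * (q - 1) / q\<^sup>2 * (q ^ CARD('n) / card S)"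
      unfolding IH cS of_nat_mult q[symmetric] .
    \<comment> \<open>One step of the telescoping sum, with s for \<open>card S\<close> and g for
      \<open>1 / card G\<close>.\<close>
    moreover have "k * V / q * (1 / (q * s) - g) + k * (q - 1) / q\<^sup>2 * (V / s) = k * V / q * (1 / s - g)"
      if "s > 0" for k V s g :: real
      using that q_gt1 by (simp add: field_simps power2_eq_square)
    ultimately show ?thesis using posS by simp
  qed
qed

lemma ex_generator_above:
  assumes "S \<in> \<P>"
  shows "\<exists>G\<in>generators \<P>. S \<subseteq> G"
proof -
  have "finite \<P>" by simp
  then obtain G where "G \<in> \<P>" "S \<subseteq> G" "\<And>T. T \<in> \<P> \<Longrightarrow> G \<subseteq> T \<Longrightarrow> T = G"
    using finite_has_maximal2[of \<P> S] assms by metis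
  then show ?thesis unfolding generators_def by blast
qed

text \<open>By \<open>N_orth_aux\<close> with \<open>S = {0}\<close>, the number of isotropic vectors is a strictly increasing
  function of the dimension of any generator.\<close>

lemma dim_generator:
  assumes "G \<in> generators \<P>"
  shows "vec.dim G = d"
proof -
  obtain G' where G': "G' \<in> generators \<P>" "vec.dim G' = d" using ex_generator by blast
  have sub: "vec.subspace H" if "H \<in> generators \<P>" for H using mem_PD(1)[OF generatorD[OF that]] .
  have N0: "N (orth {0}) = q ^ vec.dim H + \<kappa> * q ^ CARD('n) / q * (1 - 1 / q ^ vec.dim H)"
    if "H \<in> generators \<P>" for H
    using N_orth_aux[OF that vec.subspace_single_0] card_subspace[OF sub[OF that]] vec.subspace_0[OF sub[OF that]] by (simp add: q)
  have mono: "q ^ m + \<kappa> * q ^ CARD('n) / q * (1 - 1 / q ^ m) < q ^ n + \<kappa> * q ^ CARD('n) / q * (1 - 1 / q ^ n)"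
    if "m < n" for m n
  proof -
    have "q ^ m < q ^ n" using that q_gt1 by simp
    moreover have "1 / q ^ n \<le> 1 / q ^ m" using that q_gt1 by (simp add: frac_le)
    moreover have "\<kappa> * q ^ CARD('n) / q \<ge> 0" using q_gt1 by simp
    ultimately show ?thesis by (intro add_less_le_mono mult_left_mono) auto
  qed
  show ?thesis
    using N0[OF assms] N0[OF G'(1)] mono[of "vec.dim G" d] mono[of d "vec.dim G"] G'(2)
    by (metis less_irrefl linorder_neqE_nat)
qed

lemma generator_iff: "S \<in> generators \<P> \<longleftrightarrow> S \<in> \<P> \<and> vec.dim S = d"
proof
  assume S: "S \<in> \<P> \<and> vec.dim S = d"
  then obtain G where G: "G \<in> generators \<P>" "S \<subseteq> G" using ex_generator_above by blast
  then have "vec.subspace G" "vec.subspace S" using S mem_PD(1) generatorD by simp_all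
  then have "S = G" using G S dim_generator[OF G(1)] by (intro vec.subspace_dim_equal) auto
  then show "S \<in> generators \<P>" using G by simp
qed (use dim_generator in \<open>auto simp: generators_def\<close>)

text \<open>All generators have dimension \<open>d\<close>, so \<open>N_orth_aux\<close> depends on
  S through its dimension alone, and the type of the form enters only through
  \<open>E\<close>.\<close>

lemma N_orth:
  assumes "S \<in> \<P>"
  shows "N (orth S) = q ^ d + E * q ^ d * (q ^ d / q ^ vec.dim S - 1) / q"
proof -
  obtain G where G: "G \<in> generators \<P>" "S \<subseteq> G" using ex_generator_above assms by blast
  have sub: "vec.subspace S" "vec.subspace G" using mem_PD(1) assms generatorD[OF G(1)] by simp_all
  have c: "card S = q ^ vec.dim S" "card G = q ^ d"
    using card_subspace[OF sub(1)] card_subspace[OF sub(2)] dim_generator[OF G(1)] by (simp_all add: q)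
  have "q ^ (2 * d) = q ^ d * q ^ d" by (simp add: power_add mult_2)
  then have "N (orth S) = q ^ d + (q ^ d * q ^ d * E) / q * (1 / q ^ vec.dim S - 1 / q ^ d)"
    using N_orth_aux[OF G(1) sub(1) G(2)] unfolding c E by simp
  also have "\<dots> = q ^ d + E * q ^ d * (q ^ d / q ^ vec.dim S - 1) / q"
    using q_gt1 by (simp add: field_simps)
  finally show ?thesis .
qed

end

section \<open>The collinearity graph\<close>

text \<open>A vector of V outside U already brings U up to the dimension of W, so both together span
  W; the dimension formula for sums does the rest.\<close>

lemma dim_Int_hyperplanes:
  fixes U V W :: "('a::field ^ 'n::finite) set"
  assumes "vec.subspace U" "vec.subspace V" "vec.subspace W" "U \<subseteq> W" "V \<subseteq> W" "U \<noteq> V"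
    and "vec.dim U + 1 = vec.dim W" "vec.dim V + 1 = vec.dim W"
  shows "vec.dim (U \<inter> V) + 2 = vec.dim W" "vec.span (U \<union> V) = W"
proof -
  have sub: "vec.span (U \<union> V) \<subseteq> W" using assms(3-5) by (intro vec.span_minimal) auto
  have "\<not> V \<subseteq> U" using vec.subspace_dim_equal[OF assms(2,1)] assms(6-8) by auto
  then obtain v where v: "v \<in> V" "v \<notin> U" by blast
  have "vec.span U = U" using assms(1) by (simp add: vec.span_eq_iff)
  then have "vec.dim (insert v U) = vec.dim U + 1" using v vec.dim_insert[of v U] by metis
  moreover have "insert v U \<subseteq> U \<union> V" using v by blast
  then have "vec.dim (insert v U) \<le> vec.dim (vec.span (U \<union> V))"
    unfolding vec.dim_span by (rule vec.dim_subset)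
  ultimately have "vec.dim W \<le> vec.dim (vec.span (U \<union> V))" using assms(7) by simp
  then show W: "vec.span (U \<union> V) = W"
    by (intro vec.subspace_dim_equal[OF vec.subspace_span assms(3) sub])
  have "{x + y |x y. x \<in> U \<and> y \<in> V} = W"
    using W assms(1,2) by (simp add: vec.span_Un vec.span_eq_iff[THEN iffD2])
  then show "vec.dim (U \<inter> V) + 2 = vec.dim W"
    using vec.dim_sums_Int[OF assms(1,2)] assms(7,8) by simp
qed

lemma real_card_Diff_singleton: "finite A \<Longrightarrow> x \<in> A \<Longrightarrow> real (card (A - {x})) = real (card A) - 1"
  using card.remove[of A x] by simp

context polar_form
begin

section \<open>Points and their number\<close>

lemma span_point_mem_P: "iso v \<Longrightarrow> vec.span {v} \<in> \<P>"
  using span_insert_mem_P[OF zero_mem_P, of v] by (simp add: orth_def insert_commute[of v])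

lemma point_iff: "p \<in> points \<P> \<longleftrightarrow> (\<exists>v. iso v \<and> v \<noteq> 0 \<and> p = vec.span {v})"
proof
  assume p: "p \<in> points \<P>"
  then have P: "p \<in> \<P>" "vec.dim p = 1" unfolding points_def by auto
  then have "p \<noteq> {} \<and> p \<noteq> {0}" using vec.dim_eq_0[of p] by auto
  then obtain v where v: "v \<in> p" "v \<noteq> 0" by blast
  have "vec.span {v} = p"
  proof (rule vec.subspace_dim_equal)
    show "vec.span {v} \<subseteq> p" using v mem_PD(1)[OF P(1)] by (intro vec.span_minimal) auto
    show "vec.dim p \<le> vec.dim (vec.span {v})" using v P by simp
  qed (use mem_PD(1)[OF P(1)] in auto)
  then show "\<exists>v. iso v \<and> v \<noteq> 0 \<and> p = vec.span {v}" using v mem_PD(2)[OF P(1)] by blast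
next
  assume "\<exists>v. iso v \<and> v \<noteq> 0 \<and> p = vec.span {v}"
  then show "p \<in> points \<P>" unfolding points_def using span_point_mem_P by auto
qed

lemma pointD:
  assumes "p \<in> points \<P>"
  shows "p \<in> \<P>" "vec.dim p = 1" "vec.subspace p"
  using assms mem_PD(1) unfolding points_def by auto

lemma point_eq_span:
  assumes "p \<in> points \<P>" "v \<in> p" "v \<noteq> 0"
  shows "p = vec.span {v}"
proof (rule vec.subspace_dim_equal[symmetric])
  show "vec.span {v} \<subseteq> p" using assms pointD(3) by (intro vec.span_minimal) auto
qed (use pointD[OF assms(1)] assms(3) in auto)

lemma point_subset_iff:
  assumes "p \<in> points \<P>" "v \<in> p" "v \<noteq> 0" "vec.subspace W"
  shows "p \<subseteq> W \<longleftrightarrow> v \<in> W"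
  using point_eq_span[OF assms(1-3)] assms(2) vec.span_minimal[of "{v}" W] assms(4) by blast

lemma point_nonzero: "p \<in> points \<P> \<Longrightarrow> \<exists>v\<in>p. v \<noteq> 0 \<and> iso v"
  using point_iff vec.span_base by blast

lemma points_ofD: "p \<in> points_of \<P> W \<Longrightarrow> p \<in> points \<P>" "p \<in> points_of \<P> W \<Longrightarrow> p \<subseteq> W"
  unfolding points_of_def by auto

lemma points_of_mono: "V \<subseteq> W \<Longrightarrow> points_of \<P> V \<subseteq> points_of \<P> W"
  unfolding points_of_def by blast

lemma points_of_Int: "points_of \<P> (V \<inter> W) = points_of \<P> V \<inter> points_of \<P> W"
  unfolding points_of_def by blast

lemma point_in_points_of: "iso v \<Longrightarrow> v \<noteq> 0 \<Longrightarrow> v \<in> W \<Longrightarrow> vec.subspace W \<Longrightarrow> vec.span {v} \<in> points_of \<P> W"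
  unfolding points_of_def using point_iff vec.span_minimal[of "{v}" W] by blast

text \<open>The number of points of the polar space inside W, see \<open>card_points_of\<close>: a
  point has q - 1 nonzero vectors, and the zero vector is isotropic.\<close>

definition npt :: "('a ^ 'n) set \<Rightarrow> real" where "npt W = (N W - 1) / (q - 1)"

lemma card_points_of:
  assumes W: "vec.subspace W"
  shows "real (card (points_of \<P> W)) = npt W"
proof -
  let ?S = "{v \<in> W. iso v}"
  have "?S - {0} = (\<Union>p\<in>points_of \<P> W. p - {0})"
  proof (intro set_eqI iffI)
    fix v assume "v \<in> ?S - {0}"
    then have "vec.span {v} \<in> points_of \<P> W" "v \<in> vec.span {v} - {0}"
      using point_in_points_of W vec.span_base[of v "{v}"] by auto
    then show "v \<in> (\<Union>p\<in>points_of \<P> W. p - {0})" by blast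
  next
    fix v assume "v \<in> (\<Union>p\<in>points_of \<P> W. p - {0})"
    then obtain p where "p \<in> points \<P>" "p \<subseteq> W" "v \<in> p" "v \<noteq> 0" unfolding points_of_def by blast
    then show "v \<in> ?S - {0}" using mem_PD(2)[OF pointD(1)] by blast
  qed
  moreover have "card (\<Union>p\<in>points_of \<P> W. p - {0}) = (\<Sum>p\<in>points_of \<P> W. card (p - {0}))"
  proof (rule card_UN_disjoint)
    show "\<forall>p\<in>points_of \<P> W. \<forall>p'\<in>points_of \<P> W. p \<noteq> p' \<longrightarrow> (p - {0}) \<inter> (p' - {0}) = {}"
      using point_eq_span points_ofD(1) by blast
  qed auto
  moreover have "card (p - {0}) = CARD('a) - 1" if "p \<in> points_of \<P> W" for p
    using card_subspace[OF pointD(3)[OF points_ofD(1)[OF that]]] pointD(2)[OF points_ofD(1)[OF that]]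
      vec.subspace_0[OF pointD(3)[OF points_ofD(1)[OF that]]]
    by (simp add: card_Diff_singleton)
  ultimately have "card (?S - {0}) = card (points_of \<P> W) * (CARD('a) - 1)" by simp
  moreover have "0 \<in> ?S" using vec.subspace_0[OF W] iso_0 by blast
  then have "card ?S = card (?S - {0}) + 1"
    by (simp add: card_Suc_Diff1 del: card_Diff_insert card_Diff_singleton)
  ultimately have "N W = real (card (points_of \<P> W)) * (q - 1) + 1"
    unfolding N_def q using card_field_gt1[where 'a='a] by (simp add: of_nat_diff)
  then show ?thesis unfolding npt_def using q_gt1 by simp
qed

lemma card_points_diff:
  assumes "vec.subspace W" "vec.subspace V" "V \<subseteq> W"
  shows "real (card (points_of \<P> W - points_of \<P> V)) = npt W - npt V"
proof -
  have "card (points_of \<P> W - points_of \<P> V) = card (points_of \<P> W) - card (points_of \<P> V)"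
    by (rule card_Diff_subset) (use points_of_mono[OF assms(3)] in auto)
  moreover have "card (points_of \<P> V) \<le> card (points_of \<P> W)"
    by (rule card_mono) (use points_of_mono[OF assms(3)] in auto)
  ultimately show ?thesis using card_points_of assms by (simp add: of_nat_diff)
qed

lemma npt_P:
  assumes "S \<in> \<P>"
  shows "npt S = (q ^ vec.dim S - 1) / (q - 1)"
proof -
  have "{v \<in> S. iso v} = S" using mem_PD(2)[OF assms] by blast
  then have "N S = q ^ vec.dim S" unfolding N_def q using card_subspace[OF mem_PD(1)[OF assms]] by simp
  then show ?thesis unfolding npt_def by simp
qed

text \<open>The number of points perpendicular to a k-dimensional isotropic subspace, see
  \<open>npt_orth\<close>. The quotient q ^ d / q ^ k keeps its meaning for k > d, as for k = 2 when
  d = 1.\<close>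

definition orth_npt :: "nat \<Rightarrow> real" where
  "orth_npt k = (q ^ d + E * q ^ d * (q ^ d / q ^ k - 1) / q - 1) / (q - 1)"

text \<open>The number of points perpendicular to such a subspace and to a further point that is not
  perpendicular to all of it: the isotropic vectors are divided by q, see
  \<open>npt_orth_Int\<close>.\<close>

definition orth_npt' :: "nat \<Rightarrow> real" where
  "orth_npt' k = ((q ^ d + E * q ^ d * (q ^ d / q ^ k - 1) / q) / q - 1) / (q - 1)"

lemma npt_orth: "S \<in> \<P> \<Longrightarrow> npt (orth S) = orth_npt (vec.dim S)"
  unfolding npt_def orth_npt_def by (simp add: N_orth)

text \<open>A vector x of S not perpendicular to y is isotropic and lies in the radical of
  \<open>orth S\<close>, so \<open>N_Int_perp\<close> applies.\<close>

lemma npt_orth_Int: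
  assumes "S \<in> \<P>" "y \<in> points \<P>" "\<not> S \<subseteq> orth y"
  shows "npt (orth S \<inter> orth y) = orth_npt' (vec.dim S)"
proof -
  obtain w where w: "w \<in> y" "w \<noteq> 0" using point_nonzero[OF assms(2)] by blast
  then have y: "y = vec.span {w}" using point_eq_span[OF assms(2)] by blast
  then have o: "orth y = {v. B v w = 0}" using orth_span[of "{w}"] unfolding orth_def by simp
  then obtain x where x: "x \<in> S" "B x w \<noteq> 0" using assms(3) by blast
  have "q * N {v \<in> orth S. B v w = 0} = N (orth S)"
  proof (rule N_Int_perp[OF subspace_orth _ mem_PD(2)[OF assms(1) x(1)] _ x(2)])
    show "x \<in> orth S" using mem_P_subset_orth[OF assms(1)] x(1) by blast
    show "B v x = 0" if "v \<in> orth S" for v using that x(1) unfolding orth_def by blast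
  qed
  moreover have "{v \<in> orth S. B v w = 0} = orth S \<inter> orth y" unfolding o by blast
  ultimately have "N (orth S \<inter> orth y) = N (orth S) / q" using q_gt1 by (simp add: field_simps)
  then show ?thesis unfolding npt_def orth_npt'_def by (simp add: N_orth[OF assms(1)])
qed

text \<open>A reflexive relation, unlike adjacency: every point is collinear with itself.\<close>

definition col :: "('a ^ 'n) set \<Rightarrow> ('a ^ 'n) set \<Rightarrow> bool" where
  "col x y \<longleftrightarrow> x \<in> points \<P> \<and> y \<in> points \<P> \<and> x \<subseteq> orth y"

lemma col_sym: "col x y \<longleftrightarrow> col y x"
  unfolding col_def using orth_sym by blast

lemma col_refl: "x \<in> points \<P> \<Longrightarrow> col x x"
  unfolding col_def using mem_P_subset_orth pointD(1) by blast

lemma span_Un_point_mem_P: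
  assumes "S \<in> \<P>" "p \<in> points \<P>" "p \<subseteq> orth S"
  shows "vec.span (S \<union> p) \<in> \<P>"
proof -
  obtain v where v: "v \<in> p" "v \<noteq> 0" "iso v" using point_nonzero[OF assms(2)] by blast
  then have p: "p = vec.span {v}" using point_eq_span[OF assms(2)] by blast
  have "vec.span (insert v S) \<in> \<P>" using span_insert_mem_P assms v by blast
  moreover have "vec.span (S \<union> p) \<subseteq> vec.span (insert v S)"
  proof (rule vec.span_minimal)
    show "S \<union> p \<subseteq> vec.span (insert v S)"
      unfolding p using vec.span_superset[of "insert v S"] vec.span_mono[of "{v}" "insert v S"] by blast
  qed simp
  ultimately show ?thesis using subspace_mem_P by simp
qed

text \<open>Translates perpendicularity, defined by isotropy of a span, into orthogonality of
  vectors.\<close>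

lemma perp_eq: "S \<in> \<P> \<Longrightarrow> perp \<P> S = points_of \<P> (orth S)"
proof (intro set_eqI iffI)
  fix p assume S: "S \<in> \<P>"
  assume "p \<in> points_of \<P> (orth S)"
  then show "p \<in> perp \<P> S" unfolding perp_def using span_Un_point_mem_P[OF S] points_ofD by blast
next
  fix p assume S: "S \<in> \<P>"
  assume p: "p \<in> perp \<P> S"
  then have "S \<union> p \<subseteq> orth (vec.span (S \<union> p))"
    unfolding perp_def using mem_P_subset_orth[of "vec.span (S \<union> p)"] vec.span_superset[of "S \<union> p"] by blast
  then have "p \<subseteq> orth S" unfolding orth_span orth_Un by blast
  then show "p \<in> points_of \<P> (orth S)" using p unfolding perp_def points_of_def by blast
qed

lemma mem_perp_point: "x \<in> points \<P> \<Longrightarrow> y \<in> points \<P> \<Longrightarrow> x \<in> perp \<P> y \<longleftrightarrow> col x y"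
  using perp_eq[OF pointD(1)] unfolding col_def points_of_def by blast

lemma dim_span_Un_point:
  assumes "S \<in> \<P>" "p \<in> points \<P>" "\<not> p \<subseteq> S"
  shows "vec.dim (vec.span (S \<union> p)) = vec.dim S + 1"
proof -
  obtain v where v: "v \<in> p" "v \<noteq> 0" "iso v" using point_nonzero[OF assms(2)] by blast
  then have p: "p = vec.span {v}" using point_eq_span[OF assms(2)] by blast
  have sub: "vec.subspace S" using mem_PD(1)[OF assms(1)] .
  then have v': "v \<notin> S" using point_subset_iff[OF assms(2) v(1,2)] assms(3) by blast
  have "vec.span (S \<union> p) = vec.span (insert v S)"
  proof
    show "vec.span (S \<union> p) \<subseteq> vec.span (insert v S)"
    proof (rule vec.span_minimal)
      show "S \<union> p \<subseteq> vec.span (insert v S)"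
        unfolding p using vec.span_superset[of "insert v S"] vec.span_mono[of "{v}" "insert v S"] by blast
    qed simp
    show "vec.span (insert v S) \<subseteq> vec.span (S \<union> p)" using v(1) by (intro vec.span_mono) blast
  qed
  then show ?thesis using v' sub by (simp add: vec.dim_insert vec.span_eq_iff[THEN iffD2])
qed

lemma point_eq_iff: "x \<in> points \<P> \<Longrightarrow> y \<in> points \<P> \<Longrightarrow> x \<subseteq> y \<Longrightarrow> x = y"
  using pointD by (intro vec.subspace_dim_equal) auto

text \<open>Common neighbours of two collinear points are the points perpendicular to the line
  joining them; for non-collinear points the perp of one is cut with that of the other. Subtracting
  1 or 2 removes the points themselves.\<close>

lemma collinearity_graph:
  "strongly_regular (points \<P>) (\<lambda>x y. x \<noteq> y \<and> col x y)
     (orth_npt 0) (orth_npt 1 - 1) (orth_npt 2 - 2) (orth_npt' 1)"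
  unfolding strongly_regular_def
proof (intro conjI ballI impI)
  show "finite (points \<P>)" by simp
  show "y \<noteq> x" "col y x" if "x \<noteq> y \<and> col x y" for x y using that col_sym by auto
  have "points_of \<P> (orth {0}) = points \<P>" unfolding points_of_def orth_def by auto
  then show "real (card (points \<P>)) = orth_npt 0"
    using card_points_of[OF subspace_orth, of "{0}"] npt_orth[OF zero_mem_P] by simp
  have nbr: "{z \<in> points \<P>. col x z} = points_of \<P> (orth x)" if x: "x \<in> points \<P>" for x
    unfolding col_sym[of x] unfolding col_def points_of_def using x by blast
  fix x assume x: "x \<in> points \<P>"
  have xx: "x \<in> points_of \<P> (orth x)" using col_refl[OF x] unfolding col_def points_of_def by blast
  have "{z \<in> points \<P>. x \<noteq> z \<and> col x z} = points_of \<P> (orth x) - {x}"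
    using nbr[OF x] by blast
  then have "real (card {z \<in> points \<P>. x \<noteq> z \<and> col x z}) = real (card (points_of \<P> (orth x))) - 1"
    using real_card_Diff_singleton[OF _ xx] by simp
  then show "real (card {z \<in> points \<P>. x \<noteq> z \<and> col x z}) = orth_npt 1 - 1"
    using card_points_of[OF subspace_orth] npt_orth[OF pointD(1)[OF x]] pointD(2)[OF x] by simp
  fix y assume y: "y \<in> points \<P>"
  have common: "{z \<in> points \<P>. (x \<noteq> z \<and> col x z) \<and> (y \<noteq> z \<and> col y z)} = points_of \<P> (orth x \<inter> orth y) - {x, y}"
    unfolding points_of_Int nbr[OF x, symmetric] nbr[OF y, symmetric] by blast
  have sub: "vec.subspace (orth x \<inter> orth y)" using vec.subspace_inter[OF subspace_orth subspace_orth] .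
  {
    assume a: "x \<noteq> y \<and> x \<noteq> y \<and> col x y"
    then have "\<not> y \<subseteq> x" using point_eq_iff[OF y x] by blast
    have "y \<subseteq> orth x" using a col_sym[of x y] unfolding col_def by blast
    then have P: "vec.span (x \<union> y) \<in> \<P>" using span_Un_point_mem_P[OF pointD(1)[OF x] y] by blast
    have "{x, y} \<subseteq> points_of \<P> (orth x \<inter> orth y)"
      using col_refl[OF x] col_refl[OF y] a col_sym[of x y] unfolding points_of_def col_def by blast
    then have "card (points_of \<P> (orth x \<inter> orth y) - {x, y}) = card (points_of \<P> (orth x \<inter> orth y)) - card {x, y}"
      "card {x, y} \<le> card (points_of \<P> (orth x \<inter> orth y))"
      by (intro card_Diff_subset card_mono; simp)+
    then have "real (card (points_of \<P> (orth x \<inter> orth y) - {x, y})) = npt (orth x \<inter> orth y) - 2"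
      using card_points_of[OF sub] a by (simp add: of_nat_diff)
    also have "npt (orth x \<inter> orth y) = npt (orth (vec.span (x \<union> y)))" unfolding orth_span orth_Un ..
    also have "\<dots> = orth_npt 2"
      using npt_orth[OF P] dim_span_Un_point[OF pointD(1)[OF x] y \<open>\<not> y \<subseteq> x\<close>] pointD(2)[OF x]
      by (simp add: numeral_2_eq_2)
    finally show "real (card {z \<in> points \<P>. (x \<noteq> z \<and> col x z) \<and> (y \<noteq> z \<and> col y z)}) = orth_npt 2 - 2"
      unfolding common .
  }
  {
    assume a: "x \<noteq> y \<and> \<not> (x \<noteq> y \<and> col x y)"
    then have n: "\<not> x \<subseteq> orth y" using x y unfolding col_def by blast
    then have "\<not> y \<subseteq> orth x" using orth_sym by blast
    \<comment> \<open>Neither point is perpendicular to the other, so nothing has to be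
      removed.\<close>
    then have "points_of \<P> (orth x \<inter> orth y) - {x, y} = points_of \<P> (orth x \<inter> orth y)"
      using n unfolding points_of_def by blast
    then show "real (card {z \<in> points \<P>. (x \<noteq> z \<and> col x z) \<and> (y \<noteq> z \<and> col y z)}) = orth_npt' 1"
      unfolding common
      using card_points_of[OF sub] npt_orth_Int[OF pointD(1)[OF x] y n] pointD(2)[OF x] by simp
  }
qed (auto simp: strongly_regular_def)

end

section \<open>Switching hyperplanes\<close>

lemma card_fibre_sum:
  assumes "finite Z" "finite T"
  shows "card {z \<in> Z. f z \<in> T} = (\<Sum>H\<in>T. card {z \<in> Z. f z = H})"
proof -
  have "{z \<in> Z. f z \<in> T} = (\<Union>H\<in>T. {z \<in> Z. f z = H})" by auto
  moreover have "card (\<Union>H\<in>T. {z \<in> Z. f z = H}) = (\<Sum>H\<in>T. card {z \<in> Z. f z = H})"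
    by (rule card_UN_disjoint) (use assms in auto)
  ultimately show ?thesis by metis
qed

text \<open>Moves a condition from \<open>s x\<close> to \<open>x\<close>; in this way a permutation
  of hyperplanes disappears from a count.\<close>

lemma bij_betw_filter:
  assumes "bij_betw s A A"
  shows "bij_betw s {x \<in> A. Q (s x)} {x \<in> A. Q x}"
  using assms unfolding bij_betw_def by (auto simp: inj_on_def)

lemmas card_bij_filter = bij_betw_same_card[OF bij_betw_filter]

text \<open>The combinatorics on which switching rests, without any form. Members of
  \<open>Hs i\<close> are the hyperplanes of the affine part \<open>A i\<close>, and
  \<open>tr H\<close> is the set of points at infinity of H, so equal \<open>tr\<close> means
  parallel. \<open>a\<close> is the size of a hyperplane, \<open>b\<close> that of the intersection
  of two non-parallel ones. \<open>c\<close> counts the z in \<open>Z\<close> with a given trace in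
  \<open>A i\<close>, \<open>c2\<close> those with given traces in two parts that agree at infinity.
  \<open>c3\<close> and \<open>n0\<close> count only the z collinear with a fixed y whose trace
  differs from that of y or equals it; \<open>c3\<close> is the same for traces parallel and
  non-parallel to that of y.\<close>

locale hyperplane_switching =
  fixes L Z :: "'p set" and I :: "'i set" and A :: "'i \<Rightarrow> 'p set"
    and C :: "'p \<Rightarrow> 'p \<Rightarrow> bool"
    and Hs :: "'i \<Rightarrow> 'p set set" and tr :: "'p set \<Rightarrow> 'p set"
    and a b c c2 c3 n0 :: nat
  assumes fin: "finite L" "finite Z" "finite I" "\<And>i. i \<in> I \<Longrightarrow> finite (A i)"
    and disj: "L \<inter> Z = {}" "\<And>i. i \<in> I \<Longrightarrow> L \<inter> A i = {}" "\<And>i. i \<in> I \<Longrightarrow> A i \<inter> Z = {}"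
      "\<And>i j. i \<in> I \<Longrightarrow> j \<in> I \<Longrightarrow> i \<noteq> j \<Longrightarrow> A i \<inter> A j = {}"
    and sym: "C x y \<longleftrightarrow> C y x"
    and refl_Z: "z \<in> Z \<Longrightarrow> C z z"
    and C_L_A: "\<And>i x y. i \<in> I \<Longrightarrow> x \<in> L \<Longrightarrow> y \<in> A i \<Longrightarrow> C x y"
    and C_A_A: "\<And>i x y. i \<in> I \<Longrightarrow> x \<in> A i \<Longrightarrow> y \<in> A i \<Longrightarrow> C x y"
    and not_C_A_A: "\<And>i j x y. i \<in> I \<Longrightarrow> j \<in> I \<Longrightarrow> i \<noteq> j \<Longrightarrow> x \<in> A i \<Longrightarrow> y \<in> A j \<Longrightarrow> \<not> C x y"
    and Hs_subset: "\<And>i H. i \<in> I \<Longrightarrow> H \<in> Hs i \<Longrightarrow> H \<subseteq> A i"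
    and trace_Hs: "\<And>i z. i \<in> I \<Longrightarrow> z \<in> Z \<Longrightarrow> {x \<in> A i. C x z} \<in> Hs i"
    and tr_trace: "\<And>i z. i \<in> I \<Longrightarrow> z \<in> Z \<Longrightarrow> tr {x \<in> A i. C x z} = {x \<in> L. C x z}"
    and card_Hs: "\<And>i H. i \<in> I \<Longrightarrow> H \<in> Hs i \<Longrightarrow> card H = a"
    and parallel_disjoint: "\<And>i H H'. i \<in> I \<Longrightarrow> H \<in> Hs i \<Longrightarrow> H' \<in> Hs i \<Longrightarrow> tr H = tr H' \<Longrightarrow> H \<noteq> H'
      \<Longrightarrow> H \<inter> H' = {}"
    and card_nonparallel: "\<And>i H H'. i \<in> I \<Longrightarrow> H \<in> Hs i \<Longrightarrow> H' \<in> Hs i \<Longrightarrow> tr H \<noteq> tr H'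
      \<Longrightarrow> card (H \<inter> H') = b"
    and parallel_through: "\<And>i H x. i \<in> I \<Longrightarrow> H \<in> Hs i \<Longrightarrow> x \<in> A i \<Longrightarrow> \<exists>H'\<in>Hs i. tr H' = tr H \<and> x \<in> H'"
    and fibre: "\<And>i H. i \<in> I \<Longrightarrow> H \<in> Hs i \<Longrightarrow> card {z \<in> Z. {x \<in> A i. C x z} = H} = c"
    and fibre2: "\<And>i j H H'. i \<in> I \<Longrightarrow> j \<in> I \<Longrightarrow> i \<noteq> j \<Longrightarrow> H \<in> Hs i \<Longrightarrow> H' \<in> Hs j \<Longrightarrow> tr H = tr H'
      \<Longrightarrow> card {z \<in> Z. {x \<in> A i. C x z} = H \<and> {x \<in> A j. C x z} = H'} = c2"
    and fibre_perp: "\<And>i y H. i \<in> I \<Longrightarrow> y \<in> Z \<Longrightarrow> H \<in> Hs i \<Longrightarrow> H \<noteq> {x \<in> A i. C x y}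
      \<Longrightarrow> card {z \<in> Z. C z y \<and> {x \<in> A i. C x z} = H} = c3"
    and fibre_perp0: "\<And>i y. i \<in> I \<Longrightarrow> y \<in> Z
      \<Longrightarrow> card {z \<in> Z. C z y \<and> {x \<in> A i. C x z} = {x \<in> A i. C x y}} = n0"
begin

text \<open>The trace of the perp of z in \<open>A i\<close>, as opposed to \<open>tr\<close>, which
  takes a hyperplane to its part at infinity.\<close>

definition tr_of :: "'i \<Rightarrow> 'p \<Rightarrow> 'p set" where "tr_of i z = {x \<in> A i. C x z}"

definition X :: "'p set" where "X = L \<union> (\<Union>i\<in>I. A i) \<union> Z"

definition valid :: "('i \<Rightarrow> 'p set \<Rightarrow> 'p set) \<Rightarrow> bool" where
  "valid \<sigma> \<longleftrightarrow> (\<forall>i\<in>I. bij_betw (\<sigma> i) (Hs i) (Hs i) \<and> (\<forall>H\<in>Hs i. tr (\<sigma> i H) = tr H))"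

definition adj :: "('i \<Rightarrow> 'p set \<Rightarrow> 'p set) \<Rightarrow> 'p \<Rightarrow> 'p \<Rightarrow> bool" where
  "adj \<sigma> x y \<longleftrightarrow> x \<noteq> y \<and>
     (if x \<in> (\<Union>i\<in>I. A i) \<and> y \<in> Z then \<exists>i\<in>I. x \<in> A i \<and> x \<in> \<sigma> i (tr_of i y)
      else if x \<in> Z \<and> y \<in> (\<Union>i\<in>I. A i) then \<exists>i\<in>I. y \<in> A i \<and> y \<in> \<sigma> i (tr_of i x)
      else C x y)"

abbreviation (input) nosw :: "'i \<Rightarrow> 'p set \<Rightarrow> 'p set" where "nosw \<equiv> \<lambda>_ H. H"

definition nb :: "('i \<Rightarrow> 'p set \<Rightarrow> 'p set) \<Rightarrow> 'p \<Rightarrow> 'p set" where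
  "nb \<sigma> x = {z \<in> X. adj \<sigma> x z}"

lemma valid_id: "valid nosw"
  unfolding valid_def by (auto simp: bij_betw_def)

lemma A_unique: "i \<in> I \<Longrightarrow> j \<in> I \<Longrightarrow> x \<in> A i \<Longrightarrow> x \<in> A j \<Longrightarrow> i = j"
  using disj(4) by blast

lemma not_A:
  "x \<in> L \<Longrightarrow> i \<in> I \<Longrightarrow> x \<notin> A i" "x \<in> L \<Longrightarrow> x \<notin> Z" "x \<in> Z \<Longrightarrow> i \<in> I \<Longrightarrow> x \<notin> A i" "x \<in> Z \<Longrightarrow> x \<notin> L"
  "x \<in> A i \<Longrightarrow> i \<in> I \<Longrightarrow> x \<notin> L" "x \<in> A i \<Longrightarrow> i \<in> I \<Longrightarrow> x \<notin> Z"
  using disj(1) disj(2)[of i] disj(3)[of i] by blast+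

lemma ex_A_iff:
  assumes "i \<in> I" "x \<in> A i"
  shows "(\<exists>j\<in>I. x \<in> A j \<and> Q j) \<longleftrightarrow> Q i"
  using assms A_unique[OF assms(1) _ assms(2)] by blast

lemma adj_A_Z:
  assumes "i \<in> I" "x \<in> A i" "y \<in> Z"
  shows "adj \<sigma> x y \<longleftrightarrow> x \<in> \<sigma> i (tr_of i y)"
proof -
  have "x \<noteq> y" using not_A(6)[OF assms(2,1)] assms(3) by blast
  moreover have "x \<in> (\<Union>i\<in>I. A i) \<and> y \<in> Z" using assms by blast
  ultimately show ?thesis
    unfolding adj_def by (simp only: if_True ex_A_iff[OF assms(1,2)] simp_thms)
qed

lemma adj_Z_A:
  assumes "i \<in> I" "x \<in> A i" "y \<in> Z"
  shows "adj \<sigma> y x \<longleftrightarrow> x \<in> \<sigma> i (tr_of i y)"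
proof -
  have "y \<noteq> x" using not_A(6)[OF assms(2,1)] assms(3) by blast
  moreover have "y \<in> Z \<and> x \<in> (\<Union>i\<in>I. A i)" using assms by blast
  moreover have "\<not> (y \<in> (\<Union>i\<in>I. A i) \<and> x \<in> Z)" using not_A(6)[OF assms(2,1)] by blast
  ultimately show ?thesis
    unfolding adj_def by (simp only: if_True if_False ex_A_iff[OF assms(1,2)] simp_thms)
qed

lemma adj_indep:
  assumes "x \<in> Z \<Longrightarrow> y \<notin> (\<Union>i\<in>I. A i)" "y \<in> Z \<Longrightarrow> x \<notin> (\<Union>i\<in>I. A i)"
  shows "adj \<sigma> x y \<longleftrightarrow> x \<noteq> y \<and> C x y"
proof -
  have "\<not> (x \<in> (\<Union>i\<in>I. A i) \<and> y \<in> Z)" "\<not> (x \<in> Z \<and> y \<in> (\<Union>i\<in>I. A i))"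
    using assms by blast+
  then show ?thesis unfolding adj_def by (simp only: if_False)
qed

lemma adj_L: "x \<in> L \<Longrightarrow> adj \<sigma> x y \<longleftrightarrow> x \<noteq> y \<and> C x y"
  by (rule adj_indep) (use not_A in blast)+

lemma adj_L': "y \<in> L \<Longrightarrow> adj \<sigma> x y \<longleftrightarrow> x \<noteq> y \<and> C x y"
  by (rule adj_indep) (use not_A in blast)+

lemma adj_A_A: "i \<in> I \<Longrightarrow> j \<in> I \<Longrightarrow> x \<in> A i \<Longrightarrow> y \<in> A j \<Longrightarrow> adj \<sigma> x y \<longleftrightarrow> x \<noteq> y \<and> C x y"
  by (rule adj_indep) (use not_A in blast)+

lemma adj_Z_Z: "x \<in> Z \<Longrightarrow> y \<in> Z \<Longrightarrow> adj \<sigma> x y \<longleftrightarrow> x \<noteq> y \<and> C x y"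
  by (rule adj_indep) (use not_A in blast)+

lemma adj_sym: "adj \<sigma> x y \<longleftrightarrow> adj \<sigma> y x"
proof (cases "(x \<in> (\<Union>i\<in>I. A i) \<and> y \<in> Z) \<or> (x \<in> Z \<and> y \<in> (\<Union>i\<in>I. A i))")
  case True
  then show ?thesis using adj_A_Z adj_Z_A by (elim disjE conjE UN_E) simp_all
next
  case False
  then show ?thesis using adj_indep[of x y \<sigma>] adj_indep[of y x \<sigma>] sym[of x y] by blast
qed

lemma adj_nosw: "adj nosw x y \<longleftrightarrow> x \<noteq> y \<and> C x y"
proof -
  consider i where "i \<in> I" "x \<in> A i" "y \<in> Z" | i where "i \<in> I" "y \<in> A i" "x \<in> Z"
    | "x \<in> Z \<Longrightarrow> y \<notin> (\<Union>i\<in>I. A i)" "y \<in> Z \<Longrightarrow> x \<notin> (\<Union>i\<in>I. A i)"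
    by blast
  then show ?thesis
  proof cases
    case (1 i)
    then have "x \<noteq> y" using not_A(6) by metis
    with 1 show ?thesis unfolding adj_A_Z[OF 1] tr_of_def by blast
  next
    case (2 i)
    then have "x \<noteq> y" using not_A(6) by metis
    with 2 show ?thesis unfolding adj_Z_A[OF 2] tr_of_def using sym[of x y] by blast
  qed (rule adj_indep)
qed

lemma nb_L: "x \<in> L \<Longrightarrow> nb \<sigma> x = {z \<in> X. x \<noteq> z \<and> C x z}"
  unfolding nb_def by (simp add: adj_L)

lemma nb_A:
  assumes "i \<in> I" "x \<in> A i"
  shows "nb \<sigma> x \<inter> L = L" "nb \<sigma> x \<inter> A i = A i - {x}"
    "j \<in> I \<Longrightarrow> j \<noteq> i \<Longrightarrow> nb \<sigma> x \<inter> A j = {}" "nb \<sigma> x \<inter> Z = {z \<in> Z. x \<in> \<sigma> i (tr_of i z)}"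
proof -
  have X: "L \<subseteq> X" "Z \<subseteq> X" "\<And>j. j \<in> I \<Longrightarrow> A j \<subseteq> X" unfolding X_def by auto
  have "adj \<sigma> x z" if "z \<in> L" for z
    unfolding adj_L'[OF that] using C_L_A[OF assms(1) that assms(2)] sym[of x z] not_A(5)[OF assms(2,1)] that by blast
  then show "nb \<sigma> x \<inter> L = L" using X unfolding nb_def by blast
  have "adj \<sigma> x z \<longleftrightarrow> x \<noteq> z" if "z \<in> A i" for z
    unfolding adj_A_A[OF assms(1,1,2) that] using C_A_A[OF assms that] by blast
  then show "nb \<sigma> x \<inter> A i = A i - {x}" using X(3)[OF assms(1)] unfolding nb_def by blast
  show "nb \<sigma> x \<inter> A j = {}" if "j \<in> I" "j \<noteq> i"
    using adj_A_A[OF assms(1) that(1) assms(2)] not_C_A_A[OF assms(1) that(1) _ assms(2)] that(2)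
    unfolding nb_def by blast
  show "nb \<sigma> x \<inter> Z = {z \<in> Z. x \<in> \<sigma> i (tr_of i z)}"
    using adj_A_Z[OF assms] X(2) unfolding nb_def by blast
qed

lemma tr_of_Hs: "i \<in> I \<Longrightarrow> z \<in> Z \<Longrightarrow> tr_of i z \<in> Hs i"
  unfolding tr_of_def by (rule trace_Hs)

lemma valid_Hs: "valid \<sigma> \<Longrightarrow> i \<in> I \<Longrightarrow> H \<in> Hs i \<Longrightarrow> \<sigma> i H \<in> Hs i"
  unfolding valid_def bij_betw_def by blast

lemma valid_tr: "valid \<sigma> \<Longrightarrow> i \<in> I \<Longrightarrow> H \<in> Hs i \<Longrightarrow> tr (\<sigma> i H) = tr H"
  unfolding valid_def by blast

lemma valid_inj: "valid \<sigma> \<Longrightarrow> i \<in> I \<Longrightarrow> H \<in> Hs i \<Longrightarrow> H' \<in> Hs i \<Longrightarrow> \<sigma> i H = \<sigma> i H' \<longleftrightarrow> H = H'"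
  unfolding valid_def bij_betw_def inj_on_def by blast

lemma nb_Z:
  assumes "valid \<sigma>" "z \<in> Z"
  shows "nb \<sigma> z \<inter> L = {x \<in> L. C x z}" "i \<in> I \<Longrightarrow> nb \<sigma> z \<inter> A i = \<sigma> i (tr_of i z)"
    "nb \<sigma> z \<inter> Z = {x \<in> Z. x \<noteq> z \<and> C x z}"
proof -
  have X: "L \<subseteq> X" "Z \<subseteq> X" "\<And>j. j \<in> I \<Longrightarrow> A j \<subseteq> X" unfolding X_def by auto
  have "adj \<sigma> z x \<longleftrightarrow> C x z" if "x \<in> L" for x
    unfolding adj_L'[OF that] using sym[of x z] not_A(2)[OF that] assms(2) by blast
  then show "nb \<sigma> z \<inter> L = {x \<in> L. C x z}" using X(1) unfolding nb_def by blast
  show "nb \<sigma> z \<inter> A i = \<sigma> i (tr_of i z)" if i: "i \<in> I"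
  proof -
    have "\<sigma> i (tr_of i z) \<subseteq> A i"
      using Hs_subset[OF i] valid_Hs[OF assms(1) i] tr_of_Hs[OF i assms(2)] by blast
    then show ?thesis
      using adj_Z_A[OF i _ assms(2)] X(3)[OF i] unfolding nb_def by blast
  qed
  show "nb \<sigma> z \<inter> Z = {x \<in> Z. x \<noteq> z \<and> C x z}"
    using adj_Z_Z[OF assms(2)] sym[of z] X(2) unfolding nb_def by blast
qed

lemma finite_Hs: "i \<in> I \<Longrightarrow> finite (Hs i)"
  using Hs_subset fin(4) by (meson Pow_iff finite_Pow_iff finite_subset subsetI)

section \<open>Common neighbours, counted part by part\<close>

lemma card_split:
  assumes "S \<subseteq> X"
  shows "card S = card (S \<inter> L) + (\<Sum>i\<in>I. card (S \<inter> A i)) + card (S \<inter> Z)"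
proof -
  have S: "S = (S \<inter> L \<union> (\<Union>i\<in>I. S \<inter> A i)) \<union> S \<inter> Z"
    using assms unfolding X_def by blast
  have fA: "finite (\<Union>i\<in>I. S \<inter> A i)" using fin(3,4) by blast
  have "card S = card (S \<inter> L \<union> (\<Union>i\<in>I. S \<inter> A i)) + card (S \<inter> Z)"
  proof (subst S, rule card_Un_disjoint)
    show "(S \<inter> L \<union> (\<Union>i\<in>I. S \<inter> A i)) \<inter> (S \<inter> Z) = {}" using disj(1,3) by blast
  qed (use fin(1,2) fA in blast)+
  also have "card (S \<inter> L \<union> (\<Union>i\<in>I. S \<inter> A i)) = card (S \<inter> L) + card (\<Union>i\<in>I. S \<inter> A i)"
  proof (rule card_Un_disjoint)
    show "S \<inter> L \<inter> (\<Union>i\<in>I. S \<inter> A i) = {}" using disj(2) by blast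
  qed (use fin(1) fA in blast)+
  also have "card (\<Union>i\<in>I. S \<inter> A i) = (\<Sum>i\<in>I. card (S \<inter> A i))"
  proof (rule card_UN_disjoint)
    show "\<forall>i\<in>I. \<forall>j\<in>I. i \<noteq> j \<longrightarrow> S \<inter> A i \<inter> (S \<inter> A j) = {}" using disj(4) by blast
  qed (use fin(3,4) in blast)+
  finally show ?thesis .
qed

text \<open>For x = y this is the degree of x, so degrees and common neighbours are compared by the
  same lemmas.\<close>

definition cn :: "('i \<Rightarrow> 'p set \<Rightarrow> 'p set) \<Rightarrow> 'p \<Rightarrow> 'p \<Rightarrow> nat" where
  "cn \<sigma> x y = card (nb \<sigma> x \<inter> nb \<sigma> y)"

lemma cn_split:
  "cn \<sigma> x y = card ((nb \<sigma> x \<inter> L) \<inter> (nb \<sigma> y \<inter> L))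
     + (\<Sum>i\<in>I. card ((nb \<sigma> x \<inter> A i) \<inter> (nb \<sigma> y \<inter> A i)))
     + card ((nb \<sigma> x \<inter> Z) \<inter> (nb \<sigma> y \<inter> Z))"
proof -
  have "(S \<inter> T) \<inter> (S' \<inter> T) = (S \<inter> S') \<inter> T" for S S' T :: "'p set" by blast
  moreover have "nb \<sigma> x \<inter> nb \<sigma> y \<subseteq> X" unfolding nb_def by blast
  ultimately show ?thesis unfolding cn_def by (simp only: card_split)
qed

lemma cn_commute: "cn \<sigma> x y = cn \<sigma> y x"
  unfolding cn_def by (simp add: Int_commute)

lemma nb_L_indep: "x \<in> L \<Longrightarrow> nb \<sigma> x = nb nosw x"
  by (simp add: nb_L)

lemma cn_L_L: "x \<in> L \<Longrightarrow> y \<in> L \<Longrightarrow> cn \<sigma> x y = cn nosw x y"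
  unfolding cn_def by (metis nb_L_indep)

text \<open>A point of L is adjacent to all of each \<open>A i\<close>, so \<open>A i\<close>
  contributes the size of a switched hyperplane, which is always \<open>a\<close>.\<close>

lemma cn_L_Z:
  assumes "valid \<sigma>" "x \<in> L" "y \<in> Z"
  shows "cn \<sigma> x y = cn nosw x y"
proof -
  have "nb \<sigma>' x \<inter> A i = A i" if "i \<in> I" for i \<sigma>'
    unfolding nb_L[OF assms(2)] X_def
    using that C_L_A[OF that assms(2)] not_A(1)[OF assms(2) that] by blast
  moreover have "A i \<inter> \<sigma>' i (tr_of i y) = \<sigma>' i (tr_of i y)" "card (\<sigma>' i (tr_of i y)) = a"
    if "i \<in> I" "valid \<sigma>'" for i \<sigma>'
    using that Hs_subset card_Hs valid_Hs tr_of_Hs[OF _ assms(3)] by blast+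
  ultimately have A: "card ((nb \<sigma>' x \<inter> A i) \<inter> (nb \<sigma>' y \<inter> A i)) = a" if "i \<in> I" "valid \<sigma>'" for i \<sigma>'
    using that assms by (simp add: nb_Z)
  have "(\<Sum>i\<in>I. card ((nb \<sigma> x \<inter> A i) \<inter> (nb \<sigma> y \<inter> A i))) = (\<Sum>i\<in>I. card ((nb nosw x \<inter> A i) \<inter> (nb nosw y \<inter> A i)))"
    using A assms(1) valid_id by (intro sum.cong) auto
  then show ?thesis
    unfolding cn_split[of \<sigma>] cn_split[of nosw] nb_L_indep[OF assms(2), of \<sigma>]
      nb_Z(1,3)[OF assms(1,3)] nb_Z(1,3)[OF valid_id assms(3)] by simp
qed

text \<open>The size of the intersection of two hyperplanes depends only on whether they are equal,
  parallel or neither, and \<open>\<sigma> i\<close> preserves this.\<close>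

lemma cn_Z_Z:
  assumes "valid \<sigma>" "x \<in> Z" "y \<in> Z"
  shows "cn \<sigma> x y = cn nosw x y"
proof -
  have "card (\<sigma>' i (tr_of i x) \<inter> \<sigma>' i (tr_of i y)) =
      (if tr_of i x = tr_of i y then a else if tr (tr_of i x) = tr (tr_of i y) then 0 else b)"
    if i: "i \<in> I" and v: "valid \<sigma>'" for i \<sigma>'
  proof -
    note H = tr_of_Hs[OF i assms(2)] tr_of_Hs[OF i assms(3)]
    note H' = valid_Hs[OF v i H(1)] valid_Hs[OF v i H(2)]
    consider "tr_of i x = tr_of i y" | "tr_of i x \<noteq> tr_of i y" "tr (tr_of i x) = tr (tr_of i y)"
      | "tr (tr_of i x) \<noteq> tr (tr_of i y)" by blast
    then show ?thesis
    proof cases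
      case 1
      then show ?thesis using card_Hs[OF i H'(1)] by simp
    next
      case 2
      then have "\<sigma>' i (tr_of i x) \<inter> \<sigma>' i (tr_of i y) = {}"
        using valid_inj[OF v i H] valid_tr[OF v i] H by (intro parallel_disjoint[OF i H']) simp_all
      then show ?thesis using 2 by simp
    next
      case 3
      then have "card (\<sigma>' i (tr_of i x) \<inter> \<sigma>' i (tr_of i y)) = b"
        using valid_tr[OF v i] H by (intro card_nonparallel[OF i H']) simp
      then show ?thesis using 3 by auto
    qed
  qed
  from this[OF _ assms(1)] this[OF _ valid_id]
  have "(\<Sum>i\<in>I. card ((nb \<sigma> x \<inter> A i) \<inter> (nb \<sigma> y \<inter> A i))) = (\<Sum>i\<in>I. card ((nb nosw x \<inter> A i) \<inter> (nb nosw y \<inter> A i)))"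
    using nb_Z(2) assms valid_id by (intro sum.cong) simp_all
  then show ?thesis
    unfolding cn_split[of \<sigma>] cn_split[of nosw]
      nb_Z(1,3)[OF assms(1,3)] nb_Z(1,3)[OF valid_id assms(3)]
      nb_Z(1,3)[OF assms(1,2)] nb_Z(1,3)[OF valid_id assms(2)] by simp
qed

text \<open>All fibres of the trace map have size \<open>c\<close>, which turns a count over
  \<open>Z\<close> into one over hyperplanes.\<close>

lemma count_fibres:
  assumes "i \<in> I"
  shows "card {z \<in> Z. Q (tr_of i z)} = card {H \<in> Hs i. Q H} * c"
proof -
  have "{z \<in> Z. Q (tr_of i z)} = {z \<in> Z. tr_of i z \<in> {H \<in> Hs i. Q H}}"
    using tr_of_Hs[OF assms] by auto
  also have "card \<dots> = (\<Sum>H\<in>{H \<in> Hs i. Q H}. card {z \<in> Z. tr_of i z = H})"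
    using fin finite_Hs[OF assms] by (intro card_fibre_sum) auto
  also have "\<dots> = (\<Sum>H\<in>{H \<in> Hs i. Q H}. c)"
    using fibre[OF assms] by (intro sum.cong) (auto simp: tr_of_def)
  finally show ?thesis by simp
qed

text \<open>Whether x in L is collinear with z can be read off from the part at infinity of the
  trace of z, which switching leaves alone. Both conditions on z thus become conditions on the
  switched hyperplane, and as \<open>\<sigma> i\<close> is a bijection their number does not depend
  on it.\<close>

lemma cn_L_A:
  assumes "valid \<sigma>" "x \<in> L" "i \<in> I" "y \<in> A i"
  shows "cn \<sigma> x y = cn nosw x y"
proof -
  have Z: "card ((nb \<sigma>' x \<inter> Z) \<inter> (nb \<sigma>' y \<inter> Z)) = card {H \<in> Hs i. x \<in> tr H \<and> y \<in> H} * c"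
    if v: "valid \<sigma>'" for \<sigma>'
  proof -
    have "tr (\<sigma>' i (tr_of i z)) = {x \<in> L. C x z}" if "z \<in> Z" for z
      using tr_trace[OF assms(3) that, folded tr_of_def] valid_tr[OF v assms(3) tr_of_Hs[OF assms(3) that]] by simp
    then have "nb \<sigma>' x \<inter> Z = {z \<in> Z. x \<in> tr (\<sigma>' i (tr_of i z))}"
      unfolding nb_L[OF assms(2)] X_def using assms(2) not_A(2)[OF assms(2)] by blast
    then have "(nb \<sigma>' x \<inter> Z) \<inter> (nb \<sigma>' y \<inter> Z)
        = {z \<in> Z. x \<in> tr (\<sigma>' i (tr_of i z)) \<and> y \<in> \<sigma>' i (tr_of i z)}"
      unfolding nb_A(4)[OF assms(3,4)] by blast
    then have "card ((nb \<sigma>' x \<inter> Z) \<inter> (nb \<sigma>' y \<inter> Z)) = card {H \<in> Hs i. x \<in> tr (\<sigma>' i H) \<and> y \<in> \<sigma>' i H} * c"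
      using count_fibres[OF assms(3), of "\<lambda>H. x \<in> tr (\<sigma>' i H) \<and> y \<in> \<sigma>' i H"] by simp
    then show ?thesis
      using card_bij_filter[of "\<sigma>' i" "Hs i" "\<lambda>H. x \<in> tr H \<and> y \<in> H"] v assms(3)
      unfolding valid_def by simp
  qed
  have A: "nb \<sigma> y \<inter> A j = nb nosw y \<inter> A j" if "j \<in> I" for j
    using nb_A(2,3)[OF assms(3,4)] that by (cases "j = i") simp_all
  show ?thesis
    unfolding cn_split[of \<sigma>] cn_split[of nosw] Z[OF assms(1)] Z[OF valid_id]
    using nb_A(1)[OF assms(3,4)] nb_L_indep[OF assms(2), of \<sigma>] A by simp
qed

lemma cn_A_A:
  assumes "valid \<sigma>" "i \<in> I" "x \<in> A i" "y \<in> A i"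
  shows "cn \<sigma> x y = cn nosw x y"
proof -
  have Z: "card ((nb \<sigma>' x \<inter> Z) \<inter> (nb \<sigma>' y \<inter> Z)) = card {H \<in> Hs i. x \<in> H \<and> y \<in> H} * c"
    if v: "valid \<sigma>'" for \<sigma>'
  proof -
    have "(nb \<sigma>' x \<inter> Z) \<inter> (nb \<sigma>' y \<inter> Z) = {z \<in> Z. x \<in> \<sigma>' i (tr_of i z) \<and> y \<in> \<sigma>' i (tr_of i z)}"
      unfolding nb_A(4)[OF assms(2,3)] nb_A(4)[OF assms(2,4)] by blast
    then have "card ((nb \<sigma>' x \<inter> Z) \<inter> (nb \<sigma>' y \<inter> Z)) = card {H \<in> Hs i. x \<in> \<sigma>' i H \<and> y \<in> \<sigma>' i H} * c"
      using count_fibres[OF assms(2), of "\<lambda>H. x \<in> \<sigma>' i H \<and> y \<in> \<sigma>' i H"] by simp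
    then show ?thesis
      using card_bij_filter[of "\<sigma>' i" "Hs i" "\<lambda>H. x \<in> H \<and> y \<in> H"] v assms(2)
      unfolding valid_def by simp
  qed
  have A: "nb \<sigma> w \<inter> A j = nb nosw w \<inter> A j" if "j \<in> I" "w \<in> A i" for j w
    using nb_A(2,3)[OF assms(2) that(2)] that by (cases "j = i") simp_all
  show ?thesis
    unfolding cn_split[of \<sigma>] cn_split[of nosw] Z[OF assms(1)] Z[OF valid_id]
    using nb_A(1)[OF assms(2,3)] nb_A(1)[OF assms(2,4)] A[OF _ assms(3)] A[OF _ assms(4)] by simp
qed

text \<open>The traces of one z in two parts agree at infinity, so pairs of hyperplanes with a
  common part at infinity are counted, each \<open>c2\<close> times. Acting on both components,
  \<sigma> permutes these pairs because it keeps the part at infinity of each.\<close>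

lemma cn_A_A':
  assumes "valid \<sigma>" "i \<in> I" "j \<in> I" "i \<noteq> j" "x \<in> A i" "y \<in> A j"
  shows "cn \<sigma> x y = cn nosw x y"
proof -
  define T where "T \<sigma>' = {(H, H'). H \<in> Hs i \<and> H' \<in> Hs j \<and> tr H = tr H' \<and> x \<in> \<sigma>' i H \<and> y \<in> \<sigma>' j H'}"
    for \<sigma>'
  have finT: "finite (T \<sigma>')" for \<sigma>'
    by (rule finite_subset[of _ "Hs i \<times> Hs j"]) (use assms finite_Hs in \<open>auto simp: T_def\<close>)
  have Z: "card ((nb \<sigma>' x \<inter> Z) \<inter> (nb \<sigma>' y \<inter> Z)) = card (T nosw) * c2"
    if v: "valid \<sigma>'" for \<sigma>'
  proof -
    have "(nb \<sigma>' x \<inter> Z) \<inter> (nb \<sigma>' y \<inter> Z) = {z \<in> Z. (tr_of i z, tr_of j z) \<in> T \<sigma>'}"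
      unfolding nb_A(4)[OF assms(2,5)] nb_A(4)[OF assms(3,6)] T_def
      using tr_of_Hs assms tr_trace[folded tr_of_def] by auto
    also have "card \<dots> = (\<Sum>H\<in>T \<sigma>'. card {z \<in> Z. (tr_of i z, tr_of j z) = H})"
      using fin finT by (intro card_fibre_sum) auto
    also have "\<dots> = (\<Sum>H\<in>T \<sigma>'. c2)"
      using fibre2[OF assms(2-4)] by (intro sum.cong) (auto simp: tr_of_def T_def)
    finally have *: "card ((nb \<sigma>' x \<inter> Z) \<inter> (nb \<sigma>' y \<inter> Z)) = card (T \<sigma>') * c2" by simp
    have "bij_betw (map_prod (\<sigma>' i) (\<sigma>' j)) (T \<sigma>') (T nosw)"
    proof -
      have b: "bij_betw (map_prod (\<sigma>' i) (\<sigma>' j)) (Hs i \<times> Hs j) (Hs i \<times> Hs j)"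
        using v assms by (intro bij_betw_map_prod) (auto simp: valid_def)
      have t: "tr (\<sigma>' i H) = tr H" if "H \<in> Hs i" for H using valid_tr[OF v assms(2) that] .
      have t': "tr (\<sigma>' j H) = tr H" if "H \<in> Hs j" for H using valid_tr[OF v assms(3) that] .
      have "T \<sigma>' = {p \<in> Hs i \<times> Hs j. (\<lambda>(H, H'). tr H = tr H' \<and> x \<in> H \<and> y \<in> H') (map_prod (\<sigma>' i) (\<sigma>' j) p)}"
        unfolding T_def using t t' by auto
      moreover have "T nosw = {p \<in> Hs i \<times> Hs j. (\<lambda>(H, H'). tr H = tr H' \<and> x \<in> H \<and> y \<in> H') p}"
        unfolding T_def by auto
      ultimately show ?thesis using bij_betw_filter[OF b] by simp
    qed
    then show ?thesis using * bij_betw_same_card by metis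
  qed
  have A: "nb \<sigma> w \<inter> A k = nb nosw w \<inter> A k" if "l \<in> I" "k \<in> I" "w \<in> A l" for k l w
    using nb_A(2,3)[OF that(1,3)] that by (cases "k = l") simp_all
  show ?thesis
    unfolding cn_split[of \<sigma>] cn_split[of nosw] Z[OF assms(1)] Z[OF valid_id]
    using nb_A(1)[OF assms(2,5)] nb_A(1)[OF assms(3,6)] A[OF assms(2) _ assms(5)] A[OF assms(3) _ assms(6)] by simp
qed

text \<open>Exactly one hyperplane of each parallel class contains x, so the number is that of the
  parallel classes.\<close>

lemma card_through:
  assumes "valid \<sigma>" "i \<in> I" "x \<in> A i"
  shows "card {H \<in> Hs i. x \<in> \<sigma> i H} = card (tr ` Hs i)"
proof -
  have "card {H \<in> Hs i. x \<in> \<sigma> i H} = card {H \<in> Hs i. x \<in> H}"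
    using assms by (intro card_bij_filter) (auto simp: valid_def)
  also have "bij_betw tr {H \<in> Hs i. x \<in> H} (tr ` Hs i)"
    unfolding bij_betw_def
  proof
    show "inj_on tr {H \<in> Hs i. x \<in> H}"
      using parallel_disjoint[OF assms(2)] unfolding inj_on_def by blast
    show "tr ` {H \<in> Hs i. x \<in> H} = tr ` Hs i"
    proof
      show "tr ` Hs i \<subseteq> tr ` {H \<in> Hs i. x \<in> H}"
      proof clarify
        fix H assume "H \<in> Hs i"
        from parallel_through[OF assms(2) this assms(3)]
        obtain H' where "H' \<in> Hs i" "tr H' = tr H" "x \<in> H'" by blast
        then show "tr H \<in> tr ` {H \<in> Hs i. x \<in> H}" by (metis (mono_tags, lifting) imageI mem_Collect_eq)
      qed
    qed auto
  qed
  then have "card {H \<in> Hs i. x \<in> H} = card (tr ` Hs i)" by (rule bij_betw_same_card)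
  finally show ?thesis .
qed

text \<open>The summands are the contributions of L, of \<open>A i\<close> and of \<open>Z\<close>.
  In the adjacent case x is left out of the switched trace and y out of its own fibre, hence both
  subtractions of 1, and the trace of y contributes \<open>n0\<close> in place of
  \<open>c3\<close>.\<close>

definition cn_AZ :: "'i \<Rightarrow> 'p \<Rightarrow> bool \<Rightarrow> nat" where
  "cn_AZ i y adjacent = card {x \<in> L. C x y} + (if adjacent then a - 1 else a)
     + (if adjacent then n0 + (card (tr ` Hs i) - 1) * c3 - 1 else card (tr ` Hs i) * c3)"

text \<open>In the other affine parts x has no neighbour. The points z of \<open>Z\<close> are
  sorted by their trace H, subject to x being in \<open>\<sigma> i H\<close>; there is one such H
  per parallel class, and the trace of y is among them exactly if x and y are adjacent.\<close>

lemma cn_A_Z: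
  assumes "valid \<sigma>" "i \<in> I" "x \<in> A i" "y \<in> Z"
  shows "cn \<sigma> x y = cn_AZ i y (x \<in> \<sigma> i (tr_of i y))"
proof -
  let ?T = "{H \<in> Hs i. x \<in> \<sigma> i H}"
  note H = tr_of_Hs[OF assms(2,4)]
  note H' = valid_Hs[OF assms(1,2) H]
  have fT: "finite ?T" using finite_Hs[OF assms(2)] by simp
  have A: "(\<Sum>j\<in>I. card ((nb \<sigma> x \<inter> A j) \<inter> (nb \<sigma> y \<inter> A j))) = (if x \<in> \<sigma> i (tr_of i y) then a - 1 else a)"
  proof -
    have "(\<Sum>j\<in>I. card ((nb \<sigma> x \<inter> A j) \<inter> (nb \<sigma> y \<inter> A j)))
        = (\<Sum>j\<in>I. if j = i then card (\<sigma> i (tr_of i y) - {x}) else 0)"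
    proof (rule sum.cong)
      fix j assume j: "j \<in> I"
      have "(A i - {x}) \<inter> \<sigma> i (tr_of i y) = \<sigma> i (tr_of i y) - {x}"
        using Hs_subset[OF assms(2) H'] by blast
      then show "card ((nb \<sigma> x \<inter> A j) \<inter> (nb \<sigma> y \<inter> A j)) = (if j = i then card (\<sigma> i (tr_of i y) - {x}) else 0)"
        using nb_A(2,3)[OF assms(2,3)] nb_Z(2)[OF assms(1,4)] j by (cases "j = i") simp_all
    qed simp
    also have "\<dots> = card (\<sigma> i (tr_of i y) - {x})" using assms fin by simp
    also have "\<dots> = (if x \<in> \<sigma> i (tr_of i y) then a - 1 else a)"
      using card_Hs[OF assms(2) H'] by (simp add: card_Diff_singleton_if)
    finally show ?thesis .
  qed
  have L: "(nb \<sigma> x \<inter> L) \<inter> (nb \<sigma> y \<inter> L) = {x \<in> L. C x y}"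
    unfolding nb_A(1)[OF assms(2,3)] nb_Z(1)[OF assms(1,4)] by blast
  have "{z \<in> Z. C z y \<and> x \<in> \<sigma> i (tr_of i z)} = {z \<in> {z \<in> Z. C z y}. tr_of i z \<in> ?T}"
    using tr_of_Hs[OF assms(2)] by auto
  then have "card {z \<in> Z. C z y \<and> x \<in> \<sigma> i (tr_of i z)} = (\<Sum>H\<in>?T. card {z \<in> {z \<in> Z. C z y}. tr_of i z = H})"
    using card_fibre_sum[of "{z \<in> Z. C z y}" ?T "tr_of i"] fin fT by simp
  also have "\<dots> = (\<Sum>H\<in>?T. if H = tr_of i y then n0 else c3)"
    using fibre_perp[OF assms(2,4), folded tr_of_def] fibre_perp0[OF assms(2,4), folded tr_of_def]
    by (intro sum.cong) auto
  also have "\<dots> = (if x \<in> \<sigma> i (tr_of i y) then n0 + (card (tr ` Hs i) - 1) * c3 else card (tr ` Hs i) * c3)"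
  proof (cases "x \<in> \<sigma> i (tr_of i y)")
    case True
    then have "tr_of i y \<in> ?T" using H by simp
    then have "(\<Sum>H\<in>?T. if H = tr_of i y then n0 else c3) = n0 + (\<Sum>H\<in>?T - {tr_of i y}. c3)"
      using fT by (subst sum.remove[of _ "tr_of i y"]) (auto intro!: sum.cong)
    also have "(\<Sum>H\<in>?T - {tr_of i y}. c3) = (card ?T - 1) * c3"
      using \<open>tr_of i y \<in> ?T\<close> fT by (simp add: card_Diff_singleton)
    finally show ?thesis using True card_through[OF assms(1-3)] by simp
  next
    case False
    then have "(\<Sum>H\<in>?T. if H = tr_of i y then n0 else c3) = (\<Sum>H\<in>?T. c3)"
      by (intro sum.cong) auto
    then show ?thesis using False card_through[OF assms(1-3)] by simp
  qed
  finally have count: "card {z \<in> Z. C z y \<and> x \<in> \<sigma> i (tr_of i z)} = \<dots>" .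
  have "(nb \<sigma> x \<inter> Z) \<inter> (nb \<sigma> y \<inter> Z) = {z \<in> Z. C z y \<and> x \<in> \<sigma> i (tr_of i z)} - {y}"
    unfolding nb_A(4)[OF assms(2,3)] nb_Z(3)[OF assms(1,4)] by blast
  moreover have "y \<in> {z \<in> Z. C z y \<and> x \<in> \<sigma> i (tr_of i z)} \<longleftrightarrow> x \<in> \<sigma> i (tr_of i y)"
    using assms(4) refl_Z by simp
  ultimately have "card ((nb \<sigma> x \<inter> Z) \<inter> (nb \<sigma> y \<inter> Z)) =
     (if x \<in> \<sigma> i (tr_of i y) then n0 + (card (tr ` Hs i) - 1) * c3 - 1 else card (tr ` Hs i) * c3)"
    using count by (simp add: card_Diff_singleton_if)
  with A L show ?thesis unfolding cn_split cn_AZ_def by simp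
qed

text \<open>Take x' on the unswitched trace of y if x lies on the switched one, and off it
  otherwise. Such a point exists because both hyperplanes have the same size: if one is nonempty, or
  proper in \<open>A i\<close>, so is the other.\<close>

lemma transfer_AZ:
  assumes v: "valid \<sigma>" and "i \<in> I" "x \<in> A i" "y \<in> Z"
  shows "\<exists>x'\<in>A i. (adj \<sigma> x y \<longleftrightarrow> adj nosw x' y) \<and> cn \<sigma> x y = cn nosw x' y"
proof -
  note H = tr_of_Hs[OF assms(2,4)]
  note H' = valid_Hs[OF assms(1,2) H]
  note sub = Hs_subset[OF assms(2) H] Hs_subset[OF assms(2) H']
  have fA: "finite (A i)" using fin assms by blast
  note card = card_Hs[OF assms(2) H] card_Hs[OF assms(2) H']
  have "\<exists>x'\<in>A i. x' \<in> tr_of i y \<longleftrightarrow> x \<in> \<sigma> i (tr_of i y)"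
  proof (cases "x \<in> \<sigma> i (tr_of i y)")
    case True
    then have "tr_of i y \<noteq> {}" using card sub fA by (metis card_0_eq empty_iff finite_subset)
    then show ?thesis using sub True by auto
  next
    case False
    then have "\<sigma> i (tr_of i y) \<subset> A i" using sub assms by blast
    then have "card (tr_of i y) < card (A i)" using card psubset_card_mono[OF fA] by metis
    then have "tr_of i y \<noteq> A i" by auto
    then show ?thesis using sub False by auto
  qed
  then obtain x' where x': "x' \<in> A i" "x' \<in> tr_of i y \<longleftrightarrow> x \<in> \<sigma> i (tr_of i y)" by blast
  then have "(adj \<sigma> x y \<longleftrightarrow> adj nosw x' y) \<and> cn \<sigma> x y = cn nosw x' y"
    using adj_A_Z[OF assms(2-4), of \<sigma>] adj_A_Z[OF assms(2) x'(1) assms(4), of nosw]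
      cn_A_Z[OF assms] cn_A_Z[OF valid_id assms(2) x'(1) assms(4)]
    by simp
  with x' show ?thesis by blast
qed

text \<open>Only a pair of a point of some \<open>A i\<close> and a point of \<open>Z\<close> has to
  be moved, by \<open>transfer_AZ\<close>; every other pair corresponds to itself.\<close>

lemma transfer:
  assumes "valid \<sigma>" "x \<in> X" "y \<in> X"
  shows "\<exists>x'\<in>X. \<exists>y'\<in>X. (x' = y' \<longleftrightarrow> x = y) \<and> (adj \<sigma> x y \<longleftrightarrow> adj nosw x' y') \<and> cn \<sigma> x y = cn nosw x' y'"
proof -
  have AZ: ?thesis if t: "i \<in> I" "x \<in> A i" "y \<in> Z" for i
  proof -
    obtain x' where "x' \<in> A i" "(adj \<sigma> x y \<longleftrightarrow> adj nosw x' y) \<and> cn \<sigma> x y = cn nosw x' y"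
      using transfer_AZ[OF assms(1) t] by blast
    moreover have "x' \<in> X" "x' \<noteq> y" "x \<noteq> y" using calculation t not_A(6)[OF _ t(1)] unfolding X_def by blast+
    ultimately show ?thesis using assms by blast
  qed
  have ZA: ?thesis if t: "i \<in> I" "y \<in> A i" "x \<in> Z" for i
  proof -
    obtain y' where "y' \<in> A i" "(adj \<sigma> y x \<longleftrightarrow> adj nosw y' x) \<and> cn \<sigma> y x = cn nosw y' x"
      using transfer_AZ[OF assms(1) t] by blast
    moreover have "y' \<in> X" "y' \<noteq> x" "x \<noteq> y" using calculation t not_A(6)[OF _ t(1)] unfolding X_def by blast+
    ultimately have "(x = y') = (x = y) \<and> (adj \<sigma> x y \<longleftrightarrow> adj nosw x y') \<and> cn \<sigma> x y = cn nosw x y'"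
      using adj_sym[of \<sigma> x y] adj_sym[of nosw x y'] cn_commute[of \<sigma> x y] cn_commute[of nosw x y'] by simp
    then show ?thesis using assms \<open>y' \<in> X\<close> by blast
  qed
  show ?thesis
  proof (cases "(x \<in> (\<Union>i\<in>I. A i) \<and> y \<in> Z) \<or> (x \<in> Z \<and> y \<in> (\<Union>i\<in>I. A i))")
    case True
    then show ?thesis using AZ ZA by blast
  next
    case False
    then have "adj \<sigma> x y \<longleftrightarrow> adj nosw x y" using adj_indep[of x y \<sigma>] adj_indep[of x y nosw] by blast
    moreover have "cn \<sigma> x y = cn nosw x y"
    proof -
      consider "x \<in> L" "y \<in> L" | "x \<in> L" "y \<in> Z" | "x \<in> Z" "y \<in> L" | "x \<in> Z" "y \<in> Z"
        | i where "i \<in> I" "x \<in> L" "y \<in> A i" | i where "i \<in> I" "x \<in> A i" "y \<in> L"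
        | i j where "i \<in> I" "j \<in> I" "x \<in> A i" "y \<in> A j"
        using assms(2,3) False unfolding X_def by blast
      then show ?thesis
      proof cases
        case (7 i j)
        then show ?thesis using cn_A_A cn_A_A' assms(1) by (cases "i = j") auto
      qed (use cn_L_L cn_L_Z cn_Z_Z cn_L_A assms(1) cn_commute in metis)+
    qed
    ultimately show ?thesis using assms by blast
  qed
qed

theorem strongly_regular_switch:
  assumes v: "valid \<sigma>" and srg: "strongly_regular X (adj nosw) n k l m"
  shows "strongly_regular X (adj \<sigma>) n k l m"
proof -
  have cn: "card {z \<in> X. adj \<sigma>' x z \<and> adj \<sigma>' y z} = cn \<sigma>' x y" for \<sigma>' x y
    unfolding cn_def nb_def by (rule arg_cong[of _ _ card]) blast
  have deg: "card {z \<in> X. adj \<sigma>' x z} = cn \<sigma>' x x" for \<sigma>' x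
    unfolding cn_def nb_def by simp
  have irr: "\<not> adj \<sigma>' x x" for \<sigma>' x unfolding adj_def by simp
  have 1: "real (cn nosw x x) = k" if "x \<in> X" for x
    using srg that unfolding strongly_regular_def cn deg by blast
  have 2: "real (cn nosw x y) = l" if "x \<in> X" "y \<in> X" "x \<noteq> y" "adj nosw x y" for x y
    using srg that unfolding strongly_regular_def cn deg by blast
  have 3: "real (cn nosw x y) = m" if "x \<in> X" "y \<in> X" "x \<noteq> y" "\<not> adj nosw x y" for x y
    using srg that unfolding strongly_regular_def cn deg by blast
  have t: "\<exists>x'\<in>X. \<exists>y'\<in>X. (x' = y' \<longleftrightarrow> x = y) \<and> (adj \<sigma> x y \<longleftrightarrow> adj nosw x' y') \<and> cn \<sigma> x y = cn nosw x' y'"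
    if "x \<in> X" "y \<in> X" for x y using transfer[OF v that] .
  have "real (cn \<sigma> x x) = k" if x: "x \<in> X" for x
  proof -
    obtain x' y' where "x' \<in> X" "x' = y'" "cn \<sigma> x x = cn nosw x' y'" using t[OF x x] by blast
    then show ?thesis using 1[of x'] by simp
  qed
  moreover have "real (cn \<sigma> x y) = l" if x: "x \<in> X" "y \<in> X" "x \<noteq> y" "adj \<sigma> x y" for x y
  proof -
    obtain x' y' where "x' \<in> X" "y' \<in> X" "x' \<noteq> y'" "adj nosw x' y'" "cn \<sigma> x y = cn nosw x' y'"
      using t[OF x(1,2)] x(3,4) by blast
    then show ?thesis using 2[of x' y'] by simp
  qed
  moreover have "real (cn \<sigma> x y) = m" if x: "x \<in> X" "y \<in> X" "x \<noteq> y" "\<not> adj \<sigma> x y" for x y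
  proof -
    obtain x' y' where "x' \<in> X" "y' \<in> X" "x' \<noteq> y'" "\<not> adj nosw x' y'" "cn \<sigma> x y = cn nosw x' y'"
      using t[OF x(1,2)] x(3,4) by blast
    then show ?thesis using 3[of x' y'] by simp
  qed
  moreover have "finite X" "real (card X) = n" using srg unfolding strongly_regular_def by blast+
  moreover have "\<forall>x\<in>X. \<forall>y\<in>X. adj \<sigma> x y \<longrightarrow> adj \<sigma> y x" using adj_sym by blast
  ultimately show ?thesis
    unfolding strongly_regular_def cn deg by (simp add: irr)
qed

end

section \<open>Switching in a polar space\<close>

lemma strongly_regular_cong:
  assumes "\<And>x y. x \<in> V \<Longrightarrow> y \<in> V \<Longrightarrow> adj x y \<longleftrightarrow> adj' x y"
  shows "strongly_regular V adj n k l m \<longleftrightarrow> strongly_regular V adj' n k l m"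
proof -
  have "{z \<in> V. adj x z} = {z \<in> V. adj' x z}" if "x \<in> V" for x using assms that by blast
  moreover have "{z \<in> V. adj x z \<and> adj y z} = {z \<in> V. adj' x z \<and> adj' y z}" if "x \<in> V" "y \<in> V" for x y
    using assms that by blast
  ultimately show ?thesis unfolding strongly_regular_def using assms by simp
qed

locale polar_switching = polar_form B iso \<kappa> d q E \<P>
  for B :: "'a::{field,finite} ^ 'n::finite \<Rightarrow> 'a ^ 'n \<Rightarrow> 'a" and iso \<kappa> d q E \<P> +
  fixes L :: "('a ^ 'n) set" and I :: "'i set" and P :: "'i \<Rightarrow> ('a ^ 'n) set"
  assumes L: "L \<in> \<P>" "vec.dim L = d - 1"
    and P: "bij_betw P I {G \<in> generators \<P>. L \<subseteq> G}" and finI: "finite I"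
begin

definition A :: "'i \<Rightarrow> ('a ^ 'n) set set" where "A i = affine_part \<P> L (P i)"

definition Z :: "('a ^ 'n) set set" where "Z = points \<P> - perp \<P> L"

definition Hs :: "'i \<Rightarrow> ('a ^ 'n) set set set" where "Hs i = affine_hyperplanes \<P> d L (P i)"

text \<open>An affine hyperplane is a set of points, so the subspace behind it is recovered as a
  span before it is cut with L.\<close>

definition tr :: "('a ^ 'n) set set \<Rightarrow> ('a ^ 'n) set set" where
  "tr K = points_of \<P> (vec.span (\<Union>K) \<inter> L)"

text \<open>Writes lower powers as quotients of q ^ d, without truncated subtraction in the
  exponent.\<close>

lemma power_eq_divide: "m + k = n \<Longrightarrow> q ^ m = q ^ n / q ^ k"
  using q_gt1 by (auto simp: power_add)

lemma sub_L: "vec.subspace L" and dim_L: "vec.dim L + 1 = d"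
  using mem_PD(1)[OF L(1)] L(2) d_pos by auto

lemma mem_Z_iff: "z \<in> Z \<longleftrightarrow> z \<in> points \<P> \<and> \<not> z \<subseteq> orth L"
  unfolding Z_def perp_eq[OF L(1)] points_of_def by blast

section \<open>One generator through \<open>L\<close> and its affine hyperplanes\<close>

context
  fixes G assumes G: "G \<in> generators \<P>" "L \<subseteq> G"
begin

lemma GP: "G \<in> \<P>" and sub_G: "vec.subspace G" and dim_G: "vec.dim G = d"
  using generatorD[OF G(1)] mem_PD(1) dim_generator[OF G(1)] by auto

lemma G_subset_orth: "S \<subseteq> G \<Longrightarrow> G \<subseteq> orth S"
  using mem_P_subset_orth[OF GP] orth_antimono[of S G] by blast

lemma point_orth_G:
  assumes "z \<in> points \<P>" "z \<subseteq> orth G"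
  shows "z \<subseteq> G"
  using iso_orth_generator[OF G(1)] assms mem_PD(2)[OF pointD(1)] by blast

context
  fixes H assumes H: "H \<in> proper_hyperplanes d L G"
begin

lemma HP: "H \<in> \<P>" and sub_H: "vec.subspace H" and H_G: "H \<subseteq> G" and dim_H: "vec.dim H + 1 = d"
  and H_L: "H \<noteq> L"
  using H subspace_mem_P[OF GP] d_pos unfolding proper_hyperplanes_def by auto

text \<open>L and H are distinct hyperplanes of G. The second equation shows that a proper
  hyperplane exists only for d \<ge> 2.\<close>

lemma span_H_L: "vec.span (H \<union> L) = G" and dim_H_L: "vec.dim (H \<inter> L) + 2 = d"
  using dim_Int_hyperplanes[OF sub_H sub_L sub_G H_G G(2) H_L] dim_H dim_L dim_G by auto

lemma H_L_P: "H \<inter> L \<in> \<P>"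
  using subspace_mem_P[OF L(1) vec.subspace_inter[OF sub_H sub_L]] by simp

lemma H_not_L: "\<exists>h\<in>H. h \<notin> L"
proof (rule ccontr)
  assume "\<not> ?thesis"
  then have "H \<inter> L = H" by blast
  then show False using dim_H_L dim_H by simp
qed

text \<open>The points of H off L still span H: a vector x of H \<inter> L is (x + h) - h for any h
  in H off L.\<close>

lemma span_affine_part: "vec.span (\<Union>(affine_part \<P> L H)) = H"
proof
  show "vec.span (\<Union>(affine_part \<P> L H)) \<subseteq> H"
    using sub_H unfolding affine_part_def points_of_def by (intro vec.span_minimal) auto
  have *: "h \<in> \<Union>(affine_part \<P> L H)" if h: "h \<in> H" "h \<notin> L" for h
  proof -
    have "h \<noteq> 0" using h vec.subspace_0[OF sub_L] by blast
    then have "vec.span {h} \<in> points_of \<P> H" using point_in_points_of mem_PD(2)[OF HP] sub_H h by blast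
    moreover have "h \<in> vec.span {h}" using vec.span_base by blast
    ultimately show ?thesis using h(2) unfolding affine_part_def points_of_def by blast
  qed
  obtain h where h: "h \<in> H" "h \<notin> L" using H_not_L by blast
  show "H \<subseteq> vec.span (\<Union>(affine_part \<P> L H))"
  proof
    fix x assume x: "x \<in> H"
    show "x \<in> vec.span (\<Union>(affine_part \<P> L H))"
    proof (cases "x \<in> L")
      case False
      then show ?thesis using *[OF x] vec.span_base by blast
    next
      case True
      have "x + h \<in> H" using vec.subspace_add[OF sub_H x h(1)] .
      moreover have "x + h \<notin> L" using vec.subspace_diff[OF sub_L _ True, of "x + h"] h(2) by auto
      ultimately have "x + h \<in> vec.span (\<Union>(affine_part \<P> L H))" using * vec.span_base by blast
      moreover have "h \<in> vec.span (\<Union>(affine_part \<P> L H))" using *[OF h] vec.span_base by blast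
      ultimately have "(x + h) - h \<in> vec.span (\<Union>(affine_part \<P> L H))" by (rule vec.span_diff)
      then show ?thesis by simp
    qed
  qed
qed

lemma tr_affine_part: "tr (affine_part \<P> L H) = points_of \<P> (H \<inter> L)"
  unfolding tr_def span_affine_part ..

lemma affine_part_alt: "affine_part \<P> L H = points_of \<P> H - points_of \<P> (H \<inter> L)"
  unfolding affine_part_def points_of_Int by blast

lemma card_affine_part:
  "real (card (affine_part \<P> L H)) = ((q ^ d / q - 1) - (q ^ d / q\<^sup>2 - 1)) / (q - 1)"
proof -
  have "real (card (affine_part \<P> L H)) = npt H - npt (H \<inter> L)"
    unfolding affine_part_alt
    by (rule card_points_diff[OF sub_H vec.subspace_inter[OF sub_H sub_L]]) blast
  also have "\<dots> = ((q ^ vec.dim H - 1) - (q ^ vec.dim (H \<inter> L) - 1)) / (q - 1)"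
    unfolding npt_P[OF HP] npt_P[OF H_L_P] by (simp add: diff_divide_distrib)
  also have "q ^ vec.dim H = q ^ d / q"
    using power_eq_divide[OF dim_H] by simp
  also have "q ^ vec.dim (H \<inter> L) = q ^ d / q\<^sup>2"
    using power_eq_divide[OF dim_H_L] .
  finally show ?thesis .
qed

lemma orth_H_point_subset:
  assumes "z \<in> points \<P>" "z \<subseteq> orth H" "z \<subseteq> orth L"
  shows "z \<subseteq> G"
proof -
  have "z \<subseteq> orth G" unfolding span_H_L[symmetric] orth_span orth_Un using assms by blast
  then show ?thesis by (rule point_orth_G[OF assms(1)])
qed

end

lemma affine_part_inj:
  assumes "H \<in> proper_hyperplanes d L G" "H' \<in> proper_hyperplanes d L G"
  shows "affine_part \<P> L H = affine_part \<P> L H' \<longleftrightarrow> H = H'"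
  using span_affine_part[OF assms(1)] span_affine_part[OF assms(2)] by metis

text \<open>Orthogonality to z is one linear condition on G, and it fails somewhere on L because z
  is in \<open>Z\<close>. So it cuts out a hyperplane of G different from L.\<close>

lemma trace_hyperplane:
  assumes "z \<in> Z"
  shows "G \<inter> orth z \<in> proper_hyperplanes d L G"
    "{x \<in> affine_part \<P> L G. col x z} = affine_part \<P> L (G \<inter> orth z)"
    "points_of \<P> (G \<inter> orth z \<inter> L) = {x \<in> points_of \<P> L. col x z}"
proof -
  have z: "z \<in> points \<P>" "\<not> z \<subseteq> orth L" using assms perp_eq[OF L(1)] unfolding Z_def points_of_def by auto
  obtain w where w: "w \<in> z" "w \<noteq> 0" using point_nonzero[OF z(1)] by blast
  have o: "orth z = {v. B v w = 0}"
    using orth_span[of "{w}"] point_eq_span[OF z(1) w] unfolding orth_def by simp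
  have "\<not> L \<subseteq> orth z" using z(2) orth_sym by blast
  then obtain l where l: "l \<in> L" "B l w \<noteq> 0" unfolding o by blast
  have sub: "vec.subspace (G \<inter> orth z)" using sub_G subspace_orth by (rule vec.subspace_inter)
  have "G \<inter> orth z = {v \<in> G. B v w = 0}" unfolding o by blast
  then have "q * real (card (G \<inter> orth z)) = real (card G)" using card_hyperplane[OF sub_G _ l(2)] l(1) G(2) by auto
  then have "q ^ (vec.dim (G \<inter> orth z) + 1) = q ^ d"
    unfolding q card_subspace[OF sub] card_subspace[OF sub_G] dim_G by simp
  then have "vec.dim (G \<inter> orth z) + 1 = d" using q_gt1 by (rule power_inject_exp[THEN iffD1, rotated])
  moreover have "l \<notin> orth z" using l unfolding o by simp
  ultimately show "G \<inter> orth z \<in> proper_hyperplanes d L G"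
    using sub l unfolding proper_hyperplanes_def by auto
  show "{x \<in> affine_part \<P> L G. col x z} = affine_part \<P> L (G \<inter> orth z)"
    using z(1) unfolding affine_part_def points_of_def col_def by blast
  show "points_of \<P> (G \<inter> orth z \<inter> L) = {x \<in> points_of \<P> L. col x z}"
    using z(1) G(2) unfolding points_of_def col_def by blast
qed

text \<open>A point z perpendicular to H and not inside G cannot be perpendicular to L, since H and
  L span the maximal subspace G. So z is in \<open>Z\<close>, and its trace, which contains that of
  H, equals it by dimension.\<close>

lemma trace_eq_iff:
  assumes H: "H \<in> proper_hyperplanes d L G"
  shows "z \<in> Z \<and> {x \<in> affine_part \<P> L G. col x z} = affine_part \<P> L H
    \<longleftrightarrow> z \<in> points \<P> \<and> z \<subseteq> orth H \<and> \<not> z \<subseteq> G"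
proof
  assume z: "z \<in> Z \<and> {x \<in> affine_part \<P> L G. col x z} = affine_part \<P> L H"
  then have zZ: "z \<in> Z" by blast
  have "G \<inter> orth z = H"
    using z affine_part_inj[OF trace_hyperplane(1)[OF zZ] H] unfolding trace_hyperplane(2)[OF zZ] by blast
  then have "z \<subseteq> orth H" using orth_sym by blast
  moreover have "\<not> z \<subseteq> G" using zZ G_subset_orth[OF G(2)] unfolding mem_Z_iff by blast
  ultimately show "z \<in> points \<P> \<and> z \<subseteq> orth H \<and> \<not> z \<subseteq> G" using zZ unfolding mem_Z_iff by blast
next
  assume z: "z \<in> points \<P> \<and> z \<subseteq> orth H \<and> \<not> z \<subseteq> G"
  then have zZ: "z \<in> Z" using orth_H_point_subset[OF H] unfolding mem_Z_iff by blast
  note h = trace_hyperplane(1)[OF zZ]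
  have "H \<subseteq> G \<inter> orth z" using H_G[OF H] z orth_sym by blast
  then have "H = G \<inter> orth z"
    using dim_H[OF h] dim_H[OF H] by (intro vec.subspace_dim_equal[OF sub_H[OF H] sub_H[OF h]]) auto
  then show "z \<in> Z \<and> {x \<in> affine_part \<P> L G. col x z} = affine_part \<P> L H"
    using zZ trace_hyperplane(2)[OF zZ] by simp
qed

lemma card_fibre:
  assumes H: "H \<in> proper_hyperplanes d L G"
  shows "real (card {z \<in> Z. {x \<in> affine_part \<P> L G. col x z} = affine_part \<P> L H})
    = orth_npt (d - 1) - (q ^ d - 1) / (q - 1)"
proof -
  have "{z \<in> Z. {x \<in> affine_part \<P> L G. col x z} = affine_part \<P> L H} = points_of \<P> (orth H) - points_of \<P> G"
    unfolding trace_eq_iff[OF H] points_of_def by blast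
  then have "real (card {z \<in> Z. {x \<in> affine_part \<P> L G. col x z} = affine_part \<P> L H}) = npt (orth H) - npt G"
    using card_points_diff[OF subspace_orth sub_G G_subset_orth[OF H_G[OF H]]] by simp
  moreover have "vec.dim H = d - 1" using dim_H[OF H] by simp
  ultimately show ?thesis using npt_orth[OF HP[OF H]] npt_P[OF GP] dim_G by simp
qed

text \<open>If H is the trace of y, then H and y span a generator, whose perp is counted by
  \<open>orth_npt d\<close>. Otherwise H is not perpendicular to y, whether parallel to the trace of
  y or not, and \<open>npt_orth_Int\<close> applies. By \<open>trace_eq_iff\<close> the points of G
  \<inter> orth y are taken away in both cases.\<close>

lemma card_fibre_perp:
  assumes H: "H \<in> proper_hyperplanes d L G" and y: "y \<in> Z"
  shows "real (card {z \<in> Z. col z y \<and> {x \<in> affine_part \<P> L G. col x z} = affine_part \<P> L H})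
    = (if H = G \<inter> orth y then orth_npt d else orth_npt' (d - 1)) - (q ^ (d - 1) - 1) / (q - 1)"
proof -
  have yp: "y \<in> points \<P>" "\<not> y \<subseteq> orth L" using y unfolding mem_Z_iff by auto
  note h = trace_hyperplane(1)[OF y]
  have d1: "vec.dim H = d - 1" "vec.dim (G \<inter> orth y) = d - 1" using dim_H[OF H] dim_H[OF h] by auto
  have "{z \<in> Z. col z y \<and> {x \<in> affine_part \<P> L G. col x z} = affine_part \<P> L H}
      = {z. (z \<in> Z \<and> {x \<in> affine_part \<P> L G. col x z} = affine_part \<P> L H) \<and> col z y}" by blast
  also have "\<dots> = points_of \<P> (orth H \<inter> orth y) - points_of \<P> (G \<inter> orth y)"
    unfolding trace_eq_iff[OF H] using yp(1) unfolding points_of_def col_def by blast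
  also have "real (card \<dots>) = npt (orth H \<inter> orth y) - npt (G \<inter> orth y)"
  proof (rule card_points_diff)
    show "vec.subspace (orth H \<inter> orth y)" using subspace_orth by (intro vec.subspace_inter)
    show "vec.subspace (G \<inter> orth y)" using sub_H[OF h] .
    show "G \<inter> orth y \<subseteq> orth H \<inter> orth y" using G_subset_orth[OF H_G[OF H]] by blast
  qed
  also have "npt (G \<inter> orth y) = (q ^ (d - 1) - 1) / (q - 1)" unfolding npt_P[OF HP[OF h]] d1 ..
  also have "npt (orth H \<inter> orth y) = (if H = G \<inter> orth y then orth_npt d else orth_npt' (d - 1))"
  proof (cases "H = G \<inter> orth y")
    case True
    then have yH: "y \<subseteq> orth H" using orth_sym[of H y] by blast
    have "\<not> y \<subseteq> H" using yp(2) H_G[OF H] G_subset_orth[OF G(2)] by blast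
    then have "vec.dim (vec.span (H \<union> y)) = d"
      using dim_span_Un_point[OF HP[OF H] yp(1)] dim_H[OF H] by simp
    moreover have "npt (orth H \<inter> orth y) = npt (orth (vec.span (H \<union> y)))" unfolding orth_span orth_Un ..
    ultimately show ?thesis using True npt_orth[OF span_Un_point_mem_P[OF HP[OF H] yp(1) yH]] by simp
  next
    case False
    have "\<not> H \<subseteq> orth y"
    proof
      assume "H \<subseteq> orth y"
      then have "H \<subseteq> G \<inter> orth y" using H_G[OF H] by blast
      then have "H = G \<inter> orth y"
        using d1 by (intro vec.subspace_dim_equal[OF sub_H[OF H] sub_H[OF h]]) auto
      then show False using False by blast
    qed
    then show ?thesis using npt_orth_Int[OF HP[OF H] yp(1)] False d1 by simp
  qed
  finally show ?thesis .
qed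

text \<open>A common point p off L would determine both: each is spanned by p and its intersection
  with L.\<close>

lemma parallel_affine_disjoint:
  assumes H: "H \<in> proper_hyperplanes d L G" and H': "H' \<in> proper_hyperplanes d L G"
    and eq: "H \<inter> L = H' \<inter> L" and "H \<noteq> H'"
  shows "affine_part \<P> L H \<inter> affine_part \<P> L H' = {}"
proof (rule ccontr)
  assume "affine_part \<P> L H \<inter> affine_part \<P> L H' \<noteq> {}"
  then obtain p where p: "p \<in> points \<P>" "p \<subseteq> H" "p \<subseteq> H'" "\<not> p \<subseteq> L"
    unfolding affine_part_def points_of_def by blast
  have d1: "vec.dim (vec.span ((H \<inter> L) \<union> p)) + 1 = d"
    using dim_span_Un_point[OF H_L_P[OF H] p(1)] p(4) dim_H_L[OF H] by auto
  have "vec.span ((H \<inter> L) \<union> p) = K" if K: "K \<in> proper_hyperplanes d L G" "p \<subseteq> K" "H \<inter> L = K \<inter> L" for K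
  proof (rule vec.subspace_dim_equal[OF vec.subspace_span sub_H[OF K(1)]])
    show "vec.span ((H \<inter> L) \<union> p) \<subseteq> K" using K sub_H[OF K(1)] by (intro vec.span_minimal) auto
    show "vec.dim K \<le> vec.dim (vec.span ((H \<inter> L) \<union> p))" using d1 dim_H[OF K(1)] by simp
  qed
  from this[OF H p(2)] this[OF H' p(3) eq] show False using \<open>H \<noteq> H'\<close> by simp
qed

text \<open>H and H' meet in codimension 2 of G. Their intersections with L are distinct hyperplanes
  of L, so the part at infinity of H \<inter> H' has codimension 2 in L, that is 3 in G.\<close>

lemma card_nonparallel_affine:
  assumes H: "H \<in> proper_hyperplanes d L G" and H': "H' \<in> proper_hyperplanes d L G"
    and ne: "H \<inter> L \<noteq> H' \<inter> L"
  shows "real (card (affine_part \<P> L H \<inter> affine_part \<P> L H'))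
    = (q ^ d / q ^ 2 - 1) / (q - 1) - (q ^ d / q ^ 3 - 1) / (q - 1)"
proof -
  have HH: "H \<noteq> H'" using ne by blast
  have sub: "vec.subspace (H \<inter> H')" "vec.subspace (H \<inter> H' \<inter> L)"
    using sub_H[OF H] sub_H[OF H'] sub_L by (auto intro: vec.subspace_inter)
  have P: "H \<inter> H' \<in> \<P>" "H \<inter> H' \<inter> L \<in> \<P>"
    using subspace_mem_P[OF HP[OF H]] sub by auto
  have "vec.dim (H \<inter> H') + 2 = d"
    using dim_Int_hyperplanes(1)[OF sub_H[OF H] sub_H[OF H'] sub_G H_G[OF H] H_G[OF H'] HH]
      dim_H[OF H] dim_H[OF H'] dim_G by simp
  then have 1: "q ^ vec.dim (H \<inter> H') = q ^ d / q ^ 2"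
    by (rule power_eq_divide)
  have i: "H \<inter> L \<inter> (H' \<inter> L) = H \<inter> H' \<inter> L" by blast
  have "vec.dim (H \<inter> L \<inter> (H' \<inter> L)) + 2 = vec.dim L"
  proof (rule dim_Int_hyperplanes(1)[OF mem_PD(1)[OF H_L_P[OF H]] mem_PD(1)[OF H_L_P[OF H']] sub_L _ _ ne])
    show "vec.dim (H \<inter> L) + 1 = vec.dim L" "vec.dim (H' \<inter> L) + 1 = vec.dim L"
      using dim_H_L[OF H] dim_H_L[OF H'] dim_L by simp_all
  qed auto
  then have "vec.dim (H \<inter> H' \<inter> L) + 3 = d" using dim_L unfolding i by simp
  then have 2: "q ^ vec.dim (H \<inter> H' \<inter> L) = q ^ d / q ^ 3"
    by (rule power_eq_divide)
  have "affine_part \<P> L H \<inter> affine_part \<P> L H' = points_of \<P> (H \<inter> H') - points_of \<P> (H \<inter> H' \<inter> L)"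
    unfolding affine_part_def points_of_Int by blast
  then have "real (card (affine_part \<P> L H \<inter> affine_part \<P> L H')) = npt (H \<inter> H') - npt (H \<inter> H' \<inter> L)"
    using card_points_diff[OF sub Int_lower1] by simp
  then show ?thesis unfolding npt_P[OF P(1)] npt_P[OF P(2)] 1 2 .
qed

text \<open>The witness is the span of H \<inter> L and x; by dimension it meets L in no more than H
  \<inter> L.\<close>

lemma ex_parallel_through:
  assumes H: "H \<in> proper_hyperplanes d L G" and x: "x \<in> affine_part \<P> L G"
  shows "\<exists>H'\<in>proper_hyperplanes d L G. H' \<inter> L = H \<inter> L \<and> x \<in> affine_part \<P> L H'"
proof -
  have xp: "x \<in> points \<P>" "x \<subseteq> G" "\<not> x \<subseteq> L" using x unfolding affine_part_def points_of_def by auto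
  let ?H = "vec.span ((H \<inter> L) \<union> x)"
  have sup: "(H \<inter> L) \<union> x \<subseteq> ?H" by (rule vec.span_superset)
  have "vec.dim ?H + 1 = d"
    using dim_span_Un_point[OF H_L_P[OF H] xp(1)] xp(3) dim_H_L[OF H] by auto
  moreover have "?H \<subseteq> G" using xp H_G[OF H] by (intro vec.span_minimal sub_G) blast
  moreover have "?H \<noteq> L" using sup xp(3) by blast
  ultimately have K: "?H \<in> proper_hyperplanes d L G" unfolding proper_hyperplanes_def by auto
  have "H \<inter> L = ?H \<inter> L"
  proof (rule vec.subspace_dim_equal[OF mem_PD(1)[OF H_L_P[OF H]] mem_PD(1)[OF H_L_P[OF K]]])
    show "H \<inter> L \<subseteq> ?H \<inter> L" using sup by blast
    show "vec.dim (?H \<inter> L) \<le> vec.dim (H \<inter> L)" using dim_H_L[OF H] dim_H_L[OF K] by simp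
  qed
  moreover have "x \<in> affine_part \<P> L ?H" using xp sup unfolding affine_part_def points_of_def by blast
  ultimately show ?thesis using K by metis
qed

end

section \<open>Several generators through \<open>L\<close>\<close>

lemma P_I:
  assumes "i \<in> I"
  shows "P i \<in> generators \<P>" "L \<subseteq> P i"
  using assms P unfolding bij_betw_def by auto

text \<open>An intersection larger than L would have dimension d and equal both generators.\<close>

lemma P_Int:
  assumes "i \<in> I" "j \<in> I" "i \<noteq> j"
  shows "P i \<inter> P j = L"
proof -
  have ne: "P i \<noteq> P j" using P assms unfolding bij_betw_def inj_on_def by blast
  have sub: "vec.subspace (P i \<inter> P j)"
    using sub_G[OF P_I[OF assms(1)]] sub_G[OF P_I[OF assms(2)]] by (rule vec.subspace_inter)
  have "vec.dim (P i \<inter> P j) \<le> vec.dim L"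
  proof (rule ccontr)
    assume "\<not> ?thesis"
    then have d: "d \<le> vec.dim (P i \<inter> P j)" using dim_L by simp
    have "P i \<inter> P j = P k" if "k = i \<or> k = j" for k
      using that assms d dim_G[OF P_I] sub_G[OF P_I] by (intro vec.subspace_dim_equal[OF sub]) auto
    then show False using ne by metis
  qed
  then show ?thesis using P_I(2)[OF assms(1)] P_I(2)[OF assms(2)]
    by (intro vec.subspace_dim_equal[OF sub_L sub, symmetric]) auto
qed

lemma mem_A_iff: "x \<in> A i \<longleftrightarrow> x \<in> points \<P> \<and> x \<subseteq> P i \<and> \<not> x \<subseteq> L"
  unfolding A_def affine_part_def points_of_def by blast

lemma Hs_alt: "Hs i = affine_part \<P> L ` proper_hyperplanes d L (P i)"
  unfolding Hs_def affine_hyperplanes_def ..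

lemma trace_A:
  assumes "i \<in> I" "z \<in> Z"
  shows "{x \<in> A i. col x z} = affine_part \<P> L (P i \<inter> orth z)"
  unfolding A_def using trace_hyperplane(2)[OF P_I[OF assms(1)] assms(2)] .

lemma affine_orth_not_P:
  assumes "i \<in> I" "H \<in> proper_hyperplanes d L (P i)" "x \<in> points \<P>" "x \<subseteq> orth H" "x \<subseteq> orth L"
    and "j \<in> I" "i \<noteq> j" "x \<subseteq> P j"
  shows "x \<subseteq> L"
  using orth_H_point_subset[OF P_I[OF assms(1)] assms(2-5)] P_Int[OF assms(1,6,7)] assms(8) by blast

text \<open>H' is spanned by H' \<inter> L and one point y off L. As H' \<inter> L = H \<inter> L
  lies in H, being perpendicular to H and H' means being perpendicular to H and y; and y is not
  perpendicular to H, since it would otherwise lie in \<open>P i\<close> as well as in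
  \<open>P j\<close>, hence in L. So \<open>npt_orth_Int\<close> applies. Only the points of L are
  taken away, because a point of \<open>P i\<close> or \<open>P j\<close> perpendicular to both
  hyperplanes lies in L.\<close>

lemma card_fibre2:
  assumes ij: "i \<in> I" "j \<in> I" "i \<noteq> j"
    and H: "H \<in> proper_hyperplanes d L (P i)" and H': "H' \<in> proper_hyperplanes d L (P j)"
    and eq: "H \<inter> L = H' \<inter> L"
  shows "real (card {z \<in> Z. {x \<in> A i. col x z} = affine_part \<P> L H \<and> {x \<in> A j. col x z} = affine_part \<P> L H'})
    = orth_npt' (d - 1) - (q ^ (d - 1) - 1) / (q - 1)"
proof -
  note Gi = P_I[OF ij(1)] and Gj = P_I[OF ij(2)]
  obtain h where h: "h \<in> H'" "h \<notin> L" using H_not_L[OF Gj H'] by blast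
  have h0: "h \<noteq> 0" using h vec.subspace_0[OF sub_L] by blast
  define y where "y = vec.span {h}"
  have y: "y \<in> points \<P>" "y \<subseteq> H'" "\<not> y \<subseteq> L"
    using point_in_points_of[OF mem_PD(2)[OF HP[OF Gj H'] h(1)] h0 h(1) sub_H[OF Gj H']] h(2) vec.span_base[of h "{h}"]
    unfolding y_def points_of_def by auto
  have H'eq: "vec.span ((H' \<inter> L) \<union> y) = H'"
  proof (rule vec.subspace_dim_equal[OF vec.subspace_span sub_H[OF Gj H']])
    show "vec.span ((H' \<inter> L) \<union> y) \<subseteq> H'" using y by (intro vec.span_minimal sub_H[OF Gj H']) blast
    show "vec.dim H' \<le> vec.dim (vec.span ((H' \<inter> L) \<union> y))"
      using dim_span_Un_point[OF H_L_P[OF Gj H'] y(1)] y(3) dim_H_L[OF Gj H'] dim_H[OF Gj H'] by auto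
  qed
  have "orth H' = orth (H' \<inter> L) \<inter> orth y" by (subst H'eq[symmetric]) (simp add: orth_span orth_Un)
  then have o: "orth H \<inter> orth H' = orth H \<inter> orth y" using eq orth_antimono[of "H' \<inter> L" H] by blast
  have "\<not> y \<subseteq> orth H"
  proof
    assume a: "y \<subseteq> orth H"
    have yP: "y \<subseteq> P j" using y(2) H_G[OF Gj H'] by blast
    then have "y \<subseteq> orth L" using G_subset_orth[OF Gj Gj(2)] by blast
    then show False using affine_orth_not_P[OF ij(1) H y(1) a _ ij(2,3) yP] y(3) by blast
  qed
  then have nsub: "\<not> H \<subseteq> orth y" using orth_sym by blast
  have dH: "vec.dim H = d - 1" using dim_H[OF Gi H] by simp
  have "{z \<in> Z. {x \<in> A i. col x z} = affine_part \<P> L H \<and> {x \<in> A j. col x z} = affine_part \<P> L H'}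
      = {z. (z \<in> Z \<and> {x \<in> A i. col x z} = affine_part \<P> L H) \<and> (z \<in> Z \<and> {x \<in> A j. col x z} = affine_part \<P> L H')}"
    by blast
  also have "\<dots> = {z \<in> points \<P>. z \<subseteq> orth H \<inter> orth H' \<and> \<not> z \<subseteq> P i \<and> \<not> z \<subseteq> P j}"
    unfolding A_def trace_eq_iff[OF Gi H] trace_eq_iff[OF Gj H'] by blast
  also have "\<dots> = points_of \<P> (orth H \<inter> orth H') - points_of \<P> L"
  proof -
    have "z \<subseteq> L" if z: "z \<in> points \<P>" "z \<subseteq> orth H" "z \<subseteq> orth H'" "z \<subseteq> P i \<or> z \<subseteq> P j" for z
    proof -
      have "z \<subseteq> orth L" using z(4) G_subset_orth[OF Gi Gi(2)] G_subset_orth[OF Gj Gj(2)] by blast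
      then show ?thesis
        using affine_orth_not_P[OF ij(1) H z(1,2) _ ij(2,3)] affine_orth_not_P[OF ij(2) H' z(1,3) _ ij(1) ij(3)[symmetric]] z(4)
        by blast
    qed
    then show ?thesis using Gi(2) Gj(2) unfolding points_of_def by blast
  qed
  also have "real (card \<dots>) = npt (orth H \<inter> orth H') - npt L"
  proof (rule card_points_diff)
    show "vec.subspace (orth H \<inter> orth H')" using subspace_orth by (intro vec.subspace_inter)
    show "L \<subseteq> orth H \<inter> orth H'"
      using G_subset_orth[OF Gi H_G[OF Gi H]] G_subset_orth[OF Gj H_G[OF Gj H']] Gi(2) Gj(2) by blast
  qed (rule sub_L)
  also have "npt (orth H \<inter> orth H') = orth_npt' (d - 1)"
    unfolding o using npt_orth_Int[OF HP[OF Gi H] y(1) nsub] dH by simp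
  also have "npt L = (q ^ (d - 1) - 1) / (q - 1)" unfolding npt_P[OF L(1)] L(2) ..
  finally show ?thesis .
qed

text \<open>The parameters are cardinalities known through real formulas, hence the floor and
  \<open>nat\<close>. For d too small for the configuration counted, the axiom has no instance and
  the number is a default.\<close>

sublocale sw: hyperplane_switching "points_of \<P> L" Z I A col Hs tr
  "nat \<lfloor>((q ^ d / q - 1) - (q ^ d / q\<^sup>2 - 1)) / (q - 1)\<rfloor>"
  "nat \<lfloor>(q ^ d / q ^ 2 - 1) / (q - 1) - (q ^ d / q ^ 3 - 1) / (q - 1)\<rfloor>"
  "nat \<lfloor>orth_npt (d - 1) - (q ^ d - 1) / (q - 1)\<rfloor>"
  "nat \<lfloor>orth_npt' (d - 1) - (q ^ (d - 1) - 1) / (q - 1)\<rfloor>"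
  "nat \<lfloor>orth_npt' (d - 1) - (q ^ (d - 1) - 1) / (q - 1)\<rfloor>"
  "nat \<lfloor>orth_npt d - (q ^ (d - 1) - 1) / (q - 1)\<rfloor>"
proof
  have nat: "n = nat \<lfloor>r\<rfloor>" if "real n = r" for n r using that by auto
  show "finite (points_of \<P> L)" "finite Z" "finite I" "\<And>i. finite (A i)" using finI by simp_all
  show "points_of \<P> L \<inter> Z = {}"
  proof (rule equals0I)
    fix x assume "x \<in> points_of \<P> L \<inter> Z"
    then have "x \<subseteq> L" "\<not> x \<subseteq> orth L" using points_ofD(2)[of x L] mem_Z_iff[of x] by simp_all
    then show False using mem_P_subset_orth[OF L(1)] by blast
  qed
  show "points_of \<P> L \<inter> A i = {}" for i unfolding A_def affine_part_def by blast
  show "A i \<inter> Z = {}" if "i \<in> I" for i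
  proof (rule equals0I)
    fix x assume "x \<in> A i \<inter> Z"
    then have "x \<subseteq> P i" "\<not> x \<subseteq> orth L" using mem_A_iff[of x i] mem_Z_iff[of x] by simp_all
    then show False using G_subset_orth[OF P_I[OF that] P_I(2)[OF that]] by blast
  qed
  show "A i \<inter> A j = {}" if "i \<in> I" "j \<in> I" "i \<noteq> j" for i j
  proof (rule equals0I)
    fix x assume "x \<in> A i \<inter> A j"
    then have "x \<subseteq> P i \<inter> P j" "\<not> x \<subseteq> L" using mem_A_iff[of x i] mem_A_iff[of x j] by simp_all
    then show False using P_Int[OF that] by blast
  qed
  show "col x y \<longleftrightarrow> col y x" for x y by (rule col_sym)
  show "col z z" if "z \<in> Z" for z using col_refl that by (simp add: mem_Z_iff)
  show "col x y" if "i \<in> I" "x \<in> points_of \<P> L" "y \<in> A i" for i x y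
  proof -
    have "x \<subseteq> P i" "y \<subseteq> P i" "x \<in> points \<P>" "y \<in> points \<P>"
      using that P_I(2)[OF that(1)] unfolding mem_A_iff points_of_def by auto
    then show ?thesis using G_subset_orth[OF P_I[OF that(1)], of y] unfolding col_def by blast
  qed
  show "col x y" if "i \<in> I" "x \<in> A i" "y \<in> A i" for i x y
    using that G_subset_orth[OF P_I[OF that(1)], of y] unfolding mem_A_iff col_def by blast
  show "\<not> col x y" if ij: "i \<in> I" "j \<in> I" "i \<noteq> j" and x: "x \<in> A i" and y: "y \<in> A j" for i j x y
  proof
    \<comment> \<open>x and L span \<open>P i\<close>; perpendicular to both, y would lie in
      \<open>P i\<close> and hence in L.\<close>
    assume c: "col x y"
    have x': "x \<in> points \<P>" "x \<subseteq> P i" "\<not> x \<subseteq> L" and y': "y \<in> points \<P>" "y \<subseteq> P j" "\<not> y \<subseteq> L"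
      using x y unfolding mem_A_iff by blast+
    have xL: "x \<subseteq> orth L" using x'(2) G_subset_orth[OF P_I[OF ij(1)] P_I(2)[OF ij(1)]] by blast
    have yL: "y \<subseteq> orth L" using y'(2) G_subset_orth[OF P_I[OF ij(2)] P_I(2)[OF ij(2)]] by blast
    have "vec.dim (P i) \<le> vec.dim (vec.span (L \<union> x))"
      using dim_span_Un_point[OF L(1) x'(1,3)] dim_L dim_G[OF P_I[OF ij(1)]] by simp
    then have "vec.span (L \<union> x) = P i"
      using x'(2) P_I(2)[OF ij(1)]
      by (intro vec.subspace_dim_equal[OF vec.subspace_span sub_G[OF P_I[OF ij(1)]]]
          vec.span_minimal[OF _ sub_G[OF P_I[OF ij(1)]]]) auto
    then have "orth (P i) = orth L \<inter> orth x" using orth_span[of "L \<union> x"] orth_Un by simp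
    then have "y \<subseteq> orth (P i)" using c yL col_sym[of x y] unfolding col_def by blast
    then have "y \<subseteq> P i" by (rule point_orth_G[OF P_I[OF ij(1)] y'(1)])
    then show False using y' P_Int[OF ij] by blast
  qed
  show "H \<subseteq> A i" if "i \<in> I" "H \<in> Hs i" for i H
    using that(2) unfolding Hs_alt A_def affine_part_def points_of_def proper_hyperplanes_def by auto
  show "{x \<in> A i. col x z} \<in> Hs i" if "i \<in> I" "z \<in> Z" for i z
    unfolding trace_A[OF that] Hs_alt using trace_hyperplane(1)[OF P_I[OF that(1)] that(2)] by blast
  show "tr {x \<in> A i. col x z} = {x \<in> points_of \<P> L. col x z}" if "i \<in> I" "z \<in> Z" for i z
    unfolding trace_A[OF that]
    using tr_affine_part[OF P_I[OF that(1)] trace_hyperplane(1)[OF P_I[OF that(1)] that(2)]]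
      trace_hyperplane(3)[OF P_I[OF that(1)] that(2)] by simp
  show "card H = nat \<lfloor>((q ^ d / q - 1) - (q ^ d / q\<^sup>2 - 1)) / (q - 1)\<rfloor>" if "i \<in> I" "H \<in> Hs i" for i H
    using that(2) card_affine_part[OF P_I[OF that(1)]] unfolding Hs_alt by (intro nat) blast
  \<comment> \<open>An isotropic subspace is determined by its points, so \<open>tr\<close> compares
    the subspaces at infinity, even for hyperplanes of different generators.\<close>
  have tr_eq: "tr (affine_part \<P> L H) = tr (affine_part \<P> L H') \<longleftrightarrow> H \<inter> L = H' \<inter> L"
    if "i \<in> I" "j \<in> I" "H \<in> proper_hyperplanes d L (P i)" "H' \<in> proper_hyperplanes d L (P j)" for i j H H'
  proof -
    have det: "S \<subseteq> T" if "S \<in> \<P>" "T \<in> \<P>" "points_of \<P> S = points_of \<P> T" for S T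
    proof
      fix v assume v: "v \<in> S"
      show "v \<in> T"
      proof (cases "v = 0")
        case True
        then show ?thesis using vec.subspace_0[OF mem_PD(1)[OF that(2)]] by simp
      next
        case False
        then have "vec.span {v} \<in> points_of \<P> T"
          using point_in_points_of[OF mem_PD(2)[OF that(1) v] False v mem_PD(1)[OF that(1)]] that(3) by simp
        then show ?thesis using vec.span_base[of v "{v}"] unfolding points_of_def by blast
      qed
    qed
    note PH = H_L_P[OF P_I[OF that(1)] that(3)] H_L_P[OF P_I[OF that(2)] that(4)]
    show ?thesis
      unfolding tr_affine_part[OF P_I[OF that(1)] that(3)] tr_affine_part[OF P_I[OF that(2)] that(4)]
      using det[OF PH] det[OF PH(2,1)] by auto
  qed
  show "H \<inter> H' = {}" if i: "i \<in> I" and H: "H \<in> Hs i" "H' \<in> Hs i" and e: "tr H = tr H'" and ne: "H \<noteq> H'" for i H H'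
  proof -
    obtain K K' where K: "K \<in> proper_hyperplanes d L (P i)" "K' \<in> proper_hyperplanes d L (P i)"
      "H = affine_part \<P> L K" "H' = affine_part \<P> L K'"
      using H unfolding Hs_alt by blast
    then have "K \<noteq> K'" "K \<inter> L = K' \<inter> L" using tr_eq[OF i i K(1,2)] e ne by auto
    then show ?thesis using parallel_affine_disjoint[OF P_I[OF i] K(1,2)] K(3,4) by simp
  qed
  show "card (H \<inter> H') = nat \<lfloor>(q ^ d / q ^ 2 - 1) / (q - 1) - (q ^ d / q ^ 3 - 1) / (q - 1)\<rfloor>"
    if i: "i \<in> I" and H: "H \<in> Hs i" "H' \<in> Hs i" and ne: "tr H \<noteq> tr H'" for i H H'
  proof -
    obtain K K' where K: "K \<in> proper_hyperplanes d L (P i)" "K' \<in> proper_hyperplanes d L (P i)"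
      "H = affine_part \<P> L K" "H' = affine_part \<P> L K'"
      using H unfolding Hs_alt by blast
    then have "K \<inter> L \<noteq> K' \<inter> L" using tr_eq[OF i i K(1,2)] ne by auto
    then show ?thesis using card_nonparallel_affine[OF P_I[OF i] K(1,2)] K(3,4) by (intro nat) simp
  qed
  show "\<exists>H'\<in>Hs i. tr H' = tr H \<and> x \<in> H'" if i: "i \<in> I" and H: "H \<in> Hs i" and x: "x \<in> A i" for i H x
  proof -
    obtain K where K: "K \<in> proper_hyperplanes d L (P i)" "H = affine_part \<P> L K" using H unfolding Hs_alt by blast
    obtain K' where K': "K' \<in> proper_hyperplanes d L (P i)" "K' \<inter> L = K \<inter> L" "x \<in> affine_part \<P> L K'"
      using ex_parallel_through[OF P_I[OF i] K(1)] x unfolding A_def by blast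
    then have "tr (affine_part \<P> L K') = tr H" using tr_eq[OF i i K'(1) K(1)] K(2) by simp
    then show ?thesis using K'(1,3) unfolding Hs_alt by blast
  qed
  show "card {z \<in> Z. {x \<in> A i. col x z} = H} = nat \<lfloor>orth_npt (d - 1) - (q ^ d - 1) / (q - 1)\<rfloor>"
    if i: "i \<in> I" and H: "H \<in> Hs i" for i H
  proof -
    obtain K where K: "K \<in> proper_hyperplanes d L (P i)" "H = affine_part \<P> L K" using H unfolding Hs_alt by blast
    then show ?thesis using card_fibre[OF P_I[OF i] K(1)] unfolding A_def by (intro nat) simp
  qed
  show "card {z \<in> Z. {x \<in> A i. col x z} = H \<and> {x \<in> A j. col x z} = H'}
      = nat \<lfloor>orth_npt' (d - 1) - (q ^ (d - 1) - 1) / (q - 1)\<rfloor>"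
    if ij: "i \<in> I" "j \<in> I" "i \<noteq> j" and H: "H \<in> Hs i" "H' \<in> Hs j" and e: "tr H = tr H'" for i j H H'
  proof -
    obtain K K' where K: "K \<in> proper_hyperplanes d L (P i)" "K' \<in> proper_hyperplanes d L (P j)"
      "H = affine_part \<P> L K" "H' = affine_part \<P> L K'"
      using H unfolding Hs_alt by blast
    then have "K \<inter> L = K' \<inter> L" using tr_eq[OF ij(1,2) K(1,2)] e by auto
    then show ?thesis using card_fibre2[OF ij K(1,2)] unfolding K(3,4) by (intro nat)
  qed
  show "card {z \<in> Z. col z y \<and> {x \<in> A i. col x z} = H} = nat \<lfloor>orth_npt' (d - 1) - (q ^ (d - 1) - 1) / (q - 1)\<rfloor>"
    if i: "i \<in> I" and y: "y \<in> Z" and H: "H \<in> Hs i" "H \<noteq> {x \<in> A i. col x y}" for i y H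
  proof -
    obtain K where K: "K \<in> proper_hyperplanes d L (P i)" "H = affine_part \<P> L K" using H unfolding Hs_alt by blast
    then have "K \<noteq> P i \<inter> orth y" using H(2) unfolding trace_A[OF i y] by blast
    then show ?thesis using card_fibre_perp[OF P_I[OF i] K(1) y] K(2) unfolding A_def by (intro nat) simp
  qed
  show "card {z \<in> Z. col z y \<and> {x \<in> A i. col x z} = {x \<in> A i. col x y}}
      = nat \<lfloor>orth_npt d - (q ^ (d - 1) - 1) / (q - 1)\<rfloor>"
    if i: "i \<in> I" and y: "y \<in> Z" for i y
    using card_fibre_perp[OF P_I[OF i] trace_hyperplane(1)[OF P_I[OF i] y] y]
    unfolding trace_A[OF i y] unfolding A_def by (intro nat) simp
qed

text \<open>A point perpendicular to L but outside it spans with L an isotropic subspace of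
  dimension d, that is, one of the generators \<open>P i\<close>.\<close>

lemma points_eq_X: "points \<P> = sw.X"
proof
  show "sw.X \<subseteq> points \<P>" unfolding sw.X_def by (auto simp: mem_A_iff mem_Z_iff points_of_def)
  show "points \<P> \<subseteq> sw.X"
  proof
    fix x assume x: "x \<in> points \<P>"
    show "x \<in> sw.X"
    proof (cases "x \<subseteq> L \<or> \<not> x \<subseteq> orth L")
      case True
      then have "x \<in> points_of \<P> L \<or> x \<in> Z" using x mem_Z_iff[of x] unfolding points_of_def by blast
      then show ?thesis unfolding sw.X_def by blast
    next
      case False
      let ?G = "vec.span (L \<union> x)"
      have "?G \<in> generators \<P>"
        unfolding generator_iff using span_Un_point_mem_P[OF L(1) x] dim_span_Un_point[OF L(1) x] dim_L False by simp
      moreover have sup: "L \<union> x \<subseteq> ?G" by (rule vec.span_superset)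
      ultimately have "?G \<in> {G \<in> generators \<P>. L \<subseteq> G}" by simp
      then have "?G \<in> P ` I" using P unfolding bij_betw_def by simp
      then obtain i where "i \<in> I" "P i = ?G" by (metis imageE)
      then have "x \<in> A i" using x False sup unfolding mem_A_iff by blast
      then show ?thesis using \<open>i \<in> I\<close> unfolding sw.X_def by blast
    qed
  qed
qed

text \<open>K belongs to its own parallel class, which \<open>\<sigma> i\<close> maps to itself;
  hence the hyperplanes behind K and its image meet L in the same subspace.\<close>

lemma valid_switch:
  assumes "\<And>i. i \<in> I \<Longrightarrow> parallel_preserving_permutation \<P> d L (P i) (\<sigma> i)"
  shows "sw.valid \<sigma>"
  unfolding sw.valid_def
proof (intro ballI conjI)
  fix i assume i: "i \<in> I"
  note p = assms[OF i, unfolded parallel_preserving_permutation_def]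
  show "bij_betw (\<sigma> i) (Hs i) (Hs i)" using p unfolding Hs_def by blast
  fix K assume K: "K \<in> Hs i"
  then have "K \<in> parallel_class \<P> d L (P i) K" unfolding Hs_alt parallel_class_def by blast
  then have "\<sigma> i K \<in> parallel_class \<P> d L (P i) K" using p K unfolding Hs_def by blast
  then obtain H H' where H: "H \<in> proper_hyperplanes d L (P i)" "H' \<in> proper_hyperplanes d L (P i)"
    "K = affine_part \<P> L H" "\<sigma> i K = affine_part \<P> L H'" "H \<inter> L = H' \<inter> L"
    unfolding parallel_class_def by blast
  show "tr (\<sigma> i K) = tr K"
    unfolding H(4) unfolding H(3) tr_affine_part[OF P_I[OF i] H(1)] tr_affine_part[OF P_I[OF i] H(2)] H(5) ..
qed

lemma switched_graph:
  assumes "\<And>i. i \<in> I \<Longrightarrow> parallel_preserving_permutation \<P> d L (P i) (\<sigma> i)"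
  shows "strongly_regular (points \<P>) (sw.adj \<sigma>)
     (orth_npt 0) (orth_npt 1 - 1) (orth_npt 2 - 2) (orth_npt' 1)"
  unfolding points_eq_X
proof (rule sw.strongly_regular_switch[OF valid_switch[OF assms]])
  show "strongly_regular sw.X (sw.adj (\<lambda>_ H. H)) (orth_npt 0) (orth_npt 1 - 1) (orth_npt 2 - 2) (orth_npt' 1)"
    using collinearity_graph unfolding points_eq_X sw.adj_nosw .
qed simp

end

section \<open>The six types of forms\<close>

text \<open>The first \<open>s\<close> coordinates carry the anisotropic part of the form, with
  \<open>s\<close> at most 2 for the six types; they are followed by \<open>d\<close> pairs of
  coordinates \<open>a i\<close>, \<open>b i\<close>.\<close>

locale coordinates =
  fixes \<iota> :: "nat \<Rightarrow> 'n::finite" and s d :: nat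
  assumes \<iota>: "bij_betw \<iota> {1..CARD('n)} UNIV" and card_index: "CARD('n) = s + 2 * d"
begin

definition a :: "nat \<Rightarrow> 'n" where "a i = \<iota> (s + 2 * i - 1)"
definition b :: "nat \<Rightarrow> 'n" where "b i = \<iota> (s + 2 * i)"

lemma \<iota>_eq_iff: "j \<in> {1..s + 2 * d} \<Longrightarrow> k \<in> {1..s + 2 * d} \<Longrightarrow> \<iota> j = \<iota> k \<longleftrightarrow> j = k"
  using \<iota> unfolding card_index bij_betw_def inj_on_def by blast

lemma a_b_ne:
  assumes "i \<in> {1..d}" "i' \<in> {1..d}"
  shows "a i \<noteq> b i'" "b i' \<noteq> a i" "a i = a i' \<longleftrightarrow> i = i'" "b i = b i' \<longleftrightarrow> i = i'"
proof -
  have *: "s + 2 * i - 1 \<in> {1..s + 2 * d}" "s + 2 * i \<in> {1..s + 2 * d}"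
    "s + 2 * i' - 1 \<in> {1..s + 2 * d}" "s + 2 * i' \<in> {1..s + 2 * d}"
    using assms by auto
  have "s + 2 * i - 1 \<noteq> s + 2 * i'" using assms by simp presburger
  then show "a i \<noteq> b i'" "b i' \<noteq> a i"
    using \<iota>_eq_iff[OF *(1,4)] unfolding a_def b_def by auto
  show "a i = a i' \<longleftrightarrow> i = i'" "b i = b i' \<longleftrightarrow> i = i'"
    using \<iota>_eq_iff[OF *(1,3)] \<iota>_eq_iff[OF *(2,4)] assms unfolding a_def b_def by auto
qed

lemma \<iota>_ne:
  assumes "i \<in> {1..d}" "j \<in> {1..s}"
  shows "\<iota> j \<noteq> a i" "\<iota> j \<noteq> b i" "a i \<noteq> \<iota> j" "b i \<noteq> \<iota> j"
proof -
  have "s + 2 * i - 1 \<in> {1..s + 2 * d}" "s + 2 * i \<in> {1..s + 2 * d}" "j \<in> {1..s + 2 * d}"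
    "j \<noteq> s + 2 * i - 1" "j \<noteq> s + 2 * i"
    using assms by auto
  then show "\<iota> j \<noteq> a i" "\<iota> j \<noteq> b i" "a i \<noteq> \<iota> j" "b i \<noteq> \<iota> j"
    using \<iota>_eq_iff unfolding a_def b_def by metis+
qed

lemma coordinate_cases:
  obtains j where "j \<in> {1..s}" "k = \<iota> j" | i where "i \<in> {1..d}" "k = a i" | i where "i \<in> {1..d}" "k = b i"
proof -
  have "k \<in> \<iota> ` {1..s + 2 * d}" using \<iota> unfolding card_index bij_betw_def by simp
  then obtain j where j: "j \<in> {1..s + 2 * d}" "k = \<iota> j" by blast
  consider "j \<le> s" | "j > s" "even (j - s)" | "j > s" "odd (j - s)" by linarith
  then show thesis
  proof cases
    case 1
    then show ?thesis using j that(1)[of j] by simp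
  next
    case 2
    then obtain i where "j - s = 2 * i" by (elim evenE)
    then have "j = s + 2 * i" "i \<in> {1..d}" using 2(1) j by auto
    then show ?thesis using j that(3)[of i] unfolding b_def by metis
  next
    case 3
    then obtain i where "j - s = 2 * i + 1" by (elim oddE)
    then have "j = s + 2 * (i + 1) - 1" "i + 1 \<in> {1..d}" using 3(1) j by auto
    then show ?thesis using j that(2)[of "i + 1"] unfolding a_def by metis
  qed
qed

lemma vec_eqI:
  assumes "\<And>j. j \<in> {1..s} \<Longrightarrow> x $ \<iota> j = y $ \<iota> j" "\<And>i. i \<in> {1..d} \<Longrightarrow> x $ a i = y $ a i"
    "\<And>i. i \<in> {1..d} \<Longrightarrow> x $ b i = y $ b i"
  shows "x = y"
  unfolding vec_eq_iff
proof
  fix k show "x $ k = y $ k" by (cases k rule: coordinate_cases) (simp_all add: assms)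
qed

lemma sum_coordinates:
  fixes f :: "'n \<Rightarrow> 'b::comm_monoid_add"
  shows "(\<Sum>k\<in>UNIV. f k) = (\<Sum>j=1..s. f (\<iota> j)) + (\<Sum>i=1..d. f (a i) + f (b i))"
proof -
  have "(\<Sum>k\<in>UNIV. f k) = (\<Sum>j=1..s + 2 * d. f (\<iota> j))"
    using sum.reindex_bij_betw[OF \<iota>, of f] unfolding card_index by simp
  moreover have "(\<Sum>j=1..s + 2 * m. f (\<iota> j)) = (\<Sum>j=1..s. f (\<iota> j)) + (\<Sum>i=1..m. f (a i) + f (b i))" for m
    unfolding a_def b_def by (induction m) (simp_all add: add.assoc)
  ultimately show ?thesis by simp
qed

text \<open>Spanned by the axis vectors at all \<open>a i\<close>: a generator for quadratic and
  symplectic forms, and the domain parametrising one for Hermitian forms.\<close>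

definition T :: "('a::{field,finite} ^ 'n) set" where
  "T = {x. \<forall>k. k \<notin> a ` {1..d} \<longrightarrow> x $ k = 0}"

lemma dim_T: "vec.dim T = d"
proof -
  have "card (a ` {1..d}) = d" using a_b_ne(3) by (subst card_image) (auto simp: inj_on_def)
  then show ?thesis unfolding T_def dim_substandard_cart by simp
qed

lemma subspace_T: "vec.subspace T"
  unfolding T_def by (rule vec.subspaceI) auto

lemma mem_T_iff: "x \<in> T \<longleftrightarrow> (\<forall>j\<in>{1..s}. x $ \<iota> j = 0) \<and> (\<forall>i\<in>{1..d}. x $ b i = 0)"
proof
  assume "x \<in> T"
  then show "(\<forall>j\<in>{1..s}. x $ \<iota> j = 0) \<and> (\<forall>i\<in>{1..d}. x $ b i = 0)"
    unfolding T_def using \<iota>_ne(1) a_b_ne(2) by blast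
next
  assume x: "(\<forall>j\<in>{1..s}. x $ \<iota> j = 0) \<and> (\<forall>i\<in>{1..d}. x $ b i = 0)"
  have "x $ k = 0" if "k \<notin> a ` {1..d}" for k
    by (cases k rule: coordinate_cases) (use x that in auto)
  then show "x \<in> T" unfolding T_def by blast
qed

lemma axis_a_mem_T: "i \<in> {1..d} \<Longrightarrow> axis (a i) c \<in> T"
  unfolding T_def axis_def by auto

lemma ex_nonzero_coordinate:
  assumes "x \<noteq> 0"
  shows "(\<exists>j\<in>{1..s}. x $ \<iota> j \<noteq> 0) \<or> (\<exists>i\<in>{1..d}. x $ a i \<noteq> 0) \<or> (\<exists>i\<in>{1..d}. x $ b i \<noteq> 0)"
proof (rule ccontr)
  assume n: "\<not> ?thesis"
  have "x = 0" by (rule vec_eqI) (use n in auto)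
  then show False using assms by simp
qed

text \<open>The polar form of the hyperbolic part, see \<open>hyperbolic_part_add\<close>.\<close>

definition hyp :: "'a::{field,finite} ^ 'n \<Rightarrow> 'a ^ 'n \<Rightarrow> 'a" where
  "hyp x y = (\<Sum>i=1..d. x $ a i * y $ b i + x $ b i * y $ a i)"

lemma hyperbolic_part_alt: "hyperbolic_part \<iota> s d x = (\<Sum>i=1..d. x $ a i * x $ b i)"
  unfolding hyperbolic_part_def a_def b_def ..

lemma hyperbolic_part_add:
  "hyperbolic_part \<iota> s d (x + y) = hyperbolic_part \<iota> s d x + hyperbolic_part \<iota> s d y + hyp x y"
  unfolding hyperbolic_part_alt hyp_def by (simp add: algebra_simps sum.distrib)

lemma hyp_axis:
  assumes "i \<in> {1..d}"
  shows "hyp x (axis (a i) 1) = x $ b i" "hyp x (axis (b i) 1) = x $ a i"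
proof -
  have "hyp x (axis (a i) 1) = (\<Sum>k=1..d. if k = i then x $ b i else 0)"
    unfolding hyp_def by (rule sum.cong) (use assms a_b_ne in \<open>auto simp: axis_def\<close>)
  then show "hyp x (axis (a i) 1) = x $ b i" using assms by simp
  have "hyp x (axis (b i) 1) = (\<Sum>k=1..d. if k = i then x $ a i else 0)"
    unfolding hyp_def by (rule sum.cong) (use assms a_b_ne in \<open>auto simp: axis_def\<close>)
  then show "hyp x (axis (b i) 1) = x $ a i" using assms by simp
qed

text \<open>\<open>g\<close> is the anisotropic part and \<open>bg\<close> its polar form. Along y +
  t x with x isotropic the quadratic form is linear in t with slope \<open>B y x\<close>, whence
  \<kappa> = 1. Its vanishing on a subspace makes \<open>B\<close> vanish there by polarisation. The
  generator is \<open>T\<close>: a vector perpendicular to it has zero \<open>b\<close> coordinates,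
  and if it is isotropic, anisotropy of \<open>g\<close> kills the leading ones.\<close>

lemma polar_form_quadratic:
  fixes g :: "'a::{field,finite} ^ 'n \<Rightarrow> 'a" and \<P> :: "('a ^ 'n) set set"
  assumes g_scale: "\<And>c x. g (c *s x) = c\<^sup>2 * g x" and g_add: "\<And>x y. g (x + y) = g x + g y + bg x y"
    and bg_add: "\<And>x y z. bg (x + y) z = bg x z + bg y z" and bg_scale: "\<And>c x z. bg (c *s x) z = c * bg x z"
    and bg_sym: "\<And>x y. bg x y = bg y x"
    and local: "\<And>x y. (\<And>j. j \<in> {1..s} \<Longrightarrow> x $ \<iota> j = 0) \<Longrightarrow> bg y x = 0"
      "\<And>x. (\<And>j. j \<in> {1..s} \<Longrightarrow> x $ \<iota> j = 0) \<Longrightarrow> g x = 0"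
    and aniso: "\<And>x j. g x = 0 \<Longrightarrow> j \<in> {1..s} \<Longrightarrow> x $ \<iota> j = 0"
    and \<P>: "\<P> = {S. vec.subspace S \<and> (\<forall>x\<in>S. g x + hyperbolic_part \<iota> s d x = 0)}"
    and E: "E = real CARD('a) ^ s" and "d \<ge> 1"
  shows "polar_form (\<lambda>x y. bg x y + hyp x y) (\<lambda>x. g x + hyperbolic_part \<iota> s d x = 0) 1 d (real CARD('a)) E \<P>"
proof -
  define Q where "Q x = g x + hyperbolic_part \<iota> s d x" for x
  define B where "B x y = bg x y + hyp x y" for x y
  have add: "B (x + y) z = B x z + B y z" for x y z
    unfolding B_def bg_add hyp_def by (simp add: algebra_simps sum.distrib)
  have scale: "B (c *s x) z = c * B x z" for c x z
    unfolding B_def bg_scale hyp_def by (simp add: algebra_simps sum_distrib_left)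
  have sym: "B x y = B y x" for x y
    unfolding B_def bg_sym[of x] hyp_def by (simp add: algebra_simps)
  have Q_add: "Q (x + y) = Q x + Q y + B x y" for x y
    unfolding Q_def B_def g_add hyperbolic_part_add by simp
  have Q_scale: "Q (c *s x) = c\<^sup>2 * Q x" for c x
    unfolding Q_def g_scale hyperbolic_part_alt
    by (simp add: algebra_simps sum_distrib_left power2_eq_square)
  have Q_shift: "Q (y + t *s x) = Q y + t * B y x" if "Q x = 0" for y t x
    unfolding Q_add Q_scale that using sym[of y "t *s x"] sym[of y x] scale by simp
  have P: "S \<in> \<P> \<longleftrightarrow> vec.subspace S \<and> (\<forall>x\<in>S. Q x = 0)" for S
    unfolding \<P> Q_def by simp
  have PB: "B x y = 0" if "S \<in> \<P>" "x \<in> S" "y \<in> S" for S x y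
    using Q_add[of x y] that vec.subspace_add unfolding P by force
  have B_axis: "B x (axis (a i) 1) = x $ b i" "B x (axis (b i) 1) = x $ a i" if "i \<in> {1..d}" for x i
  proof -
    have "bg x (axis (a i) 1) = 0" "bg x (axis (b i) 1) = 0"
      by (rule local(1); use \<iota>_ne that in \<open>auto simp: axis_def\<close>)+
    then show "B x (axis (a i) 1) = x $ b i" "B x (axis (b i) 1) = x $ a i"
      unfolding B_def using hyp_axis[OF that] by simp_all
  qed
  have "polar_form B (\<lambda>x. Q x = 0) 1 d (real CARD('a)) E \<P>"
  proof
    show "B (x + y) z = B x z + B y z" "B (c *s x) z = c * B x z" for x y z c by (fact add scale)+
    show "B y x = 0" if "B x y = 0" for x y using that sym by simp
    show "B x x = 0" if "Q x = 0" for x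
      using Q_shift[OF that, of x "-1"] that Q_scale[of 0 0] by simp
    show "Q (x + y) = 0" if "Q x = 0" "Q y = 0" "B x y = 0" for x y using that Q_add by simp
    show "Q (c *s x) = 0" if "Q x = 0" for x c using that Q_scale by simp
    show "\<exists>y. B y x \<noteq> 0" if "Q x = 0" "x \<noteq> 0" for x
    proof (rule ccontr)
      assume n: "\<not> ?thesis"
      then have ab: "x $ a i = 0" "x $ b i = 0" if "i \<in> {1..d}" for i
        using B_axis[OF that, of x] sym by metis+
      \<comment> \<open>Here isotropy of x enters: orthogonality to the axes kills only the
        hyperbolic coordinates, and in characteristic 2 the leading ones may lie in the radical of
        \<open>bg\<close>.\<close>
      then have "g x = 0" using that(1) unfolding Q_def hyperbolic_part_alt by simp
      then have "x $ \<iota> j = 0" if "j \<in> {1..s}" for j using aniso that by blast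
      then show False using ab ex_nonzero_coordinate[OF \<open>x \<noteq> 0\<close>] by blast
    qed
    show "card {t. Q (y + t *s x) = 0} = 1" if "Q x = 0" "B y x \<noteq> 0" for x y
    proof -
      have "Q y + t * B y x = 0 \<longleftrightarrow> t = - Q y / B y x" for t
        using that(2) by (simp add: field_simps add_eq_0_iff)
      then show ?thesis unfolding Q_shift[OF that(1)] by simp
    qed
    show "S \<in> \<P> \<longleftrightarrow> vec.subspace S \<and> (\<forall>x\<in>S. Q x = 0) \<and> (\<forall>x\<in>S. \<forall>y\<in>S. B x y = 0)" for S
      using P PB by blast
    have TP: "T \<in> \<P>"
      unfolding P
    proof (intro conjI ballI)
      fix x :: "'a ^ 'n" assume "x \<in> T"
      then have "g x = 0" "\<And>i. i \<in> {1..d} \<Longrightarrow> x $ b i = 0" using local(2) unfolding mem_T_iff by blast+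
      then show "Q x = 0" unfolding Q_def hyperbolic_part_alt by simp
    qed (rule subspace_T)
    have "S = T" if S: "S \<in> \<P>" "T \<subseteq> S" for S
    proof
      show "S \<subseteq> T"
      proof
        fix x assume x: "x \<in> S"
        have b: "x $ b i = 0" if "i \<in> {1..d}" for i
          using PB[OF S(1) x, of "axis (a i) 1"] B_axis[OF that] axis_a_mem_T[OF that] S(2) by auto
        have "Q x = 0" using x S(1) unfolding P by blast
        then have "g x = 0" unfolding Q_def hyperbolic_part_alt using b by simp
        then show "x \<in> T" unfolding mem_T_iff using aniso b by blast
      qed
    qed (rule S(2))
    then show "\<exists>G\<in>generators \<P>. vec.dim G = d" using TP dim_T unfolding generators_def by blast
    show "real 1 * real CARD('a) ^ CARD('n) = real CARD('a) ^ (2 * d) * E"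
      unfolding E card_index by (simp add: power_add)
  qed (use \<open>d \<ge> 1\<close> in auto)
  then show ?thesis unfolding Q_def B_def .
qed

end

text \<open>A zero (u, v) other than (0, 0) yields the linear factor v X - u Y, up to a scalar just
  Y if v = 0. The polynomial \<open>[:[:0, k:], [:l:]:]\<close> is k X + l Y.\<close>

lemma irreducible_binary_quadratic_anisotropic:
  fixes a b c u v :: "'a::field"
  assumes irr: "irreducible (binary_quadratic a b c)" and 0: "a * u\<^sup>2 + b * u * v + c * v\<^sup>2 = 0"
  shows "u = 0 \<and> v = 0"
proof (rule ccontr)
  assume ne: "\<not> ?thesis"
  \<comment> \<open>Units of F[X][Y] are constants, so no nonzero linear form is one.\<close>
  have unit: "\<not> is_unit [:[:0, k:], [:l:]:]" if "k \<noteq> 0 \<or> l \<noteq> 0" for k l :: 'a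
  proof
    assume "is_unit [:[:0, k:], [:l:]:]"
    then obtain e where "[:[:0, k:], [:l:]:] = [:e:]" "is_unit e" unfolding is_unit_poly_iff by blast
    then have "l = 0" "is_unit [:0, k:]" by auto
    then have "k = 0" unfolding is_unit_poly_iff by auto
    then show False using that \<open>l = 0\<close> by simp
  qed
  have "\<exists>k l k' l'. binary_quadratic a b c = [:[:0, k:], [:l:]:] * [:[:0, k':], [:l':]:]
      \<and> (k \<noteq> 0 \<or> l \<noteq> 0) \<and> (k' \<noteq> 0 \<or> l' \<noteq> 0)"
  proof (cases "v = 0")
    case True
    then have "a = 0" using 0 ne by simp
    then have f: "binary_quadratic a b c = [:[:0, 0:], [:1:]:] * [:[:0, b:], [:c:]:]"
      unfolding binary_quadratic_def by simp
    moreover have "b \<noteq> 0 \<or> c \<noteq> 0"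
    proof (rule ccontr)
      assume "\<not> ?thesis"
      then have "binary_quadratic a b c = 0" using \<open>a = 0\<close> unfolding binary_quadratic_def by simp
      then show False using irr by simp
    qed
    ultimately show ?thesis by (metis one_neq_zero)
  next
    case False
    \<comment> \<open>Comparing coefficients in (v X - u Y) (k X + l Y) gives v k = a, v l - u k = b
      and - u l = c. The first two determine k and l; the third then says that (u, v) is a
      zero.\<close>
    define k where "k = a / v"
    define l where "l = (b + u * k) / v"
    have k: "v * k = a" and l: "v * l = b + u * k" unfolding k_def l_def using False by simp_all
    have "v\<^sup>2 * (- u * l) = v\<^sup>2 * c"
    proof -
      have "v\<^sup>2 * (- u * l) = - u * v * (b + u * k)" unfolding l[symmetric] by (simp add: power2_eq_square)
      also have "\<dots> = - b * u * v - u\<^sup>2 * (v * k)" by (simp add: power2_eq_square algebra_simps)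
      also have "\<dots> = v\<^sup>2 * c" unfolding k using 0 by (simp add: algebra_simps add_eq_0_iff)
      finally show ?thesis .
    qed
    then have c: "- u * l = c" using False by (metis mult_left_cancel power_not_zero)
    have f: "binary_quadratic a b c = [:[:0, v:], [:- u:]:] * [:[:0, k:], [:l:]:]"
      unfolding binary_quadratic_def using k l c by simp
    moreover have "k \<noteq> 0 \<or> l \<noteq> 0"
    proof (rule ccontr)
      assume "\<not> ?thesis"
      then have "binary_quadratic a b c = 0" unfolding f by simp
      then show False using irr by simp
    qed
    ultimately show ?thesis using False by blast
  qed
  then show False using irreducibleD[OF irr] unit by blast
qed

context coordinates
begin

text \<open>All vectors are isotropic, so every t is counted and \<kappa> = q. The generator is
  \<open>T\<close>, which is its own perp.\<close>

lemma polar_form_symplectic: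
  fixes \<P> :: "('a::{field,finite} ^ 'n) set set"
  assumes s: "s = 0"
    and \<P>: "\<P> = {S. vec.subspace S \<and> (\<forall>x\<in>S. \<forall>y\<in>S. symplectic_form \<iota> d x y = 0)}"
    and "d \<ge> 1"
  shows "polar_form (symplectic_form \<iota> d) (\<lambda>_. True) CARD('a) d (real CARD('a)) (real CARD('a)) \<P>"
proof -
  let ?B = "symplectic_form \<iota> d :: 'a ^ 'n \<Rightarrow> _"
  have B: "?B x y = (\<Sum>i=1..d. x $ a i * y $ b i - x $ b i * y $ a i)" for x y
    unfolding symplectic_form_def a_def b_def using s by simp
  have alt: "?B y x = - ?B x y" for x y
    unfolding B sum_negf[symmetric] by (simp add: algebra_simps)
  have B_axis: "?B x (axis (a i) 1) = - (x $ b i)" "?B x (axis (b i) 1) = x $ a i" if i: "i \<in> {1..d}" for x i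
  proof -
    have "?B x (axis (a i) 1) = (\<Sum>k=1..d. if k = i then - (x $ b i) else 0)"
      unfolding B by (rule sum.cong) (use i a_b_ne in \<open>auto simp: axis_def\<close>)
    then show "?B x (axis (a i) 1) = - (x $ b i)" using i by simp
    have "?B x (axis (b i) 1) = (\<Sum>k=1..d. if k = i then x $ a i else 0)"
      unfolding B by (rule sum.cong) (use i a_b_ne in \<open>auto simp: axis_def\<close>)
    then show "?B x (axis (b i) 1) = x $ a i" using i by simp
  qed
  show ?thesis
  proof
    show "?B (x + y) z = ?B x z + ?B y z" for x y z
      unfolding B by (simp add: algebra_simps sum.distrib sum_subtractf)
    show "?B (c *s x) z = c * ?B x z" for c x z
      unfolding B by (simp add: algebra_simps sum_distrib_left)
    show "?B y x = 0" if "?B x y = 0" for x y using alt[of x y] that by simp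
    show "?B x x = 0" for x unfolding B by (simp add: mult.commute)
    show "\<exists>y. ?B y x \<noteq> 0" if "x \<noteq> 0" for x
    proof (rule ccontr)
      assume n: "\<not> ?thesis"
      then have "x $ a i = 0" "x $ b i = 0" if "i \<in> {1..d}" for i
        using B_axis[OF that, of x] alt[of x] by (metis neg_equal_0_iff_equal)+
      then show False using ex_nonzero_coordinate[OF that] s by auto
    qed
    show "S \<in> \<P> \<longleftrightarrow> vec.subspace S \<and> (\<forall>x\<in>S. True) \<and> (\<forall>x\<in>S. \<forall>y\<in>S. ?B x y = 0)" for S
      unfolding \<P> by simp
    have TP: "T \<in> \<P>"
      unfolding \<P> B using subspace_T by (simp add: mem_T_iff)
    have "S = T" if S: "S \<in> \<P>" "T \<subseteq> S" for S
    proof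
      show "S \<subseteq> T"
      proof
        fix x assume x: "x \<in> S"
        have "x $ b i = 0" if "i \<in> {1..d}" for i
        proof -
          have "?B x (axis (a i) 1) = 0" using x S axis_a_mem_T[OF that] unfolding \<P> by blast
          then show ?thesis using B_axis[OF that, of x] by simp
        qed
        then show "x \<in> T" unfolding mem_T_iff using s by auto
      qed
    qed (rule S(2))
    then show "\<exists>G\<in>generators \<P>. vec.dim G = d" using TP dim_T unfolding generators_def by blast
    show "real CARD('a) * real CARD('a) ^ CARD('n) = real CARD('a) ^ (2 * d) * real CARD('a)"
      unfolding card_index s by simp
  qed (use \<open>d \<ge> 1\<close> in auto)
qed

text \<open>For x isotropic, u = t ^ r * B y x turns isotropy of y + t x into B y y + u + u ^ r = 0,
  a trace equation with r solutions, and u determines t. A leading coordinate contributes its norm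
  to the form, so a single one is anisotropic.\<close>

lemma polar_form_hermitian:
  fixes \<P> :: "('a::{field,finite} ^ 'n) set set"
  assumes s: "s \<le> 1" and r: "CARD('a) = r\<^sup>2"
    and \<P>: "\<P> = {S. vec.subspace S \<and> (\<forall>x\<in>S. \<forall>y\<in>S. hermitian_form x y = 0)}"
    and E: "E = r * real CARD('a) ^ s" and "d \<ge> 1"
  shows "polar_form hermitian_form (\<lambda>x. hermitian_form x x = 0) r d (real CARD('a)) E \<P>"
proof -
  let ?B = "hermitian_form :: 'a ^ 'n \<Rightarrow> _"
  note r_gt1 = sqrt_card_gt1[OF r] and add_r = sqrt_card_power_add[OF r] and rr = power_sqrt_card_twice[OF r]
  have B: "?B x y = (\<Sum>k\<in>UNIV. x $ k * (y $ k) ^ r)" for x y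
    unfolding hermitian_form_def r by simp
  have zero_r: "(0::'a) ^ r = 0" using r_gt1 by simp
  have sum_r: "(\<Sum>k\<in>K. f k) ^ r = (\<Sum>k\<in>K. f k ^ r)" for f :: "'n \<Rightarrow> 'a" and K
    by (induction K rule: infinite_finite_induct) (simp_all add: zero_r add_r)
  \<comment> \<open>The r-th power is the additive involution of the field, and the form is
    symmetric up to it.\<close>
  have conj: "?B y x = ?B x y ^ r" for x y
    unfolding B sum_r by (simp add: power_mult_distrib rr mult.commute)
  have add: "?B (x + y) z = ?B x z + ?B y z" for x y z
    unfolding B by (simp add: algebra_simps sum.distrib)
  have scale: "?B (c *s x) z = c * ?B x z" for c x z
    unfolding B by (simp add: algebra_simps sum_distrib_left)
  have add': "?B z (x + y) = ?B z x + ?B z y" for x y z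
    unfolding conj[of z] add add_r by (simp add: conj[of z])
  have scale': "?B z (c *s x) = c ^ r * ?B z x" for c x z
    unfolding conj[of z] scale power_mult_distrib by (simp add: conj[of z])
  have sym: "?B y x = 0" if "?B x y = 0" for x y unfolding conj[of y x] that zero_r ..
  have B_coord: "?B x y = (\<Sum>j=1..s. x $ \<iota> j * (y $ \<iota> j) ^ r)
      + (\<Sum>i=1..d. x $ a i * (y $ a i) ^ r + x $ b i * (y $ b i) ^ r)" for x y
    unfolding B by (rule sum_coordinates)
  obtain \<epsilon> :: 'a where \<epsilon>: "\<epsilon> * \<epsilon> ^ r = - 1" using norm_eq_minus_one[OF r] by blast
  \<comment> \<open>\<open>F ` T\<close> is spanned by the vectors \<open>axis (a i) 1 + \<epsilon> *s axis (b i) 1\<close>, isotropic as \<open>\<epsilon> * \<epsilon> ^ r = - 1\<close>.\<close>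
  define F :: "'a ^ 'n \<Rightarrow> 'a ^ 'n" where
    "F t = (\<chi> k. t $ k + (\<Sum>i=1..d. if k = b i then \<epsilon> * t $ a i else 0))" for t
  have F_a: "F t $ a i = t $ a i" if "i \<in> {1..d}" for t i
  proof -
    have "(\<Sum>k=1..d. if a i = b k then \<epsilon> * t $ a k else 0) = 0"
      by (rule sum.neutral) (use that a_b_ne(1) in auto)
    then show ?thesis unfolding F_def by simp
  qed
  have F_b: "F t $ b i = t $ b i + \<epsilon> * t $ a i" if "i \<in> {1..d}" for t i
  proof -
    have "(\<Sum>k=1..d. if b i = b k then \<epsilon> * t $ a k else 0) = (\<Sum>k=1..d. if k = i then \<epsilon> * t $ a i else 0)"
      by (rule sum.cong) (use that a_b_ne(4)[OF that] in auto)
    then show ?thesis unfolding F_def using that by simp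
  qed
  have F_\<iota>: "F t $ \<iota> j = t $ \<iota> j" if "j \<in> {1..s}" for t j
  proof -
    have "(\<Sum>k=1..d. if \<iota> j = b k then \<epsilon> * t $ a k else 0) = 0"
      by (rule sum.neutral) (use that \<iota>_ne(2) in auto)
    then show ?thesis unfolding F_def by simp
  qed
  let ?G = "F ` T"
  have lin: "Vector_Spaces.linear (*s) (*s) F"
  proof (unfold Vector_Spaces.linear_iff, intro conjI allI)
    show "F (x + y) = F x + F y" for x y
      by (rule vec_eqI) (simp_all add: F_a F_b F_\<iota> algebra_simps)
    show "F (c *s x) = c *s F x" for c x
      by (rule vec_eqI) (simp_all add: F_a F_b F_\<iota> algebra_simps)
  qed (rule vec.vector_space_axioms)+
  have F_T: "F t $ \<iota> j = 0" "F t $ a i = t $ a i" "F t $ b i = \<epsilon> * t $ a i"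
    if "t \<in> T" "j \<in> {1..s}" "i \<in> {1..d}" for t i j
    using that F_a F_b F_\<iota> unfolding mem_T_iff by simp_all
  have inj: "inj_on F T"
  proof (rule inj_onI)
    fix x y assume xy: "x \<in> T" "y \<in> T" "F x = F y"
    show "x = y"
    proof (rule vec_eqI)
      show "x $ a i = y $ a i" if "i \<in> {1..d}" for i using F_a[OF that] xy(3) by metis
    qed (use xy in \<open>simp_all add: mem_T_iff\<close>)
  qed
  have dimG: "vec.dim ?G = d"
    using vec.dim_image_eq[OF lin, of T] inj
    unfolding vec.span_eq_iff[THEN iffD2, OF subspace_T] dim_T by blast
  have subG: "vec.subspace ?G" using vec.linear_subspace_image[OF lin subspace_T] .
  have G_iff: "x \<in> ?G \<longleftrightarrow> (\<forall>j\<in>{1..s}. x $ \<iota> j = 0) \<and> (\<forall>i\<in>{1..d}. x $ b i = \<epsilon> * x $ a i)" for x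
  proof
    assume "x \<in> ?G"
    then obtain t where "t \<in> T" "x = F t" by blast
    then show "(\<forall>j\<in>{1..s}. x $ \<iota> j = 0) \<and> (\<forall>i\<in>{1..d}. x $ b i = \<epsilon> * x $ a i)"
      by (simp add: F_a F_b F_\<iota> mem_T_iff)
  next
    assume x: "(\<forall>j\<in>{1..s}. x $ \<iota> j = 0) \<and> (\<forall>i\<in>{1..d}. x $ b i = \<epsilon> * x $ a i)"
    define t where "t = (\<chi> k. if k \<in> a ` {1..d} then x $ k else 0)"
    have "t \<in> T" unfolding T_def t_def by simp
    moreover have ta: "t $ a i = x $ a i" if "i \<in> {1..d}" for i unfolding t_def using that by simp
    ultimately have "x = F t"
      by (intro vec_eqI) (use x in \<open>simp_all add: F_a F_b F_\<iota> mem_T_iff\<close>)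
    then show "x \<in> ?G" using \<open>t \<in> T\<close> by blast
  qed
  have GB: "?B x y = (\<Sum>j=1..s. x $ \<iota> j * (y $ \<iota> j) ^ r)"
    if xy: "\<And>i. i \<in> {1..d} \<Longrightarrow> x $ b i = \<epsilon> * x $ a i" "\<And>i. i \<in> {1..d} \<Longrightarrow> y $ b i = \<epsilon> * y $ a i" for x y
  proof -
    have "x $ a i * (y $ a i) ^ r + x $ b i * (y $ b i) ^ r = 0" if i: "i \<in> {1..d}" for i
    proof -
      have "x $ b i * (y $ b i) ^ r = (\<epsilon> * \<epsilon> ^ r) * (x $ a i * (y $ a i) ^ r)"
        using xy[OF i] by (simp add: power_mult_distrib)
      then show ?thesis unfolding \<epsilon> by simp
    qed
    then show ?thesis unfolding B_coord by simp
  qed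
  show ?thesis
  proof
    show "?B (x + y) z = ?B x z + ?B y z" "?B (c *s x) z = c * ?B x z" for x y z c by (fact add scale)+
    show "?B y x = 0" if "?B x y = 0" for x y by (rule sym[OF that])
    show "?B (x + y) (x + y) = 0" if "?B x x = 0" "?B y y = 0" "?B x y = 0" for x y
      using that sym[OF that(3)] by (simp add: add add')
    show "?B (c *s x) (c *s x) = 0" if "?B x x = 0" for x c using that by (simp add: scale scale')
    show "\<exists>y. ?B y x \<noteq> 0" if "x \<noteq> 0" for x
    proof -
      obtain k where k: "x $ k \<noteq> 0" using \<open>x \<noteq> 0\<close> by (auto simp: vec_eq_iff)
      have "?B (axis k 1) x = (\<Sum>l\<in>UNIV. if l = k then (x $ k) ^ r else 0)"
        unfolding B by (rule sum.cong) (auto simp: axis_def)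
      then show ?thesis using k by (intro exI[of _ "axis k 1"]) simp
    qed
    show "card {t. ?B (y + t *s x) (y + t *s x) = 0} = r" if x: "?B x x = 0" and ne: "?B y x \<noteq> 0" for x y
    proof -
      let ?f = "\<lambda>t::'a. t ^ r * ?B y x"
      have "?B (y + t *s x) (y + t *s x) = ?B y y + ?f t + (?f t) ^ r" for t
        unfolding add add' scale scale' x conj[of x y] by (simp add: power_mult_distrib rr algebra_simps)
      then have "card {t. ?B (y + t *s x) (y + t *s x) = 0} = card {t \<in> UNIV. ?B y y + ?f t + (?f t) ^ r = 0}"
        by simp
      also have "bij_betw ?f UNIV UNIV"
      proof -
        have "inj ?f"
        proof (rule injI)
          fix t u assume "?f t = ?f u"
          then have "t ^ r = u ^ r" using ne by simp
          then show "t = u" using rr by metis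
        qed
        then show ?thesis by (simp add: bij_betw_def finite_UNIV_inj_surj)
      qed
      then have "card {t \<in> UNIV. ?B y y + ?f t + (?f t) ^ r = 0} = card {u \<in> UNIV. ?B y y + u + u ^ r = 0}"
        by (rule card_bij_filter)
      also have "\<dots> = r" using card_trace_fibre[OF r conj[of y y, symmetric]] by simp
      finally show ?thesis .
    qed
    show "S \<in> \<P> \<longleftrightarrow> vec.subspace S \<and> (\<forall>x\<in>S. ?B x x = 0) \<and> (\<forall>x\<in>S. \<forall>y\<in>S. ?B x y = 0)" for S
      unfolding \<P> by blast
    have GP: "?G \<in> \<P>"
    proof -
      have "?B x y = 0" if "x \<in> ?G" "y \<in> ?G" for x y
        using that unfolding G_iff by (subst GB) simp_all
      then show ?thesis unfolding \<P> using subG by simp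
    qed
    have "S = ?G" if S: "S \<in> \<P>" "?G \<subseteq> S" for S
    proof
      show "S \<subseteq> ?G"
      proof
        fix x assume x: "x \<in> S"
        have b: "x $ b i = \<epsilon> * x $ a i" if i: "i \<in> {1..d}" for i
        proof -
          let ?e = "F (axis (a i) 1)"
          have e: "?e \<in> ?G" using axis_a_mem_T[OF i] by blast
          then have "?e \<in> S" using S(2) by blast
          then have 0: "?B x ?e = 0" using x S(1) unfolding \<P> by simp
          have "x $ a k * (?e $ a k) ^ r + x $ b k * (?e $ b k) ^ r
              = (if k = i then x $ a i + x $ b i * \<epsilon> ^ r else 0)" if k: "k \<in> {1..d}" for k
          proof -
            have "axis (a i) 1 $ a k = (if k = i then 1 else (0::'a))" "axis (a i) 1 $ b k = (0::'a)"
              using a_b_ne(1)[OF i k] a_b_ne(3)[OF k i] by (auto simp: axis_def)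
            then show ?thesis unfolding F_a[OF k] F_b[OF k] by (simp add: zero_r)
          qed
          moreover have "?e $ \<iota> j = 0" if "j \<in> {1..s}" for j using e that unfolding G_iff by blast
          \<comment> \<open>Only the i-th pair survives, where the test vector has the entries 1 and
            \<epsilon>. Multiplying by \<epsilon> will turn the condition into the equation that
            describes the generator.\<close>
          ultimately have "?B x ?e = x $ a i + x $ b i * \<epsilon> ^ r" unfolding B_coord using i by (simp add: zero_r)
          then have "\<epsilon> * (x $ a i + x $ b i * \<epsilon> ^ r) = 0" using 0 by simp
          then have "\<epsilon> * x $ a i + x $ b i * (\<epsilon> * \<epsilon> ^ r) = 0" by (simp add: algebra_simps)
          then show ?thesis unfolding \<epsilon> by simp
        qed
        have "x $ \<iota> j = 0" if j: "j \<in> {1..s}" for j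
        proof -
          \<comment> \<open>There is only one leading coordinate, and \<open>B x x\<close> reduces
            to its norm, which vanishes only with it.\<close>
          have "s = 1" "j = 1" using s j by auto
          moreover have "?B x x = 0" using x S unfolding \<P> by blast
          ultimately show ?thesis using GB[OF b b] by auto
        qed
        then show "x \<in> ?G" unfolding G_iff using b by blast
      qed
    qed (rule S(2))
    then show "\<exists>G\<in>generators \<P>. vec.dim G = d" using GP dimG unfolding generators_def by blast
    show "real r * real CARD('a) ^ CARD('n) = real CARD('a) ^ (2 * d) * E"
      unfolding E card_index by (simp add: power_add)
  qed (use \<open>d \<ge> 1\<close> r_gt1 in auto)
qed

end

text \<open>In all cases q ^ e is \<kappa> * q ^ s with s the number of leading coordinates; this is
  where the half-integers of the Hermitian types come from, as there \<kappa> is the square root of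
  q.\<close>

lemma ex_polar_form:
  fixes ty :: "'a::{field,finite} polar_type" and \<iota> :: "nat \<Rightarrow> 'n::finite"
  assumes "d \<ge> 1" and adm: "polar_admissible ty" and dim: "CARD('n) = polar_dim ty d"
    and \<iota>: "bij_betw \<iota> {1..CARD('n)} UNIV"
  shows "\<exists>(B :: 'a ^ 'n \<Rightarrow> 'a ^ 'n \<Rightarrow> 'a) iso \<kappa>.
    polar_form B iso \<kappa> d (real CARD('a)) (real CARD('a) powr polar_e ty) (polar_space ty d \<iota>)"
proof -
  have coord: "coordinates \<iota> s d" if "CARD('n) = s + 2 * d" for s
    using \<iota> that by unfold_locales
  have q0: "real CARD('a) > 0" by simp
  show ?thesis
  proof (cases ty)
    case O_plus
    interpret coordinates \<iota> 0 d using coord dim O_plus by simp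
    have "polar_form (\<lambda>x y. 0 + hyp x y) (\<lambda>x. 0 + hyperbolic_part \<iota> 0 d x = 0) 1 d (real CARD('a))
      (real CARD('a) powr polar_e ty) (polar_space ty d \<iota> :: ('a ^ 'n) set set)"
      by (rule polar_form_quadratic) (use \<open>d \<ge> 1\<close> O_plus in \<open>auto simp: polar_space_def\<close>)
    then show ?thesis by blast
  next
    case O_parabolic
    interpret coordinates \<iota> 1 d using coord dim O_parabolic by simp
    have "polar_form (\<lambda>x y. 2 * x $ \<iota> 1 * y $ \<iota> 1 + hyp x y)
      (\<lambda>x. (x $ \<iota> 1)\<^sup>2 + hyperbolic_part \<iota> 1 d x = 0) 1 d (real CARD('a))
      (real CARD('a) powr polar_e ty) (polar_space ty d \<iota> :: ('a ^ 'n) set set)"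
      by (rule polar_form_quadratic)
        (use \<open>d \<ge> 1\<close> O_parabolic in \<open>auto simp: polar_space_def power2_eq_square algebra_simps\<close>)
    then show ?thesis by blast
  next
    case (O_minus a b c)
    interpret coordinates \<iota> 2 d using coord dim O_minus by simp
    have irr: "irreducible (binary_quadratic a b c)" using adm O_minus by simp
    have "polar_form
      (\<lambda>x y. (2 * a * x $ \<iota> 1 * y $ \<iota> 1 + b * (x $ \<iota> 1 * y $ \<iota> 2 + x $ \<iota> 2 * y $ \<iota> 1) + 2 * c * x $ \<iota> 2 * y $ \<iota> 2)
        + hyp x y)
      (\<lambda>x. (a * (x $ \<iota> 1)\<^sup>2 + b * x $ \<iota> 1 * x $ \<iota> 2 + c * (x $ \<iota> 2)\<^sup>2) + hyperbolic_part \<iota> 2 d x = 0)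
      1 d (real CARD('a)) (real CARD('a) powr polar_e ty) (polar_space ty d \<iota> :: ('a ^ 'n) set set)"
    proof (rule polar_form_quadratic)
      fix x :: "'a ^ 'n" and j :: nat
      assume 0: "a * (x $ \<iota> 1)\<^sup>2 + b * x $ \<iota> 1 * x $ \<iota> 2 + c * (x $ \<iota> 2)\<^sup>2 = 0" and "j \<in> {1..2}"
      then have "j = 1 \<or> j = 2" by auto
      then show "x $ \<iota> j = 0" using irreducible_binary_quadratic_anisotropic[OF irr 0] by blast
    qed (use \<open>d \<ge> 1\<close> O_minus in \<open>auto simp: polar_space_def power2_eq_square algebra_simps\<close>)
    then show ?thesis by blast
  next
    case Symplectic
    interpret coordinates \<iota> 0 d using coord dim Symplectic by simp
    have "polar_form (symplectic_form \<iota> d) (\<lambda>_. True) CARD('a) d (real CARD('a))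
      (real CARD('a)) (polar_space ty d \<iota> :: ('a ^ 'n) set set)"
      by (rule polar_form_symplectic) (use \<open>d \<ge> 1\<close> Symplectic in \<open>auto simp: polar_space_def\<close>)
    then show ?thesis using Symplectic by auto
  next
    case U_even
    interpret coordinates \<iota> 0 d using coord dim U_even by simp
    obtain r where r: "CARD('a) = r\<^sup>2" using adm U_even by auto
    have "polar_form hermitian_form (\<lambda>x. hermitian_form x x = 0) r d (real CARD('a))
      (real CARD('a) powr polar_e ty) (polar_space ty d \<iota> :: ('a ^ 'n) set set)"
    proof (rule polar_form_hermitian[OF _ r])
      have "real CARD('a) powr polar_e ty = sqrt (real CARD('a))" using U_even by (simp add: powr_half_sqrt)
      then show "real CARD('a) powr polar_e ty = real r * real CARD('a) ^ 0" unfolding r by simp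
    qed (use \<open>d \<ge> 1\<close> U_even in \<open>auto simp: polar_space_def\<close>)
    then show ?thesis by blast
  next
    case U_odd
    interpret coordinates \<iota> 1 d using coord dim U_odd by simp
    obtain r where r: "CARD('a) = r\<^sup>2" using adm U_odd by auto
    have "polar_form hermitian_form (\<lambda>x. hermitian_form x x = 0) r d (real CARD('a))
      (real CARD('a) powr polar_e ty) (polar_space ty d \<iota> :: ('a ^ 'n) set set)"
    proof (rule polar_form_hermitian[OF _ r])
      have "real CARD('a) powr polar_e ty = real CARD('a) powr (1 / 2 + 1)" using U_odd by simp
      also have "\<dots> = sqrt (real CARD('a)) * real CARD('a)"
        unfolding powr_add by (simp add: powr_half_sqrt)
      finally show "real CARD('a) powr polar_e ty = real r * real CARD('a) ^ 1" unfolding r by simp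
    qed (use \<open>d \<ge> 1\<close> U_odd in \<open>auto simp: polar_space_def\<close>)
    then show ?thesis by blast
  qed
qed

context polar_form
begin

text \<open>All powers of q become q ^ d or q ^ d * E divided by small powers of q, which leaves
  rational identities that also hold for d = 1.\<close>

lemma parameters:
  assumes E: "E = q powr e"
  shows "(q powr (real d - 1 + e) + 1) * qbracket q (int d) = orth_npt 0"
    "q * (q powr (real d - 2 + e) + 1) * qbracket q (int d - 1) = orth_npt 1 - 1"
    "q - 1 + q\<^sup>2 * (q powr (real d - 3 + e) + 1) * qbracket q (int d - 2) = orth_npt 2 - 2"
    "(q powr (real d - 2 + e) + 1) * qbracket q (int d - 1) = orth_npt' 1"
proof -
  have p: "q powr (real d - 1 + e) = q ^ d * E / q" "q powr (real d - 2 + e) = q ^ d * E / q ^ 2"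
    "q powr (real d - 3 + e) = q ^ d * E / q ^ 3"
    using q_gt1 by (simp_all add: E powr_add powr_diff powr_realpow)
  have b: "qbracket q (int d) = (q ^ d - 1) / (q - 1)" "qbracket q (int d - 1) = (q ^ d / q - 1) / (q - 1)"
    "qbracket q (int d - 2) = (q ^ d / q ^ 2 - 1) / (q - 1)"
    using q_gt1 by (simp_all add: qbracket_def power_int_diff)
  have "q - 1 \<noteq> 0" "q \<noteq> 0" using q_gt1 by auto
  then show "(q powr (real d - 1 + e) + 1) * qbracket q (int d) = orth_npt 0"
    "q * (q powr (real d - 2 + e) + 1) * qbracket q (int d - 1) = orth_npt 1 - 1"
    "q - 1 + q\<^sup>2 * (q powr (real d - 3 + e) + 1) * qbracket q (int d - 2) = orth_npt 2 - 2"
    "(q powr (real d - 2 + e) + 1) * qbracket q (int d - 1) = orth_npt' 1"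
    unfolding p b orth_npt_def orth_npt'_def
    by (simp_all add: divide_simps) (simp_all add: algebra_simps eval_nat_numeral)
qed

end

theorem theorem3p3:
  fixes ty :: "'a::{field,finite} polar_type"
    and \<iota> :: "nat \<Rightarrow> 'n::finite"
    and d N :: nat
    and \<P> :: "('a ^ 'n) set set"
    and L :: "('a ^ 'n) set"
    and P :: "nat \<Rightarrow> ('a ^ 'n) set"
    and \<sigma> :: "nat \<Rightarrow> ('a ^ 'n) set set \<Rightarrow> ('a ^ 'n) set set"
    and q e :: real
  assumes "q = real CARD('a)" and "e = polar_e ty"
    and "d \<ge> 1"
    and "polar_admissible ty"
    and "CARD('n) = polar_dim ty d"
    and "bij_betw \<iota> {1..CARD('n)} UNIV"
    and "\<P> = polar_space ty d \<iota>"
    and "L \<in> \<P>" and "vec.dim L = d - 1"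
    and "bij_betw P {1..N} {G \<in> generators \<P>. L \<subseteq> G}"
    and "\<And>i. i \<in> {1..N} \<Longrightarrow> parallel_preserving_permutation \<P> d L (P i) (\<sigma> i)"
  shows "strongly_regular (points \<P>) (Gamma_adjacent \<P> L N P \<sigma>)
           ((q powr (real d - 1 + e) + 1) * qbracket q (int d))
           (q * (q powr (real d - 2 + e) + 1) * qbracket q (int d - 1))
           (q - 1 + q\<^sup>2 * (q powr (real d - 3 + e) + 1) * qbracket q (int d - 2))
           ((q powr (real d - 2 + e) + 1) * qbracket q (int d - 1))"
proof -
  obtain B :: "'a ^ 'n \<Rightarrow> 'a ^ 'n \<Rightarrow> 'a" and iso \<kappa> where "polar_form B iso \<kappa> d q (q powr e) \<P>"
    using ex_polar_form[OF assms(3-6)] unfolding assms(1,2,7) by blast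
  then interpret pf: polar_form B iso \<kappa> d q "q powr e" \<P> .
  interpret ps: polar_switching B iso \<kappa> d q "q powr e" \<P> L "{1..N}" P
    by unfold_locales (use assms(8-10) in simp_all)
  have "Gamma_adjacent \<P> L N P \<sigma> x y \<longleftrightarrow> ps.sw.adj \<sigma> x y" if "x \<in> points \<P>" "y \<in> points \<P>" for x y
  proof -
    \<comment> \<open>The trace in the definition of the graph and \<open>tr_of\<close> differ only
      in how perpendicularity is expressed.\<close>
    have tr: "perp \<P> z \<inter> affine_part \<P> L (P i) = ps.sw.tr_of i z" if "z \<in> points \<P>" for z i
      unfolding ps.sw.tr_of_def ps.A_def
      using pf.mem_perp_point[OF _ that] unfolding affine_part_def points_of_def by blast
    show ?thesis
      unfolding Gamma_adjacent_def affine_adjacent_def ps.sw.adj_def Let_def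
        ps.Z_def[symmetric] ps.A_def[symmetric] tr[unfolded ps.A_def[symmetric], OF that(1)]
        tr[unfolded ps.A_def[symmetric], OF that(2)] pf.mem_perp_point[OF that] ..
  qed
  then show ?thesis
    unfolding pf.parameters[OF refl]
    using ps.switched_graph[of \<sigma>] assms(11) strongly_regular_cong by blast
qed

end
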